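(* Every weakly $6$-balanced looped simple graph is globally $\mathcal{L}_2$-rigid (i.e. globally $2$-rigid as a linearly constrained framework).
   Context: A looped simple graph $G=(V,E,L)$ has vertex set $V$, a set $E$ of simple edges (no multiple edges) and a set $L$ of loops (a vertex may carry several loops). For $T\subseteq V$, $G-T$ deletes the vertices of $T$ with all incident edges and loops. $G$ is weakly $k$-balanced if for every $T\subseteq V$ with $|T|\leq k$, every connected component of $G-T$ contains at least $k-|T|$ loops. A linearly constrained framework $(G,p,q)$ in $\mathbb{R}^d$ consists of $G$, $p:V\to\mathbb{R}^d$, $q:L\to\mathbb{R}^d$; it is generic if all coordinates of $p$ and $q$ are algebraically independent over $\mathbb{Q}$. Two frameworks $(G,p,q)$ and $(G,\tilde p,q)$ are equivalent if $\|p(u)-p(v)\|^2=\|\tilde p(u)-\tilde p(v)\|^2$ for all $uv\in E$ and $p(v)\cdot q(e)=\tilde p(v)\cdot q(e)$ for every loop $e$ at every vertex $v$. $(G,p,q)$ is globally rigid if the only framework equivalent to it is itself. $G$ is globally $\mathcal{L}_d$-rigid if it has a generic realisation in $\mathbb{R}^d$ that is globally rigid. *)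

theory Defs
  imports "HOL-Analysis.Analysis" "HOL-Library.Poly_Mapping"
begin

text \<open>Loops are named, so that a vertex may carry several of them; edges are two-element
  sets of vertices, so that there are no multiple edges.\<close>

record ('v, 'l) looped_graph =
  verts :: "'v set"
  edges :: "'v set set"
  loops :: "'l set"
  loop_at :: "'l \<Rightarrow> 'v"

locale looped_simple_graph =
  fixes G :: "('v, 'l) looped_graph"
  assumes finite_verts: "finite (verts G)"
    and finite_loops: "finite (loops G)"
    and edge_subset: "e \<in> edges G \<Longrightarrow> e \<subseteq> verts G"
    and edge_card: "e \<in> edges G \<Longrightarrow> card e = 2"
    and loop_at_verts: "l \<in> loops G \<Longrightarrow> loop_at G l \<in> verts G"

definition delete_verts :: "('v, 'l) looped_graph \<Rightarrow> 'v set \<Rightarrow> ('v, 'l) looped_graph" where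
  "delete_verts G T =
    \<lparr> verts = verts G - T,
      edges = {e \<in> edges G. e \<inter> T = {}},
      loops = {l \<in> loops G. loop_at G l \<notin> T},
      loop_at = loop_at G \<rparr>"

definition connectivity :: "('v, 'l) looped_graph \<Rightarrow> ('v \<times> 'v) set" where
  "connectivity G = {(u, v) \<in> verts G \<times> verts G. (u, v) \<in> {(x, y). {x, y} \<in> edges G}\<^sup>*}"

text \<open>A connected component is represented by its vertex set; its loops are those of the
  graph at vertices of that set.\<close>

definition components :: "('v, 'l) looped_graph \<Rightarrow> 'v set set" where
  "components G = verts G // connectivity G"

definition loops_in :: "('v, 'l) looped_graph \<Rightarrow> 'v set \<Rightarrow> 'l set" where
  "loops_in G C = {l \<in> loops G. loop_at G l \<in> C}"

definition weakly_balanced :: "nat \<Rightarrow> ('v, 'l) looped_graph \<Rightarrow> bool" where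
  "weakly_balanced k G \<longleftrightarrow>
    (\<forall>T \<subseteq> verts G. card T \<le> k \<longrightarrow>
      (\<forall>C \<in> components (delete_verts G T).
        card (loops_in (delete_verts G T) C) \<ge> k - card T))"

text \<open>A polynomial with rational coefficients in the variables \<open>x\<^sub>i\<close> is a finitely supported map
  from monomials to coefficients, a monomial being a finitely supported map from indices
  to exponents.\<close>

definition eval_poly :: "('i \<Rightarrow> real) \<Rightarrow> (('i \<Rightarrow>\<^sub>0 nat) \<Rightarrow>\<^sub>0 rat) \<Rightarrow> real" where
  "eval_poly c P =
    (\<Sum>m \<in> Poly_Mapping.keys P. of_rat (Poly_Mapping.lookup P m) *
      (\<Prod>i \<in> Poly_Mapping.keys m. c i ^ Poly_Mapping.lookup m i))"

text \<open>Independence is that of the family \<open>(c i)\<close> for \<open>i \<in> I\<close>; in particular, its members are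
  distinct.\<close>

definition algebraically_independent_over_rat :: "'i set \<Rightarrow> ('i \<Rightarrow> real) \<Rightarrow> bool" where
  "algebraically_independent_over_rat I c \<longleftrightarrow>
    (\<forall>P :: ('i \<Rightarrow>\<^sub>0 nat) \<Rightarrow>\<^sub>0 rat.
      (\<forall>m \<in> Poly_Mapping.keys P. Poly_Mapping.keys m \<subseteq> I) \<longrightarrow> eval_poly c P = 0 \<longrightarrow> P = 0)"

text \<open>A framework \<open>(G, p, q)\<close> in dimension \<open>CARD('d)\<close> is given by functions on the whole
  types \<open>'v\<close> and \<open>'l\<close>, of which only the values on the vertices and loops of \<open>G\<close> matter.\<close>

fun coordinate ::
  "('v \<Rightarrow> real ^ 'd) \<Rightarrow> ('l \<Rightarrow> real ^ 'd) \<Rightarrow> ('v + 'l) \<times> 'd \<Rightarrow> real" where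
  "coordinate p q (Inl v, j) = p v $ j"
| "coordinate p q (Inr l, j) = q l $ j"

definition generic_framework ::
  "('v, 'l) looped_graph \<Rightarrow> ('v \<Rightarrow> real ^ 'd) \<Rightarrow> ('l \<Rightarrow> real ^ 'd) \<Rightarrow> bool" where
  "generic_framework G p q \<longleftrightarrow>
    algebraically_independent_over_rat ((verts G <+> loops G) \<times> UNIV) (coordinate p q)"

definition equivalent_frameworks ::
  "('v, 'l) looped_graph \<Rightarrow> ('v \<Rightarrow> real ^ 'd) \<Rightarrow> ('v \<Rightarrow> real ^ 'd) \<Rightarrow>
    ('l \<Rightarrow> real ^ 'd) \<Rightarrow> bool" where
  "equivalent_frameworks G p p' q \<longleftrightarrow>
    (\<forall>u v. {u, v} \<in> edges G \<longrightarrow> (norm (p u - p v))\<^sup>2 = (norm (p' u - p' v))\<^sup>2) \<and>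
    (\<forall>l \<in> loops G. p (loop_at G l) \<bullet> q l = p' (loop_at G l) \<bullet> q l)"

definition globally_rigid_framework ::
  "('v, 'l) looped_graph \<Rightarrow> ('v \<Rightarrow> real ^ 'd) \<Rightarrow> ('l \<Rightarrow> real ^ 'd) \<Rightarrow> bool" where
  "globally_rigid_framework G p q \<longleftrightarrow>
    (\<forall>p'. equivalent_frameworks G p p' q \<longrightarrow> (\<forall>v \<in> verts G. p' v = p v))"

text \<open>The dimension is passed as a type: \<open>globally_L_rigid TYPE('d) G\<close> concerns realisations in
  Euclidean space of dimension \<open>CARD('d)\<close>.\<close>

definition globally_L_rigid :: "'d::finite itself \<Rightarrow> ('v, 'l) looped_graph \<Rightarrow> bool" where
  "globally_L_rigid _ G \<longleftrightarrow>
    (\<exists>(p :: 'v \<Rightarrow> real ^ 'd) (q :: 'l \<Rightarrow> real ^ 'd).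
      generic_framework G p q \<and> globally_rigid_framework G p q)"

end

theory Submission
  imports Defs
begin

text \<open>
  Global rigidity of an infinitesimally rigid framework persists under small perturbations, so it
  suffices to find one such framework that is globally rigid, generic or not. Write \<open>surplus C\<close>
  for the number of neighbours of a vertex set \<open>C\<close> plus the number of its loops; a weakly
  6-balanced graph has \<open>surplus C \<ge> 6\<close> for every nonempty \<open>C\<close>, and this is all that is used.

  The proof is by induction on the number of vertices. If \<open>G - w\<close> is infinitesimally rigid, then
  for suitable positions of its vertices it has only finitely many equivalent placements, by
  Perron's theorem on algebraic dependence. Placing \<open>w\<close> outside finitely many curves then forces
  the neighbours of \<open>w\<close> to keep their distances, and even their positions if \<open>w\<close> has a loop. So \<open>G\<close> may
  be replaced by \<open>G - w\<close> with a clique, or with six new loops at each vertex, on the neighbours of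
  \<open>w\<close>; both operations preserve the surplus condition.

  That \<open>G - w\<close> is infinitesimally rigid for \<open>w\<close> in a minimal set of surplus 6 follows, as in
  Villanyi's proof for bar-joint frameworks, by adding the vertices in a random order to the
  closure of \<open>G - w\<close>: each vertex raises the rank by one for each of its first two links, and by one
  more if it has three that do not lie in a rigid body (a 1-extension). The expected gains add up to
  more than \<open>2n - 1\<close>.
\<close>

section \<open>Polynomial functions of configurations\<close>

text \<open>The constant 6 comes from the expected rank. A loopless vertex whose j links do not lie
  in a single rigid body gains at least 5/2 - 3/j on average, which covers its own two coordinates
  exactly at j = 6; a loop counts as one more link and leaves an excess of 1/2. Deleting
  \<open>w\<close> can cost a vertex one of six links and hence 1/10. This affects at most 30
  vertices: each is assigned to one of the at most six neighbours of the minimal set of surplus 6,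
  and each neighbour accounts for at most five. The total defect 3 is set against an excess of 1/2
  at five or more vertices, which carry a loop or are already immobile, so that less than one degree
  of freedom remains. Two devices make this count possible. Links are all pairs whose distance is
  infinitesimally preserved, not only the edges, so that a loopless vertex preceded by three or more
  links misses the third unit only if these form a clique. Vertices all of whose links form a clique
  are left out of the random order, since they merely follow the body that contains them.\<close>

definition towards :: "('c \<Rightarrow> 'b::real_vector) \<Rightarrow> ('c \<Rightarrow> 'b) \<Rightarrow> real \<Rightarrow> 'c \<Rightarrow> 'b" where
  "towards X Y t = (\<lambda>a. X a + t *\<^sub>R (Y a - X a))"

text \<open>Continuity and polynomial dependence along every line are all that is asked of a
  polynomial here: they make the nonzeros of a map that is not identically zero open and
  dense.\<close>

definition polynomial_map :: "(('c \<Rightarrow> 'b::real_normed_vector) \<Rightarrow> real) \<Rightarrow> bool" where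
  "polynomial_map f \<longleftrightarrow>
    continuous_on UNIV f \<and> (\<forall>X Y. \<exists>P. \<forall>t. f (towards X Y t) = poly P t)"

lemma polynomial_map_const: "polynomial_map (\<lambda>X. c)"
  unfolding polynomial_map_def by (auto intro!: exI[of _ "[:c:]"])

lemma polynomial_map_add:
  assumes "polynomial_map f" "polynomial_map g"
  shows "polynomial_map (\<lambda>X. f X + g X)"
  using assms unfolding polynomial_map_def
  by (auto intro: continuous_on_add) (metis poly_add)

lemma polynomial_map_mult:
  assumes "polynomial_map f" "polynomial_map g"
  shows "polynomial_map (\<lambda>X. f X * g X)"
  using assms unfolding polynomial_map_def
  by (auto intro: continuous_on_mult) (metis poly_mult)

lemma polynomial_map_diff:
  assumes "polynomial_map f" "polynomial_map g"
  shows "polynomial_map (\<lambda>X. f X - g X)"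
  using assms unfolding polynomial_map_def
  by (auto intro: continuous_on_diff) (metis poly_diff)

lemma polynomial_map_component: "polynomial_map (\<lambda>X :: 'c \<Rightarrow> real ^ 'd. X a $ j)"
  unfolding polynomial_map_def
proof (intro conjI allI)
  show "continuous_on UNIV (\<lambda>X :: 'c \<Rightarrow> real ^ 'd. X a $ j)"
    by (intro continuous_intros continuous_on_product_coordinates)
  show "\<exists>P. \<forall>t. towards X Y t a $ j = poly P t" for X Y :: "'c \<Rightarrow> real ^ 'd"
    by (rule exI[of _ "[:X a $ j, Y a $ j - X a $ j:]"]) (simp add: towards_def algebra_simps)
qed

lemmas polynomial_map_intros =
  polynomial_map_const polynomial_map_add polynomial_map_mult polynomial_map_diff
  polynomial_map_component

lemma towards_continuous: "continuous_on UNIV (towards X (Y :: 'c \<Rightarrow> 'b::real_normed_vector))"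
  unfolding towards_def by (intro continuous_on_coordinatewise_then_product continuous_intros)

text \<open>On the line from a point of the open set to a nonzero of \<open>f s\<close>, only
  finitely many parameters are roots, while infinitely many stay in the open set. Shrinking the open
  set to the nonzeros of \<open>f s\<close> prepares the next map.\<close>

lemma polynomial_maps_avoid:
  fixes \<Omega> :: "('c \<Rightarrow> 'b::real_normed_vector) set"
  assumes "finite S" "open \<Omega>" "X0 \<in> \<Omega>"
    and "\<And>s. s \<in> S \<Longrightarrow> polynomial_map (f s)" "\<And>s. s \<in> S \<Longrightarrow> \<exists>Y. f s Y \<noteq> 0"
  shows "\<exists>X\<in>\<Omega>. \<forall>s\<in>S. f s X \<noteq> 0"
  using assms
proof (induction S arbitrary: \<Omega> X0 rule: finite_induct)
  case empty
  then show ?case by blast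
next
  case (insert s S)
  obtain Y where Y: "f s Y \<noteq> 0" using insert.prems(4) by blast
  have cont: "continuous_on UNIV (f s)" and pol: "\<exists>P. \<forall>t. f s (towards X0 Y t) = poly P t"
    using insert.prems(3)[of s] unfolding polynomial_map_def by auto
  obtain P where P: "\<And>t. f s (towards X0 Y t) = poly P t" using pol by blast
  have "towards X0 Y 1 = Y" "towards X0 Y 0 = X0" by (auto simp: towards_def)
  then have "poly P 1 \<noteq> 0" using P[of 1] Y by simp
  then have "P \<noteq> 0" by auto
  then have fin: "finite {t. poly P t = 0}" by (rule poly_roots_finite)
  have "open (towards X0 Y -` \<Omega>)"
    using towards_continuous insert.prems(1) by (metis open_vimage)
  moreover have "0 \<in> towards X0 Y -` \<Omega>"
    using \<open>towards X0 Y 0 = X0\<close> insert.prems(2) by simp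
  ultimately have "infinite (towards X0 Y -` \<Omega>)"
    using finite_imp_not_open by blast
  then obtain t where t: "t \<in> towards X0 Y -` \<Omega>" "poly P t \<noteq> 0"
    using fin by (metis (mono_tags, lifting) mem_Collect_eq rev_finite_subset subsetI)
  have "open {X. f s X \<noteq> 0}"
    using open_vimage[OF _ cont, of "- {0}"] by (simp add: vimage_def open_Compl)
  then have "open (\<Omega> \<inter> {X. f s X \<noteq> 0})" using insert.prems(1) by blast
  moreover have "towards X0 Y t \<in> \<Omega> \<inter> {X. f s X \<noteq> 0}" using t P by simp
  ultimately show ?case
    using insert.IH[of "\<Omega> \<inter> {X. f s X \<noteq> 0}" "towards X0 Y t"] insert.prems(3,4) by auto
qed

section \<open>Linear systems whose coefficients are polynomials\<close>

definition injective_system ::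
  "'a set \<Rightarrow> 'r set \<Rightarrow> ('r \<Rightarrow> 'a \<Rightarrow> real) \<Rightarrow> bool" where
  "injective_system A R c \<longleftrightarrow>
    (\<forall>m. (\<forall>r\<in>R. (\<Sum>a\<in>A. c r a * m a) = 0) \<longrightarrow> (\<forall>a\<in>A. m a = 0))"

lemma injective_systemD:
  assumes "injective_system A R c" "\<And>r. r \<in> R \<Longrightarrow> (\<Sum>a\<in>A. c r a * m a) = 0" "a \<in> A"
  shows "m a = 0"
  using assms unfolding injective_system_def by blast

text \<open>Fraction-free elimination: cross-multiplying with the pivot row keeps all entries
  polynomial in \<open>X\<close>, and \<delta> is the product of the pivots met when eliminating at
  \<open>Y\<close>. This takes the place of a nonzero maximal minor and allows infinitely many
  rows.\<close>

lemma injective_system_polynomial: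
  fixes c :: "('c \<Rightarrow> 'b::real_normed_vector) \<Rightarrow> 'r \<Rightarrow> 'a \<Rightarrow> real"
  assumes "finite A" "injective_system A R (c Y)"
    and "\<And>r a. polynomial_map (\<lambda>X. c X r a)"
  shows "\<exists>\<delta>. polynomial_map \<delta> \<and> \<delta> Y \<noteq> 0 \<and> (\<forall>X. \<delta> X \<noteq> 0 \<longrightarrow> injective_system A R (c X))"
  using assms
proof (induction A arbitrary: c R rule: finite_induct)
  case empty
  then show ?case
    by (intro exI[of _ "\<lambda>X. 1"]) (simp add: injective_system_def polynomial_map_const)
next
  case (insert k A)
  have "\<exists>r\<in>R. c Y r k \<noteq> 0"
  proof (rule ccontr)
    assume "\<not> (\<exists>r\<in>R. c Y r k \<noteq> 0)"
    then have "\<forall>r\<in>R. (\<Sum>a\<in>insert k A. c Y r a * (if a = k then 1 else 0)) = 0"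
      using insert.hyps by (auto intro!: sum.neutral)
    then show False
      using injective_systemD[OF insert.prems(1), of "\<lambda>a. if a = k then 1 else 0" k] by simp
  qed
  then obtain r where r: "r \<in> R" "c Y r k \<noteq> 0" by blast
  let ?c = "\<lambda>X s a. c X r k * c X s a - c X s k * c X r a"
  have elim: "(\<Sum>a\<in>A. ?c X s a * m a) =
      c X r k * (\<Sum>a\<in>A. c X s a * m a) - c X s k * (\<Sum>a\<in>A. c X r a * m a)" for X s m
    by (simp add: sum_distrib_left sum_subtractf[symmetric] algebra_simps)
  have inj: "injective_system A R (?c Y)"
    unfolding injective_system_def
  proof (intro allI impI)
    fix m assume m: "\<forall>s\<in>R. (\<Sum>a\<in>A. ?c Y s a * m a) = 0"
    let ?m = "m(k := - (\<Sum>a\<in>A. c Y r a * m a) / c Y r k)"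
    have "(\<Sum>a\<in>insert k A. c Y s a * ?m a) = 0" if "s \<in> R" for s
    proof -
      define T where "T = (\<lambda>s. \<Sum>a\<in>A. c Y s a * m a)"
      have "(\<Sum>a\<in>insert k A. c Y s a * ?m a) = c Y s k * ?m k + (\<Sum>a\<in>A. c Y s a * ?m a)"
        using insert.hyps by (rule sum.insert)
      also have "(\<Sum>a\<in>A. c Y s a * ?m a) = T s"
        unfolding T_def using insert.hyps by (intro sum.cong) auto
      also have "?m k = - T r / c Y r k" unfolding T_def by (rule fun_upd_same)
      also have "c Y s k * (- T r / c Y r k) + T s = (c Y r k * T s - c Y s k * T r) / c Y r k"
        using r by (simp add: field_simps)
      also have "c Y r k * T s - c Y s k * T r = 0"
        using m that unfolding T_def elim by blast
      finally show ?thesis by simp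
    qed
    then have "\<forall>a\<in>insert k A. ?m a = 0"
      using injective_systemD[OF insert.prems(1), of ?m] by blast
    then show "\<forall>a\<in>A. m a = 0" using insert.hyps by (metis fun_upd_apply insertCI)
  qed
  have "polynomial_map (\<lambda>X. ?c X s a)" for s a
    by (intro polynomial_map_intros insert.prems(2))
  from insert.IH[OF inj this] obtain \<delta> where \<delta>: "polynomial_map \<delta>" "\<delta> Y \<noteq> 0"
    "\<And>X. \<delta> X \<noteq> 0 \<Longrightarrow> injective_system A R (?c X)" by blast
  have "injective_system (insert k A) R (c X)" if X: "\<delta> X * c X r k \<noteq> 0" for X
    unfolding injective_system_def
  proof (intro allI impI)
    fix m assume m: "\<forall>s\<in>R. (\<Sum>a\<in>insert k A. c X s a * m a) = 0"
    then have eq: "(\<Sum>a\<in>A. c X s a * m a) = - c X s k * m k" if "s \<in> R" for s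
      using that insert.hyps by (simp add: add_eq_0_iff)
    have "(\<Sum>a\<in>A. ?c X s a * m a) = 0" if "s \<in> R" for s
      using r that by (simp add: elim eq)
    then have "\<forall>a\<in>A. m a = 0"
      using injective_systemD[OF \<delta>(3), of X m] X by auto
    moreover have "m k = 0" using eq[OF r(1)] X calculation by auto
    ultimately show "\<forall>a\<in>insert k A. m a = 0" by blast
  qed
  moreover have "polynomial_map (\<lambda>X. \<delta> X * c X r k)"
    by (intro polynomial_map_intros insert.prems(2) \<delta>(1))
  ultimately show ?case
    using \<delta>(2) r(2) by (intro exI[of _ "\<lambda>X. \<delta> X * c X r k"]) auto
qed

lemma underdetermined_system:
  fixes c :: "'b \<Rightarrow> 'a \<Rightarrow> real"
  assumes "finite B" "finite A" "card B < card A"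
  shows "\<exists>m. (\<forall>b\<in>B. (\<Sum>a\<in>A. c b a * m a) = 0) \<and> (\<exists>a\<in>A. m a \<noteq> 0)"
  using assms
proof (induction B arbitrary: A c rule: finite_induct)
  case empty
  then obtain a where "a \<in> A" by (metis card.empty less_irrefl all_not_in_conv)
  then show ?case by (intro exI[of _ "\<lambda>_. 1"]) auto
next
  case (insert r B)
  show ?case
  proof (cases "\<exists>k\<in>A. c r k \<noteq> 0")
    case False
    then show ?thesis
      using insert.IH[of A c] insert.prems insert.hyps by auto
  next
    case True
    then obtain k where k: "k \<in> A" "c r k \<noteq> 0" by blast
    let ?A = "A - {k}"
    let ?c = "\<lambda>s a. c s a - c s k * c r a / c r k"
    have "card B < card ?A" using insert.prems insert.hyps k by simp
    then obtain m where m: "\<And>b. b \<in> B \<Longrightarrow> (\<Sum>a\<in>?A. ?c b a * m a) = 0" "\<exists>a\<in>?A. m a \<noteq> 0"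
      using insert.IH[of ?A ?c] insert.prems by auto
    let ?m = "m(k := - (\<Sum>a\<in>?A. c r a * m a) / c r k)"
    have split: "(\<Sum>a\<in>A. c s a * ?m a) = c s k * ?m k + (\<Sum>a\<in>?A. c s a * m a)" for s
    proof -
      have "(\<Sum>a\<in>A. c s a * ?m a) = c s k * ?m k + (\<Sum>a\<in>?A. c s a * ?m a)"
        using k insert.prems by (simp add: sum.remove)
      also have "(\<Sum>a\<in>?A. c s a * ?m a) = (\<Sum>a\<in>?A. c s a * m a)"
        by (intro sum.cong) auto
      finally show ?thesis .
    qed
    have "(\<Sum>a\<in>?A. ?c s a * m a) =
        (\<Sum>a\<in>?A. c s a * m a) - c s k / c r k * (\<Sum>a\<in>?A. c r a * m a)" for s
      by (simp add: sum_distrib_left sum_subtractf[symmetric] algebra_simps)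
    then have "(\<Sum>a\<in>A. c s a * ?m a) = 0" if "s \<in> B" for s
      using m(1)[OF that] by (simp only: split) simp
    moreover have "(\<Sum>a\<in>A. c r a * ?m a) = 0" using k by (simp only: split) simp
    moreover have "\<exists>a\<in>A. ?m a \<noteq> 0" using m(2) by auto
    ultimately show ?thesis by blast
  qed
qed

section \<open>Frameworks and stability of global rigidity\<close>

text \<open>The index \<open>(v, 0)\<close> holds the position of \<open>v\<close> and
  \<open>(v, Suc i)\<close> the normal of its loop number \<open>i\<close>. Keeping both in one map
  lets positions and normals be perturbed together.\<close>

type_synonym 'v config = "'v \<times> nat \<Rightarrow> real ^ 2"

datatype 'v row = Edge 'v 'v | Loop 'v nat

fun row_value :: "'v config \<Rightarrow> 'v row \<Rightarrow> ('v \<Rightarrow> real ^ 2) \<Rightarrow> real" where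
  "row_value X (Edge u v) m = (X (u, 0) - X (v, 0)) \<bullet> (m u - m v)"
| "row_value X (Loop v i) m = X (v, Suc i) \<bullet> m v"

text \<open>A row may involve a vertex outside \<open>Q\<close>; it then constrains its other end
  alone, as if the former were a fixed point.\<close>

definition motions :: "'v config \<Rightarrow> 'v set \<Rightarrow> 'v row set \<Rightarrow> ('v \<Rightarrow> real ^ 2) set" where
  "motions X Q R = {m. (\<forall>v. v \<notin> Q \<longrightarrow> m v = 0) \<and> (\<forall>r\<in>R. row_value X r m = 0)}"

definition graph_rows :: "'v set \<Rightarrow> ('v \<Rightarrow> 'v \<Rightarrow> bool) \<Rightarrow> ('v \<Rightarrow> nat) \<Rightarrow> 'v row set" where
  "graph_rows V adj l =
    {Edge u v | u v. u \<in> V \<and> v \<in> V \<and> adj u v} \<union> {Loop v i | v i. v \<in> V \<and> i < l v}"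

text \<open>No trivial motions are factored out: the loops have to exclude translations and
  rotations as well.\<close>

definition inf_rigid ::
  "'v set \<Rightarrow> ('v \<Rightarrow> 'v \<Rightarrow> bool) \<Rightarrow> ('v \<Rightarrow> nat) \<Rightarrow> 'v config \<Rightarrow> bool" where
  "inf_rigid V adj l X \<longleftrightarrow> motions X V (graph_rows V adj l) \<subseteq> {\<lambda>_. 0}"

definition equivalent_placement ::
  "'v set \<Rightarrow> ('v \<Rightarrow> 'v \<Rightarrow> bool) \<Rightarrow> ('v \<Rightarrow> nat) \<Rightarrow> 'v config \<Rightarrow> ('v \<Rightarrow> real ^ 2) \<Rightarrow> bool" where
  "equivalent_placement V adj l X p \<longleftrightarrow>
    (\<forall>u\<in>V. \<forall>v\<in>V. adj u v \<longrightarrow> (norm (p u - p v))\<^sup>2 = (norm (X (u, 0) - X (v, 0)))\<^sup>2) \<and>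
    (\<forall>v\<in>V. \<forall>i<l v. p v \<bullet> X (v, Suc i) = X (v, 0) \<bullet> X (v, Suc i))"

definition glob_rigid ::
  "'v set \<Rightarrow> ('v \<Rightarrow> 'v \<Rightarrow> bool) \<Rightarrow> ('v \<Rightarrow> nat) \<Rightarrow> 'v config \<Rightarrow> bool" where
  "glob_rigid V adj l X \<longleftrightarrow>
    (\<forall>p. equivalent_placement V adj l X p \<longrightarrow> (\<forall>v\<in>V. p v = X (v, 0)))"

text \<open>The space of motions has dimension at most \<open>k\<close>, witnessed by
  \<open>k\<close> linear functionals without a common nonzero zero. Explicit functionals let the
  bound pass from one configuration to nearby and generic ones.\<close>

definition killed_by ::
  "'v config \<Rightarrow> 'v set \<Rightarrow> 'v row set \<Rightarrow> nat \<Rightarrow> (nat \<Rightarrow> 'v \<Rightarrow> real ^ 2) \<Rightarrow> bool" where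
  "killed_by X Q R k f \<longleftrightarrow>
    (\<forall>m\<in>motions X Q R. (\<forall>i<k. (\<Sum>v\<in>Q. f i v \<bullet> m v) = 0) \<longrightarrow> m = (\<lambda>_. 0))"

lemma row_value_linear:
  "row_value X r (\<lambda>v. a *\<^sub>R m v + b *\<^sub>R n v) = a * row_value X r m + b * row_value X r n"
  by (cases r) (simp_all add: inner_simps algebra_simps)

lemma row_value_polynomial: "polynomial_map (\<lambda>X. row_value X r m)"
proof (cases r)
  case (Edge u v)
  then show ?thesis
    by (simp add: inner_vec_def sum_2) (intro polynomial_map_intros)
next
  case (Loop v i)
  then show ?thesis
    by (simp add: inner_vec_def sum_2) (intro polynomial_map_intros)
qed

definition unit_motion :: "'v \<times> 2 \<Rightarrow> 'v \<Rightarrow> real ^ 2" where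
  "unit_motion a = (\<lambda>v. if v = fst a then axis (snd a) 1 else 0)"

lemma sum_unit_motion:
  assumes "finite Q" "\<And>v. v \<notin> Q \<Longrightarrow> m v = 0"
  shows "(\<Sum>a\<in>Q \<times> UNIV. (m (fst a) $ snd a) *\<^sub>R unit_motion a v) = m v"
proof -
  have "(\<Sum>a\<in>Q \<times> UNIV. (m (fst a) $ snd a) *\<^sub>R unit_motion a v) =
      (\<Sum>u\<in>Q. \<Sum>j\<in>UNIV. (m u $ j) *\<^sub>R (if v = u then axis j 1 else 0))"
    by (simp add: sum.cartesian_product unit_motion_def split_def)
  also have "\<dots> = (\<Sum>u\<in>Q. if u = v then m v else 0)"
    by (intro sum.cong refl)
      (auto simp: sum_2 vec_eq_iff forall_2 axis_def)
  also have "\<dots> = m v" using assms by (simp add: sum.delta)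
  finally show ?thesis .
qed

lemma row_value_sum:
  "finite A \<Longrightarrow> row_value X r (\<lambda>v. \<Sum>a\<in>A. c a *\<^sub>R g a v) = (\<Sum>a\<in>A. c a * row_value X r (g a))"
proof (induction A rule: finite_induct)
  case empty
  then show ?case by (cases r) auto
next
  case (insert a A)
  then show ?case
    using row_value_linear[of X r "c a" "g a" 1 "\<lambda>v. \<Sum>a\<in>A. c a *\<^sub>R g a v"] by simp
qed

lemma row_value_coordinates:
  assumes "finite Q" "\<And>v. v \<notin> Q \<Longrightarrow> m v = 0"
  shows "row_value X r m =
    (\<Sum>a\<in>Q \<times> UNIV. row_value X r (unit_motion a) * m (fst a) $ snd a)"
proof -
  have "m = (\<lambda>v. \<Sum>a\<in>Q \<times> UNIV. (m (fst a) $ snd a) *\<^sub>R unit_motion a v)"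
    using sum_unit_motion[of Q m] assms by auto
  then have "row_value X r m =
      row_value X r (\<lambda>v. \<Sum>a\<in>Q \<times> UNIV. (m (fst a) $ snd a) *\<^sub>R unit_motion a v)"
    by simp
  also have "\<dots> = (\<Sum>a\<in>Q \<times> UNIV. m (fst a) $ snd a * row_value X r (unit_motion a))"
    using assms(1) by (intro row_value_sum) auto
  finally show ?thesis by (simp add: mult.commute)
qed

text \<open>In coordinates, the rows and the \<open>k\<close> fixed functionals form one linear
  system in the unknowns \<open>Q \<times> UNIV\<close>. Killing all motions means that this system
  is injective, which persists off an algebraic set.\<close>

lemma killed_by_polynomial:
  assumes "finite Q" "killed_by Y Q R k f"
  shows "\<exists>\<delta>. polynomial_map \<delta> \<and> \<delta> Y \<noteq> 0 \<and> (\<forall>X. \<delta> X \<noteq> 0 \<longrightarrow> killed_by X Q R k f)"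
proof -
  let ?A = "Q \<times> (UNIV :: 2 set)"
  let ?R = "Inl ` R \<union> Inr ` {..<k}"
  let ?c = "\<lambda>X r a. case r of Inl r \<Rightarrow> row_value X r (unit_motion a)
    | Inr i \<Rightarrow> f i (fst a) $ snd a"
  let ?m = "\<lambda>x v. if v \<in> Q then \<chi> j. x (v, j) else 0"
  have fm: "(\<Sum>v\<in>Q. f i v \<bullet> m v) = (\<Sum>a\<in>?A. f i (fst a) $ snd a * m (fst a) $ snd a)" for i m
    by (simp add: inner_vec_def sum.cartesian_product split_def)
  have iff: "killed_by X Q R k f \<longleftrightarrow> injective_system ?A ?R (?c X)" for X
  proof
    assume K: "killed_by X Q R k f"
    show "injective_system ?A ?R (?c X)"
      unfolding injective_system_def
    proof (intro allI impI)
      fix x assume x: "\<forall>r\<in>?R. (\<Sum>a\<in>?A. ?c X r a * x a) = 0"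
      have *: "(\<Sum>a\<in>?A. h a * ?m x (fst a) $ snd a) = (\<Sum>a\<in>?A. h a * x a)" for h
        by (intro sum.cong) auto
      have "row_value X r (?m x) = 0" if "r \<in> R" for r
      proof -
        have "row_value X r (?m x) = (\<Sum>a\<in>?A. row_value X r (unit_motion a) * ?m x (fst a) $ snd a)"
          by (rule row_value_coordinates) (use assms in auto)
        also have "\<dots> = 0" using bspec[OF x, of "Inl r"] that unfolding * by simp
        finally show ?thesis .
      qed
      moreover have "(\<Sum>v\<in>Q. f i v \<bullet> ?m x v) = 0" if "i < k" for i
        unfolding fm * using bspec[OF x, of "Inr i"] that by simp
      ultimately have "?m x = (\<lambda>_. 0)"
        using K unfolding killed_by_def motions_def by auto
      then have z: "?m x v = 0" for v by meson
      show "\<forall>a\<in>?A. x a = 0"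
      proof
        fix a assume "a \<in> ?A"
        then have "x a = ?m x (fst a) $ snd a" by auto
        then show "x a = 0" by (simp only: z zero_index)
      qed
    qed
  next
    assume I: "injective_system ?A ?R (?c X)"
    show "killed_by X Q R k f"
      unfolding killed_by_def
    proof (intro ballI impI)
      fix m assume m: "m \<in> motions X Q R" "\<forall>i<k. (\<Sum>v\<in>Q. f i v \<bullet> m v) = 0"
      have z: "m v = 0" if "v \<notin> Q" for v using m that by (auto simp: motions_def)
      have "m (fst a) $ snd a = 0" if "a \<in> ?A" for a
      proof (rule injective_systemD[OF I _ that])
        fix r assume "r \<in> ?R"
        then consider s where "r = Inl s" "s \<in> R" | i where "r = Inr i" "i < k" by auto
        then show "(\<Sum>a\<in>?A. ?c X r a * m (fst a) $ snd a) = 0"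
        proof cases
          case 1
          then show ?thesis
            using row_value_coordinates[of Q m X s] z assms m by (auto simp: motions_def)
        next
          case 2
          then show ?thesis using m fm[of i m] by auto
        qed
      qed
      then have "m v = 0" for v using z[of v] by (cases "v \<in> Q") (auto simp: vec_eq_iff)
      then show "m = (\<lambda>_. 0)" by auto
    qed
  qed
  have "polynomial_map (\<lambda>X. ?c X r a)" for r a
    by (cases r) (auto intro: polynomial_map_intros row_value_polynomial)
  from injective_system_polynomial[of ?A ?R ?c Y, OF _ _ this] show ?thesis
    using assms unfolding iff by auto
qed

lemma inf_rigid_iff_killed: "inf_rigid V adj l X \<longleftrightarrow> killed_by X V (graph_rows V adj l) 0 f"
  by (auto simp: inf_rigid_def killed_by_def)

lemma inf_rigidD:
  assumes "inf_rigid V adj l X" "\<And>u v. u \<in> V \<Longrightarrow> v \<in> V \<Longrightarrow> adj u v \<Longrightarrow> (X (u, 0) - X (v, 0)) \<bullet> (m u - m v) = 0"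
    and "\<And>v i. v \<in> V \<Longrightarrow> i < l v \<Longrightarrow> X (v, Suc i) \<bullet> m v = 0" and "v \<in> V"
  shows "m v = 0"
proof -
  have "(\<lambda>v. if v \<in> V then m v else 0) \<in> motions X V (graph_rows V adj l)"
    using assms(2,3) by (auto simp: motions_def graph_rows_def)
  then have "(\<lambda>v. if v \<in> V then m v else 0) = (\<lambda>_. 0)"
    using assms(1) unfolding inf_rigid_def by blast
  then show ?thesis using assms(4) by meson
qed

lemma bounded_subsequence:
  fixes f :: "nat \<Rightarrow> 'v \<Rightarrow> 'b::euclidean_space"
  assumes "finite V" "\<And>n v. v \<in> V \<Longrightarrow> norm (f n v) \<le> B"
  shows "\<exists>r g. strict_mono r \<and> (\<forall>v\<in>V. (\<lambda>n. f (r n) v) \<longlonglongrightarrow> g v)"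
  using assms
proof (induction V rule: finite_induct)
  case empty
  then show ?case by (intro exI[of _ id]) (auto simp: strict_mono_def)
next
  case (insert u V)
  then obtain r g where r: "strict_mono r" "\<And>v. v \<in> V \<Longrightarrow> (\<lambda>n. f (r n) v) \<longlonglongrightarrow> g v" by (metis insertCI)
  have "bounded (range (\<lambda>n. f (r n) u))"
    using insert.prems by (auto simp: bounded_iff intro!: exI[of _ B])
  then obtain s L where s: "strict_mono s" "((\<lambda>n. f (r n) u) \<circ> s) \<longlonglongrightarrow> L"
    using bounded_imp_convergent_subsequence by metis
  have "(\<lambda>n. f (r (s n)) v) \<longlonglongrightarrow> (g(u := L)) v" if "v \<in> insert u V" for v
    using that s r(2)[THEN LIMSEQ_subseq_LIMSEQ, OF _ s(1), of v] insert.hyps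
    by (auto simp: o_def)
  then show ?case
    using r(1) s(1) by (intro exI[of _ "r \<circ> s"] exI[of _ "g(u := L)"])
      (auto simp: strict_mono_def)
qed

lemma norm_diff_sq_eq_iff:
  fixes a b :: "'b::real_inner"
  shows "(norm b)\<^sup>2 = (norm a)\<^sup>2 \<longleftrightarrow> (b - a) \<bullet> (2 *\<^sub>R a + (b - a)) = 0"
  by (simp add: power2_norm_eq_inner inner_simps inner_commute algebra_simps scaleR_2)

text \<open>Compactness: counterexamples approaching \<open>X0\<close> give displacements whose
  normalised limit \<open>g\<close> is nonzero. If, along a subsequence, their sizes tend to 0 or to
  infinity, then \<open>g\<close> is an infinitesimal motion; if they tend to a positive number,
  \<open>g\<close> leads to a second placement equivalent to \<open>X0\<close>.\<close>

lemma glob_rigid_stable: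
  assumes V: "finite V" and inf: "inf_rigid V adj l X0" and glob: "glob_rigid V adj l X0"
  shows "\<exists>\<Omega>. open \<Omega> \<and> X0 \<in> \<Omega> \<and> (\<forall>X\<in>\<Omega>. glob_rigid V adj l X)"
proof (rule ccontr)
  assume neg: "\<not> ?thesis"
  define A where "A = (SIGMA v:V. {..l v})"
  define \<Omega> where "\<Omega> n = {X. \<forall>a\<in>A. dist (X a) (X0 a) < inverse (real (Suc n))}" for n
  have "finite A" using V by (auto simp: A_def)
  have "open (\<Omega> n)" for n
  proof -
    have "\<Omega> n = (\<Inter>a\<in>A. {X. dist (X a) (X0 a) < inverse (real (Suc n))})"
      by (auto simp: \<Omega>_def)
    moreover have "open {X :: 'a config. dist (X a) (X0 a) < inverse (real (Suc n))}" for a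
      by (intro open_Collect_less continuous_intros continuous_on_product_coordinates)
    ultimately show ?thesis using \<open>finite A\<close> by auto
  qed
  moreover have "X0 \<in> \<Omega> n" for n by (auto simp: \<Omega>_def)
  ultimately have "\<exists>X\<in>\<Omega> n. \<exists>p. equivalent_placement V adj l X p \<and> (\<exists>v\<in>V. p v \<noteq> X (v, 0))" for n
    using neg unfolding glob_rigid_def by blast
  then obtain X p where X: "\<And>n. X n \<in> \<Omega> n" and p: "\<And>n. equivalent_placement V adj l (X n) (p n)"
    and ne: "\<And>n. \<exists>v\<in>V. p n v \<noteq> X n (v, 0)" by metis
  have lim: "(\<lambda>n. X n a) \<longlonglongrightarrow> X0 a" if "a \<in> A" for a
  proof (rule metric_LIMSEQ_I)
    fix e :: real assume "e > 0"
    then obtain N where N: "inverse (real (Suc N)) < e" using reals_Archimedean by blast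
    have "dist (X n a) (X0 a) < e" if "n \<ge> N" for n
    proof -
      have "dist (X n a) (X0 a) < inverse (real (Suc n))" using X[of n] \<open>a \<in> A\<close> by (auto simp: \<Omega>_def)
      also have "\<dots> \<le> inverse (real (Suc N))" using \<open>n \<ge> N\<close> by (simp add: field_simps)
      finally show ?thesis using N by simp
    qed
    then show "\<exists>N. \<forall>n\<ge>N. dist (X n a) (X0 a) < e" by blast
  qed
  define w where "w n v = p n v - X n (v, 0)" for n v
  define s where "s n = (\<Sum>v\<in>V. norm (w n v))" for n
  define h where "h n v = inverse (s n) *\<^sub>R w n v" for n v
  \<comment> \<open>This compactifies the size \<open>s n\<close>: the limit \<tau> is 1, strictly
    between 0 and 1, or 0 according as the sizes tend to 0, to a positive number or to
    infinity.\<close>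
  define t where "t n = inverse (1 + s n)" for n
  have s_pos: "s n > 0" for n
  proof -
    obtain v where "v \<in> V" "p n v \<noteq> X n (v, 0)" using ne[of n] by blast
    then show ?thesis
      unfolding s_def using V by (intro sum_pos2[of V v]) (auto simp: w_def)
  qed
  have sum1: "(\<Sum>v\<in>V. norm (h n v)) = 1" for n
  proof -
    have "(\<Sum>v\<in>V. norm (h n v)) = (\<Sum>v\<in>V. inverse (s n) * norm (w n v))"
      using s_pos[of n] by (intro sum.cong) (simp_all add: h_def)
    also have "\<dots> = inverse (s n) * s n" unfolding s_def by (rule sum_distrib_left[symmetric])
    finally show ?thesis using s_pos[of n] by simp
  qed
  have "norm (h n v) \<le> 1" if "v \<in> V" for n v
    using member_le_sum[of v V "\<lambda>v. norm (h n v)"] V that sum1[of n] by simp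
  then obtain r1 g where r1: "strict_mono r1" "\<And>v. v \<in> V \<Longrightarrow> (\<lambda>n. h (r1 n) v) \<longlonglongrightarrow> g v"
    using bounded_subsequence[OF V, of h 1] by blast
  have t01: "0 < t n" "t n < 1" for n using s_pos[of n] by (auto simp: t_def field_simps)
  have "norm (t (r1 n)) \<le> 1" for n using t01[of "r1 n"] by simp
  then have "bounded (range (\<lambda>n. t (r1 n)))" by (auto simp: bounded_iff)
  then obtain r2 \<tau> where r2: "strict_mono r2" "((\<lambda>n. t (r1 n)) \<circ> r2) \<longlonglongrightarrow> \<tau>"
    using bounded_imp_convergent_subsequence by metis
  define r where "r n = r1 (r2 n)" for n
  have r: "strict_mono r" using strict_mono_o[OF r1(1) r2(1)] by (simp add: r_def[abs_def] o_def)
  have limt: "(\<lambda>n. t (r n)) \<longlonglongrightarrow> \<tau>" using r2(2) by (simp add: o_def r_def)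
  have limh: "(\<lambda>n. h (r n) v) \<longlonglongrightarrow> g v" if "v \<in> V" for v
    using LIMSEQ_subseq_LIMSEQ[OF r1(2)[OF that] r2(1)] by (simp add: o_def r_def)
  have limX: "(\<lambda>n. X (r n) (v, i)) \<longlonglongrightarrow> X0 (v, i)" if "v \<in> V" "i \<le> l v" for v i
    using LIMSEQ_subseq_LIMSEQ[OF lim r, of "(v, i)"] that by (simp add: o_def A_def)
  have "(\<lambda>n. \<Sum>v\<in>V. norm (h (r n) v)) \<longlonglongrightarrow> (\<Sum>v\<in>V. norm (g v))"
    by (intro tendsto_intros limh)
  then have sumg: "(\<Sum>v\<in>V. norm (g v)) = 1"
    unfolding sum1 by (metis LIMSEQ_const_iff)
  have \<tau>: "0 \<le> \<tau>" using limt t01 by (meson LIMSEQ_le_const less_imp_le)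
  \<comment> \<open>The exact length equation of the displaced edge, divided by \<open>s n\<close>
    and scaled by \<open>t n\<close> so that it has a limit even when the sizes are
    unbounded.\<close>
  have edge: "(g u - g v) \<bullet> ((2 * \<tau>) *\<^sub>R (X0 (u, 0) - X0 (v, 0)) + (1 - \<tau>) *\<^sub>R (g u - g v)) = 0"
    if uv: "u \<in> V" "v \<in> V" "adj u v" for u v
  proof -
    have "(h n u - h n v) \<bullet> ((2 * t n) *\<^sub>R (X n (u, 0) - X n (v, 0)) + (1 - t n) *\<^sub>R (h n u - h n v)) = 0"
      for n
    proof -
      have "(w n u - w n v) \<bullet> (2 *\<^sub>R (X n (u, 0) - X n (v, 0)) + (w n u - w n v)) = 0"
        using p[of n] uv norm_diff_sq_eq_iff[of "p n u - p n v" "X n (u, 0) - X n (v, 0)"]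
        unfolding equivalent_placement_def w_def by (simp add: algebra_simps)
      moreover have "w n = (\<lambda>v. s n *\<^sub>R h n v)" using s_pos[of n] by (auto simp: h_def)
      ultimately have "s n * ((h n u - h n v) \<bullet>
          (2 *\<^sub>R (X n (u, 0) - X n (v, 0)) + s n *\<^sub>R (h n u - h n v))) = 0"
        by (simp add: scaleR_diff_right[symmetric])
      then have *: "(h n u - h n v) \<bullet>
          (2 *\<^sub>R (X n (u, 0) - X n (v, 0)) + s n *\<^sub>R (h n u - h n v)) = 0"
        using s_pos[of n] by simp
      have "1 - t n = t n * s n" using s_pos[of n] by (simp add: t_def field_simps)
      then have "(2 * t n) *\<^sub>R (X n (u, 0) - X n (v, 0)) + (1 - t n) *\<^sub>R (h n u - h n v) =
        t n *\<^sub>R (2 *\<^sub>R (X n (u, 0) - X n (v, 0)) + s n *\<^sub>R (h n u - h n v))"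
        by (simp add: scaleR_add_right mult.commute)
      then show ?thesis using * by simp
    qed
    moreover have "(\<lambda>n. (h (r n) u - h (r n) v) \<bullet> ((2 * t (r n)) *\<^sub>R (X (r n) (u, 0) - X (r n) (v, 0)) +
        (1 - t (r n)) *\<^sub>R (h (r n) u - h (r n) v))) \<longlonglongrightarrow>
        (g u - g v) \<bullet> ((2 * \<tau>) *\<^sub>R (X0 (u, 0) - X0 (v, 0)) + (1 - \<tau>) *\<^sub>R (g u - g v))"
      by (intro tendsto_intros limh limX limt uv) auto
    ultimately show ?thesis by (simp add: LIMSEQ_const_iff)
  qed
  have loop: "X0 (v, Suc i) \<bullet> g v = 0" if v: "v \<in> V" "i < l v" for v i
  proof -
    have "X n (v, Suc i) \<bullet> h n v = 0" for n
      using p[of n] v unfolding equivalent_placement_def h_def w_def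
      by (simp add: inner_simps inner_commute)
    moreover have "(\<lambda>n. X (r n) (v, Suc i) \<bullet> h (r n) v) \<longlonglongrightarrow> X0 (v, Suc i) \<bullet> g v"
      by (intro tendsto_intros limh limX) (use v in auto)
    ultimately show ?thesis by (simp add: LIMSEQ_const_iff)
  qed
  have nomotion: False
    if "\<And>u v. u \<in> V \<Longrightarrow> v \<in> V \<Longrightarrow> adj u v \<Longrightarrow> (X0 (u, 0) - X0 (v, 0)) \<bullet> (g u - g v) = 0"
    using inf_rigidD[OF inf that loop] sumg by simp
  show False
  proof (cases "\<tau> = 0")
    case True
    \<comment> \<open>At \<tau> = 0 the equation says that \<open>g u - g v\<close> has norm 0, so
      \<open>g\<close> is constant along edges and hence a motion.\<close>
    then show False using edge by (intro nomotion) auto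
  next
    case False
    \<comment> \<open>The limit of the sizes \<open>s n\<close> along the subsequence. Global
      rigidity at \<open>X0\<close> forces it to be 0.\<close>
    define \<sigma> where "\<sigma> = (1 - \<tau>) / \<tau>"
    have "equivalent_placement V adj l X0 (\<lambda>v. X0 (v, 0) + \<sigma> *\<^sub>R g v)"
      unfolding equivalent_placement_def
    proof (intro conjI ballI allI impI)
      fix u v assume uv: "u \<in> V" "v \<in> V" "adj u v"
      have "(\<sigma> *\<^sub>R (g u - g v)) \<bullet> (2 *\<^sub>R (X0 (u, 0) - X0 (v, 0)) + \<sigma> *\<^sub>R (g u - g v)) =
        (\<sigma> / \<tau>) * ((g u - g v) \<bullet> ((2 * \<tau>) *\<^sub>R (X0 (u, 0) - X0 (v, 0)) + (1 - \<tau>) *\<^sub>R (g u - g v)))"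
      proof -
        have st: "1 - \<tau> = \<sigma> * \<tau>" using False by (simp add: \<sigma>_def)
        show ?thesis
          unfolding st inner_scaleR_left inner_add_right inner_scaleR_right
          using False by (simp add: field_simps)
      qed
      then have "(\<sigma> *\<^sub>R (g u - g v)) \<bullet> (2 *\<^sub>R (X0 (u, 0) - X0 (v, 0)) + \<sigma> *\<^sub>R (g u - g v)) = 0"
        using edge[OF uv] by simp
      moreover have "X0 (u, 0) + \<sigma> *\<^sub>R g u - (X0 (v, 0) + \<sigma> *\<^sub>R g v) - (X0 (u, 0) - X0 (v, 0)) =
          \<sigma> *\<^sub>R (g u - g v)" by (simp add: algebra_simps)
      ultimately show "(norm (X0 (u, 0) + \<sigma> *\<^sub>R g u - (X0 (v, 0) + \<sigma> *\<^sub>R g v)))\<^sup>2 =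
          (norm (X0 (u, 0) - X0 (v, 0)))\<^sup>2"
        unfolding norm_diff_sq_eq_iff by simp
    next
      fix v i assume "v \<in> V" "i < l v"
      then show "(X0 (v, 0) + \<sigma> *\<^sub>R g v) \<bullet> X0 (v, Suc i) = X0 (v, 0) \<bullet> X0 (v, Suc i)"
        using loop by (simp add: inner_simps inner_commute)
    qed
    then have "\<sigma> *\<^sub>R g v = 0" if "v \<in> V" for v
      using glob that unfolding glob_rigid_def by fastforce
    then have "\<sigma> = 0" using sumg by (metis (no_types, lifting) norm_zero scale_eq_0_iff sum.neutral zero_neq_one)
    then have "\<tau> = 1" using False by (simp add: \<sigma>_def)
    then show False using edge by (intro nomotion) (auto simp: inner_commute)
  qed
qed

section \<open>Finite fibres of polynomial maps\<close>

definition separately_polynomial :: "'i set \<Rightarrow> nat \<Rightarrow> (('i \<Rightarrow> real) \<Rightarrow> real) \<Rightarrow> bool" where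
  "separately_polynomial I n f \<longleftrightarrow>
    (\<forall>x. \<forall>i\<in>I. \<exists>P. degree P \<le> n \<and> (\<forall>t. f (x(i := t)) = poly P t))"

lemma separately_polynomialI:
  assumes "\<And>x i. i \<in> I \<Longrightarrow> \<exists>P. degree P \<le> n \<and> (\<forall>t. f (x(i := t)) = poly P t)"
  shows "separately_polynomial I n f"
  using assms unfolding separately_polynomial_def by blast

lemma separately_polynomialE:
  assumes "separately_polynomial I n f" "i \<in> I"
  obtains P where "degree P \<le> n" "\<And>t. f (x(i := t)) = poly P t"
  using assms unfolding separately_polynomial_def by blast

lemma separately_polynomial_const: "separately_polynomial I n (\<lambda>x. c)"
  by (rule separately_polynomialI) (auto intro!: exI[of _ "[:c:]"])

lemma separately_polynomial_mono:
  "separately_polynomial I n f \<Longrightarrow> n \<le> n' \<Longrightarrow> separately_polynomial I n' f"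
  unfolding separately_polynomial_def by (meson order_trans)

lemma separately_polynomial_coordinate: "separately_polynomial I 1 (\<lambda>x. x j)"
proof (rule separately_polynomialI)
  fix x :: "'a \<Rightarrow> real" and i
  show "\<exists>P. degree P \<le> 1 \<and> (\<forall>t. (x(i := t)) j = poly P t)"
    by (cases "i = j") (auto intro: exI[of _ "[:0, 1:]"] exI[of _ "[:x j:]"])
qed

lemma separately_polynomial_add:
  assumes f: "separately_polynomial I n f" and g: "separately_polynomial I n g"
  shows "separately_polynomial I n (\<lambda>x. f x + g x)"
proof (rule separately_polynomialI)
  fix x i assume i: "i \<in> I"
  obtain P where P: "degree P \<le> n" "\<And>t. f (x(i := t)) = poly P t"
    using separately_polynomialE[OF f i] by metis
  obtain Q where Q: "degree Q \<le> n" "\<And>t. g (x(i := t)) = poly Q t"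
    using separately_polynomialE[OF g i] by metis
  show "\<exists>P. degree P \<le> n \<and> (\<forall>t. f (x(i := t)) + g (x(i := t)) = poly P t)"
    using P Q by (intro exI[of _ "P + Q"]) (auto simp: degree_add_le)
qed

lemma separately_polynomial_mult:
  assumes f: "separately_polynomial I n f" and g: "separately_polynomial I k g"
  shows "separately_polynomial I (n + k) (\<lambda>x. f x * g x)"
proof (rule separately_polynomialI)
  fix x i assume i: "i \<in> I"
  obtain P where P: "degree P \<le> n" "\<And>t. f (x(i := t)) = poly P t"
    using separately_polynomialE[OF f i] by metis
  obtain Q where Q: "degree Q \<le> k" "\<And>t. g (x(i := t)) = poly Q t"
    using separately_polynomialE[OF g i] by metis
  show "\<exists>P. degree P \<le> n + k \<and> (\<forall>t. f (x(i := t)) * g (x(i := t)) = poly P t)"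
    using P Q degree_mult_le[of P Q] by (intro exI[of _ "P * Q"]) auto
qed

lemma separately_polynomial_power:
  assumes "separately_polynomial I n f"
  shows "separately_polynomial I (n * k) (\<lambda>x. f x ^ k)"
proof (induction k)
  case 0
  then show ?case by (simp add: separately_polynomial_const)
next
  case (Suc k)
  then show ?case using separately_polynomial_mult[OF assms Suc] by simp
qed

lemma separately_polynomial_sum:
  assumes "\<And>a. a \<in> A \<Longrightarrow> separately_polynomial I n (f a)"
  shows "separately_polynomial I n (\<lambda>x. \<Sum>a\<in>A. f a x)"
  using assms
  by (induction A rule: infinite_finite_induct)
    (simp_all add: separately_polynomial_const separately_polynomial_add)

lemma separately_polynomial_prod:
  assumes "\<And>a. a \<in> A \<Longrightarrow> separately_polynomial I (n a) (f a)"
  shows "separately_polynomial I (\<Sum>a\<in>A. n a) (\<lambda>x. \<Prod>a\<in>A. f a x)"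
  using assms
  by (induction A rule: infinite_finite_induct)
    (simp_all add: separately_polynomial_const separately_polynomial_mult)

definition grid :: "'i set \<Rightarrow> nat \<Rightarrow> ('i \<Rightarrow> real) set" where
  "grid I n = {x. (\<forall>i\<in>I. x i \<in> real ` {..n}) \<and> (\<forall>i. i \<notin> I \<longrightarrow> x i = 0)}"

lemma finite_grid_card:
  assumes "finite I"
  shows "finite (grid I n) \<and> card (grid I n) \<le> Suc n ^ card I"
proof -
  let ?E = "PiE I (\<lambda>_. {..n})"
  let ?h = "\<lambda>e i. if i \<in> I then real (e i) else 0"
  have "grid I n \<subseteq> ?h ` ?E"
  proof
    fix x assume x: "x \<in> grid I n"
    have "x = ?h (\<lambda>i\<in>I. nat \<lfloor>x i\<rfloor>)" "(\<lambda>i\<in>I. nat \<lfloor>x i\<rfloor>) \<in> ?E"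
      using x by (fastforce simp: grid_def)+
    then show "x \<in> ?h ` ?E" by blast
  qed
  moreover have "finite ?E" using assms by (simp add: finite_PiE)
  moreover have "card ?E = Suc n ^ card I" using assms by (simp add: card_PiE)
  ultimately show ?thesis
    using finite_subset[of "grid I n" "?h ` ?E"] card_mono[of "?h ` ?E" "grid I n"]
      card_image_le[of ?E ?h] by simp
qed

text \<open>\<open>T\<close> collects the variables that have left the grid. When one more variable
  leaves it, the polynomial in this variable has degree at most \<open>n\<close> and, by induction,
  the \<open>n + 1\<close> roots 0 to \<open>n\<close>.\<close>

lemma separately_polynomial_grid:
  assumes I: "finite I" and f: "separately_polynomial I n f"
    and grid: "\<And>x. x \<in> grid I n \<Longrightarrow> f x = 0" and x: "\<And>i. i \<notin> I \<Longrightarrow> x i = 0"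
  shows "f x = 0"
proof -
  have "f y = 0" if "T \<subseteq> I" "\<And>i. i \<in> I - T \<Longrightarrow> y i \<in> real ` {..n}" "\<And>i. i \<notin> I \<Longrightarrow> y i = 0" for T y
    using finite_subset[OF that(1) I] that
  proof (induction T arbitrary: y rule: finite_induct)
    case empty
    then show ?case using grid by (simp add: grid_def)
  next
    case (insert i T)
    then have i: "i \<in> I" by simp
    obtain P where P: "degree P \<le> n" "\<And>t. f (y(i := t)) = poly P t"
      using separately_polynomialE[OF f i] by metis
    have "poly P (real k) = 0" if "k \<le> n" for k
    proof -
      have "f (y(i := real k)) = 0"
        using insert.prems i that by (intro insert.IH) auto
      then show ?thesis using P by simp
    qed
    then have sub: "real ` {..n} \<subseteq> {t. poly P t = 0}" by auto
    have "P = 0"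
    proof (rule ccontr)
      assume "P \<noteq> 0"
      then have "card (real ` {..n}) \<le> degree P"
        using card_mono[OF poly_roots_finite sub] card_poly_roots_bound[of P] by linarith
      then show False using P(1) by (simp add: card_image)
    qed
    then show ?case using P(2)[of "y i"] by simp
  qed
  from this[of I x] x show ?thesis by auto
qed

definition monomial_at :: "'j set \<Rightarrow> ('j \<Rightarrow> real) \<Rightarrow> ('j \<Rightarrow> nat) \<Rightarrow> real" where
  "monomial_at J y \<alpha> = (\<Prod>j\<in>J. y j ^ \<alpha> j)"

text \<open>Counting step of Perron's theorem: there are more monomials in the \<open>f j\<close> and \<open>x i\<close> of
  exponents at most \<open>K\<close> than points in a grid on which the resulting polynomial is determined.\<close>

lemma algebraic_relation:
  fixes f :: "'j \<Rightarrow> ('i \<Rightarrow> real) \<Rightarrow> real"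
  assumes I: "finite I" and J: "finite J" "card I \<le> card J"
    and f: "\<And>j. j \<in> J \<Longrightarrow> separately_polynomial I 2 (f j)"
  shows "\<exists>K c. (\<exists>\<alpha>\<in>PiE J (\<lambda>_. {..K}). \<exists>k\<le>K. c \<alpha> k \<noteq> 0) \<and>
    (\<forall>x. (\<forall>i. i \<notin> I \<longrightarrow> x i = 0) \<longrightarrow>
      (\<Sum>k\<le>K. (\<Sum>\<alpha>\<in>PiE J (\<lambda>_. {..K}). c \<alpha> k * monomial_at J (\<lambda>j. f j x) \<alpha>) * x i0 ^ k) = 0)"
proof -
  define N where "N = card I"
  \<comment> \<open>A product of the \<open>f j\<close> and of \<open>x i0\<close> with exponents at
    most \<open>K\<close> has degree at most \<open>2 * card J * K + K = b * K\<close> in each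
    variable. With \<open>K = b ^ N\<close> the grid has at most \<open>K * Suc K ^ N\<close>
    points, fewer than the \<open>Suc K ^ (card J + 1)\<close> monomials.\<close>
  define b where "b = 2 * card J + 1"
  define K where "K = b ^ N"
  define n where "n = b * K"
  let ?E = "PiE J (\<lambda>_. {..K})"
  let ?A = "?E \<times> {..K}"
  let ?c = "\<lambda>x a. monomial_at J (\<lambda>j. f j x) (fst a) * x i0 ^ snd a"
  have finE: "finite ?E" using J by (simp add: finite_PiE)
  have "card (grid I n) \<le> Suc n ^ N" using finite_grid_card[OF I, of n] by (simp add: N_def)
  also have "\<dots> \<le> (b * Suc K) ^ N"
    by (intro power_mono) (auto simp: n_def b_def)
  also have "\<dots> = K * Suc K ^ N" by (simp only: power_mult_distrib K_def)
  also have "\<dots> < Suc K * Suc K ^ N" by simp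
  also have "\<dots> \<le> Suc K * Suc K ^ card J"
    using J by (intro mult_left_mono power_increasing) (auto simp: N_def)
  also have "\<dots> = card ?A" using J by (simp add: card_cartesian_product card_PiE)
  finally obtain m where m: "\<And>x. x \<in> grid I n \<Longrightarrow> (\<Sum>a\<in>?A. ?c x a * m a) = 0" "\<exists>a\<in>?A. m a \<noteq> 0"
    using underdetermined_system[of "grid I n" ?A ?c] finite_grid_card[OF I, of n] finE by auto
  have sep: "separately_polynomial I n (\<lambda>x. ?c x a * m a)" if "a \<in> ?A" for a
  proof -
    have "separately_polynomial I (\<Sum>j\<in>J. 2 * fst a j) (\<lambda>x. \<Prod>j\<in>J. f j x ^ fst a j)"
      using f by (intro separately_polynomial_prod separately_polynomial_power) auto
    then have "separately_polynomial I ((\<Sum>j\<in>J. 2 * fst a j) + 1 * snd a + 0) (\<lambda>x. ?c x a * m a)"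
      unfolding monomial_at_def
      by (intro separately_polynomial_mult separately_polynomial_power
          separately_polynomial_coordinate separately_polynomial_const)
    moreover have "(\<Sum>j\<in>J. 2 * fst a j) \<le> (\<Sum>j\<in>J. 2 * K)"
      using that by (intro sum_mono) auto
    moreover have "snd a \<le> K" using that by auto
    ultimately show ?thesis
      by (elim separately_polynomial_mono) (simp add: n_def b_def algebra_simps)
  qed
  have zero: "(\<Sum>a\<in>?A. ?c x a * m a) = 0" if "\<And>i. i \<notin> I \<Longrightarrow> x i = 0" for x
    by (rule separately_polynomial_grid[OF I separately_polynomial_sum m(1) that]) (use sep in auto)
  have "(\<Sum>k\<le>K. (\<Sum>\<alpha>\<in>?E. m (\<alpha>, k) * monomial_at J (\<lambda>j. f j x) \<alpha>) * x i0 ^ k) =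
      (\<Sum>a\<in>?A. ?c x a * m a)" for x
  proof -
    have "(\<Sum>k\<le>K. (\<Sum>\<alpha>\<in>?E. m (\<alpha>, k) * monomial_at J (\<lambda>j. f j x) \<alpha>) * x i0 ^ k) =
      (\<Sum>k\<le>K. \<Sum>\<alpha>\<in>?E. ?c x (\<alpha>, k) * m (\<alpha>, k))"
      by (simp only: sum_distrib_right fst_conv snd_conv) (simp add: mult_ac)
    also have "\<dots> = (\<Sum>\<alpha>\<in>?E. \<Sum>k\<le>K. ?c x (\<alpha>, k) * m (\<alpha>, k))" by (rule sum.swap)
    also have "\<dots> = (\<Sum>a\<in>?A. ?c x a * m a)" by (simp add: sum.cartesian_product split_def)
    finally show ?thesis .
  qed
  then show ?thesis
    using m(2) zero by (intro exI[of _ K] exI[of _ "\<lambda>\<alpha> k. m (\<alpha>, k)"]) auto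
qed

text \<open>The product rule. Truncation in \<open>\<alpha> j - 1\<close> is harmless, because a
  term with \<open>\<alpha> j = 0\<close> carries the factor 0.\<close>

lemma DERIV_monomial_at:
  assumes "finite J" "\<And>j. j \<in> J \<Longrightarrow> ((\<lambda>t. y t j) has_real_derivative dy j) (at s)"
  shows "((\<lambda>t. monomial_at J (y t) \<alpha>) has_real_derivative
    (\<Sum>j\<in>J. real (\<alpha> j) * monomial_at J (y s) (\<alpha>(j := \<alpha> j - 1)) * dy j)) (at s)"
  using assms
proof (induction J rule: finite_induct)
  case empty
  then show ?case by (simp add: monomial_at_def)
next
  case (insert i J)
  have ins: "monomial_at (insert i J) z \<beta> = z i ^ \<beta> i * monomial_at J z \<beta>" for z \<beta>
    using insert.hyps by (simp add: monomial_at_def)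
  have upd: "monomial_at J z (\<beta>(i := k)) = monomial_at J z \<beta>" for z \<beta> k
    using insert.hyps unfolding monomial_at_def by (intro prod.cong) auto
  have "((\<lambda>t. y t i ^ \<alpha> i * monomial_at J (y t) \<alpha>) has_real_derivative
     (real (\<alpha> i) * y s i ^ (\<alpha> i - 1) * dy i) * monomial_at J (y s) \<alpha> +
     (\<Sum>j\<in>J. real (\<alpha> j) * monomial_at J (y s) (\<alpha>(j := \<alpha> j - 1)) * dy j) * y s i ^ \<alpha> i) (at s)"
  proof (rule DERIV_mult)
    show "((\<lambda>t. y t i ^ \<alpha> i) has_real_derivative real (\<alpha> i) * y s i ^ (\<alpha> i - 1) * dy i) (at s)"
      using insert.prems by (auto intro!: derivative_eq_intros)
    show "((\<lambda>t. monomial_at J (y t) \<alpha>) has_real_derivative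
      (\<Sum>j\<in>J. real (\<alpha> j) * monomial_at J (y s) (\<alpha>(j := \<alpha> j - 1)) * dy j)) (at s)"
      using insert.prems by (intro insert.IH) auto
  qed
  moreover have "(\<Sum>j\<in>J. real (\<alpha> j) * monomial_at J (y s) (\<alpha>(j := \<alpha> j - 1)) * dy j) * y s i ^ \<alpha> i =
    (\<Sum>j\<in>J. real (\<alpha> j) * monomial_at (insert i J) (y s) (\<alpha>(j := \<alpha> j - 1)) * dy j)"
    unfolding sum_distrib_right
    using insert.hyps by (intro sum.cong) (auto simp: ins)
  ultimately show ?case
    unfolding ins sum.insert[OF insert.hyps] by (simp add: upd ins mult_ac)
qed

text \<open>Differentiating a relation of minimal degree gives relations of smaller degree between
  the partial derivatives.\<close>

lemma algebraic_independence_aux: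
  fixes f :: "'j \<Rightarrow> ('i \<Rightarrow> real) \<Rightarrow> real"
  assumes J: "finite J" and U: "open U" "U \<noteq> {}"
    and df: "\<And>j x h. j \<in> J \<Longrightarrow> x \<in> U \<Longrightarrow>
      ((\<lambda>t. f j (\<lambda>i. x i + t * h i)) has_real_derivative df j x h) (at 0)"
    and indep: "\<And>x c. x \<in> U \<Longrightarrow> (\<And>h. (\<Sum>j\<in>J. c j * df j x h) = 0) \<Longrightarrow> (\<And>j. j \<in> J \<Longrightarrow> c j = 0)"
    and S: "finite S" "S \<subseteq> extensional J" "\<And>\<alpha>. \<alpha> \<in> S \<Longrightarrow> (\<Sum>j\<in>J. \<alpha> j) \<le> n"
    and rel: "\<And>x. x \<in> U \<Longrightarrow> (\<Sum>\<alpha>\<in>S. c \<alpha> * monomial_at J (\<lambda>j. f j x) \<alpha>) = 0"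
  shows "\<forall>\<alpha>\<in>S. c \<alpha> = 0"
  using S rel
proof (induction n arbitrary: S c)
  case 0
  show ?case
  proof
    fix \<alpha> assume \<alpha>: "\<alpha> \<in> S"
    have "\<beta> = \<alpha>" if "\<beta> \<in> S" for \<beta>
    proof (rule extensionalityI[of _ J])
      show "\<beta> \<in> extensional J" "\<alpha> \<in> extensional J" using "0.prems"(2) that \<alpha> by auto
      show "\<beta> j = \<alpha> j" if "j \<in> J" for j
        using "0.prems"(3)[OF \<alpha>] "0.prems"(3)[OF \<open>\<beta> \<in> S\<close>] that J by simp
    qed
    then have S: "S = {\<alpha>}" using \<alpha> by blast
    obtain x where "x \<in> U" using U by auto
    moreover have "monomial_at J y \<alpha> = 1" for y
      using "0.prems"(3)[OF \<alpha>] J by (simp add: monomial_at_def)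
    ultimately show "c \<alpha> = 0" using "0.prems"(4)[of x] S by simp
  qed
next
  case (Suc n)
  \<comment> \<open>Differentiating the relation in direction \<open>h\<close> gives a combination
    of the \<open>df j x h\<close> that vanishes for all \<open>h\<close>; independence of the
    gradients makes each coefficient zero.\<close>
  have deriv0: "(\<Sum>\<alpha>\<in>S. c \<alpha> * (real (\<alpha> j) * monomial_at J (\<lambda>j. f j x) (\<alpha>(j := \<alpha> j - 1)))) = 0"
    if x: "x \<in> U" and j: "j \<in> J" for x j
  proof (rule indep[OF x _ j])
    fix h
    let ?x = "\<lambda>t i. x i + t * h i"
    let ?y = "\<lambda>t j. f j (?x t)"
    have x0: "?x 0 = x" by simp
    have "((\<lambda>t. monomial_at J (?y t) \<alpha>) has_real_derivative
      (\<Sum>j\<in>J. real (\<alpha> j) * monomial_at J (?y 0) (\<alpha>(j := \<alpha> j - 1)) * df j x h)) (at 0)" for \<alpha>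
      using df[OF _ x] by (intro DERIV_monomial_at J) auto
    then have "((\<lambda>t. \<Sum>\<alpha>\<in>S. c \<alpha> * monomial_at J (?y t) \<alpha>) has_real_derivative
      (\<Sum>\<alpha>\<in>S. c \<alpha> * (\<Sum>j\<in>J. real (\<alpha> j) * monomial_at J (?y 0) (\<alpha>(j := \<alpha> j - 1)) * df j x h))) (at 0)"
      by (intro DERIV_sum DERIV_cmult)
    moreover have "((\<lambda>t. \<Sum>\<alpha>\<in>S. c \<alpha> * monomial_at J (?y t) \<alpha>) has_real_derivative 0) (at 0)"
    proof (rule has_field_derivative_transform_within_open)
      show "((\<lambda>t. 0 :: real) has_real_derivative 0) (at 0)" by simp
      have "continuous_on UNIV ?x"
        by (intro continuous_on_coordinatewise_then_product continuous_intros)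
      then show "open (?x -` U)" using U by (metis open_vimage)
      show "0 \<in> ?x -` U" using x x0 by simp
      show "0 = (\<Sum>\<alpha>\<in>S. c \<alpha> * monomial_at J (?y t) \<alpha>)" if "t \<in> ?x -` U" for t
        using Suc.prems(4) that by simp
    qed
    ultimately have "(\<Sum>\<alpha>\<in>S. c \<alpha> * (\<Sum>j\<in>J. real (\<alpha> j) *
        monomial_at J (?y 0) (\<alpha>(j := \<alpha> j - 1)) * df j x h)) = 0"
      by (rule DERIV_unique)
    moreover have "(\<Sum>\<alpha>\<in>S. c \<alpha> * (\<Sum>j\<in>J. real (\<alpha> j) *
        monomial_at J (?y 0) (\<alpha>(j := \<alpha> j - 1)) * df j x h)) =
      (\<Sum>j\<in>J. (\<Sum>\<alpha>\<in>S. c \<alpha> * (real (\<alpha> j) * monomial_at J (\<lambda>j. f j x) (\<alpha>(j := \<alpha> j - 1)))) * df j x h)"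
      unfolding x0 sum_distrib_left sum_distrib_right
      by (subst sum.swap) (simp add: mult_ac)
    ultimately show "(\<Sum>j\<in>J. (\<Sum>\<alpha>\<in>S. c \<alpha> * (real (\<alpha> j) *
        monomial_at J (\<lambda>j. f j x) (\<alpha>(j := \<alpha> j - 1)))) * df j x h) = 0" by simp
  qed
  \<comment> \<open>The vanishing coefficient is a relation of smaller total degree. Lowering the
    exponent of \<open>j\<close> is injective on the monomials that contain \<open>j\<close>, so the
    induction hypothesis applies to the shifted exponents.\<close>
  have c0: "c \<alpha> = 0" if \<alpha>: "\<alpha> \<in> S" "j \<in> J" "\<alpha> j > 0" for \<alpha> j
  proof -
    let ?S = "{\<alpha>\<in>S. \<alpha> j > 0}"
    let ?h = "\<lambda>\<alpha>. \<alpha>(j := \<alpha> j - 1)"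
    let ?c = "\<lambda>\<beta>. c (\<beta>(j := Suc (\<beta> j))) * real (Suc (\<beta> j))"
    have inv: "(?h \<alpha>)(j := Suc ((?h \<alpha>) j)) = \<alpha>" if "\<alpha> \<in> ?S" for \<alpha> using that by auto
    have inj: "inj_on ?h ?S"
      by (rule inj_on_inverseI[of _ "\<lambda>\<beta>. \<beta>(j := Suc (\<beta> j))"]) (rule inv)
    have "\<forall>\<beta>\<in>?h ` ?S. ?c \<beta> = 0"
    proof (rule Suc.IH)
      show "finite (?h ` ?S)" using Suc.prems by auto
      show "?h ` ?S \<subseteq> extensional J" using Suc.prems(2) \<alpha>(2) by (auto simp: extensional_def)
      show "(\<Sum>i\<in>J. \<beta> i) \<le> n" if \<beta>: "\<beta> \<in> ?h ` ?S" for \<beta>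
      proof -
        obtain \<alpha> where a: "\<alpha> \<in> ?S" "\<beta> = ?h \<alpha>" using \<beta> by auto
        have "(\<Sum>i\<in>J. \<alpha> i) = \<alpha> j + (\<Sum>i\<in>J-{j}. \<alpha> i)" "(\<Sum>i\<in>J. \<beta> i) = \<beta> j + (\<Sum>i\<in>J-{j}. \<beta> i)"
          using J \<alpha>(2) by (auto simp: sum.remove)
        moreover have "(\<Sum>i\<in>J-{j}. \<beta> i) = (\<Sum>i\<in>J-{j}. \<alpha> i)"
          unfolding a by (intro sum.cong) auto
        ultimately show ?thesis using Suc.prems(3)[of \<alpha>] a by auto
      qed
      show "(\<Sum>\<beta>\<in>?h ` ?S. ?c \<beta> * monomial_at J (\<lambda>j. f j x) \<beta>) = 0" if "x \<in> U" for x
      proof -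
        have "(\<Sum>\<beta>\<in>?h ` ?S. ?c \<beta> * monomial_at J (\<lambda>j. f j x) \<beta>) =
          (\<Sum>\<alpha>\<in>?S. ?c (?h \<alpha>) * monomial_at J (\<lambda>j. f j x) (?h \<alpha>))"
          using inj by (simp only: sum.reindex o_def)
        also have "\<dots> = (\<Sum>\<alpha>\<in>?S. c \<alpha> * (real (\<alpha> j) * monomial_at J (\<lambda>j. f j x) (?h \<alpha>)))"
          by (intro sum.cong refl) (auto simp: inv)
        also have "\<dots> = (\<Sum>\<alpha>\<in>S. c \<alpha> * (real (\<alpha> j) * monomial_at J (\<lambda>j. f j x) (?h \<alpha>)))"
          using Suc.prems(1) by (intro sum.mono_neutral_left) auto
        finally show ?thesis using deriv0[OF that \<alpha>(2)] by simp
      qed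
    qed
    then have "?c (?h \<alpha>) = 0" using \<alpha> by blast
    then show ?thesis using inv[of \<alpha>] \<alpha> by simp
  qed
  show ?case
  proof
    fix \<alpha> assume \<alpha>: "\<alpha> \<in> S"
    show "c \<alpha> = 0"
    proof (cases "\<exists>j\<in>J. \<alpha> j > 0")
      case True
      then show ?thesis using c0[OF \<alpha>] by blast
    next
      case False
      \<comment> \<open>Every other monomial already has coefficient 0, and the constant one is read
        off at any point of \<open>U\<close>.\<close>
      then have zero: "\<And>j. j \<in> J \<Longrightarrow> \<alpha> j = 0" by auto
      obtain x where x: "x \<in> U" using U by auto
      have "c \<beta> * monomial_at J (\<lambda>j. f j x) \<beta> = 0" if "\<beta> \<in> S - {\<alpha>}" for \<beta>
      proof -
        have "\<exists>j\<in>J. \<beta> j > 0"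
        proof (rule ccontr)
          assume "\<not> (\<exists>j\<in>J. \<beta> j > 0)"
          then have "\<beta> j = \<alpha> j" if "j \<in> J" for j using zero that by auto
          moreover have "\<beta> \<in> extensional J" "\<alpha> \<in> extensional J"
            using Suc.prems(2) that \<alpha> by auto
          ultimately have "\<beta> = \<alpha>" by (intro extensionalityI[of \<beta> J \<alpha>])
          then show False using that by simp
        qed
        then show ?thesis using c0[of \<beta>] that by auto
      qed
      then have "(\<Sum>\<beta>\<in>S - {\<alpha>}. c \<beta> * monomial_at J (\<lambda>j. f j x) \<beta>) = 0"
        by (rule sum.neutral[OF ballI])
      then have "(\<Sum>\<alpha>\<in>S. c \<alpha> * monomial_at J (\<lambda>j. f j x) \<alpha>) = c \<alpha> * monomial_at J (\<lambda>j. f j x) \<alpha>"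
        using sum.remove[OF Suc.prems(1) \<alpha>, of "\<lambda>\<alpha>. c \<alpha> * monomial_at J (\<lambda>j. f j x) \<alpha>"] by simp
      moreover have "monomial_at J (\<lambda>j. f j x) \<alpha> = 1" using zero by (simp add: monomial_at_def)
      ultimately show ?thesis using Suc.prems(4)[OF x] by simp
    qed
  qed
qed

text \<open>For points that vanish outside \<open>I\<close>, each coordinate is a root of a
  polynomial whose coefficients are polynomials in the values of the \<open>f j\<close>.
  Independence provides, on a smaller open set, a coefficient without zeros for each coordinate.
  Over a point of that set, the whole fibre satisfies the same nonzero equations in one variable.
  The base point itself may be nonzero outside \<open>I\<close>.\<close>

lemma finite_fibre:
  fixes f :: "'j \<Rightarrow> ('i \<Rightarrow> real) \<Rightarrow> real"
  assumes I: "finite I" and J: "finite J" "card I \<le> card J"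
    and U: "open U" "x0 \<in> U"
    and cont: "\<And>j. j \<in> J \<Longrightarrow> continuous_on UNIV (f j)"
    and f: "\<And>j. j \<in> J \<Longrightarrow> separately_polynomial I 2 (f j)"
    and df: "\<And>j x h. j \<in> J \<Longrightarrow> x \<in> U \<Longrightarrow>
      ((\<lambda>t. f j (\<lambda>i. x i + t * h i)) has_real_derivative df j x h) (at 0)"
    and indep: "\<And>x c. x \<in> U \<Longrightarrow> (\<And>h. (\<Sum>j\<in>J. c j * df j x h) = 0) \<Longrightarrow> (\<And>j. j \<in> J \<Longrightarrow> c j = 0)"
  shows "\<exists>x\<in>U. finite {y. (\<forall>i. i \<notin> I \<longrightarrow> y i = 0) \<and> (\<forall>j\<in>J. f j y = f j x)}"
proof -
  define rel where "rel i0 K c \<longleftrightarrow> (\<exists>\<alpha>\<in>PiE J (\<lambda>_. {..K}). \<exists>k\<le>K. c \<alpha> k \<noteq> 0) \<and>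
    (\<forall>x. (\<forall>i. i \<notin> I \<longrightarrow> x i = 0) \<longrightarrow>
      (\<Sum>k\<le>K. (\<Sum>\<alpha>\<in>PiE J (\<lambda>_. {..K}). c \<alpha> k * monomial_at J (\<lambda>j. f j x) \<alpha>) * x i0 ^ k) = 0)"
    for i0 K c
  have "\<forall>i0. \<exists>K c. rel i0 K c"
    unfolding rel_def by (rule allI, rule algebraic_relation[OF I J]) (rule f)
  then obtain K where "\<forall>i. \<exists>c. rel i (K i) c" using choice[of "\<lambda>i K. \<exists>c. rel i K c"] by blast
  then obtain c where Kc: "rel i (K i) (c i)" for i using choice[of "\<lambda>i c. rel i (K i) c"] by blast
  have nz: "\<exists>\<alpha>\<in>PiE J (\<lambda>_. {..K i}). \<exists>k\<le>K i. c i \<alpha> k \<noteq> 0" for i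
    using Kc[of i] unfolding rel_def by (rule conjunct1)
  have rel: "(\<Sum>k\<le>K i. (\<Sum>\<alpha>\<in>PiE J (\<lambda>_. {..K i}). c i \<alpha> k * monomial_at J (\<lambda>j. f j x) \<alpha>) * x i ^ k) = 0"
    if "\<And>i. i \<notin> I \<Longrightarrow> x i = 0" for i x
    using Kc[of i] that unfolding rel_def by blast
  define Q where "Q i k x = (\<Sum>\<alpha>\<in>PiE J (\<lambda>_. {..K i}). c i \<alpha> k * monomial_at J (\<lambda>j. f j x) \<alpha>)" for i k x
  have contQ: "continuous_on UNIV (Q i k)" for i k
    unfolding Q_def monomial_at_def by (intro continuous_intros cont)
  have ex: "\<exists>k\<le>K i. \<exists>x\<in>W. Q i k x \<noteq> 0" if W: "open W" "W \<noteq> {}" "W \<subseteq> U" for W i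
  proof -
    obtain \<alpha> k where ak: "\<alpha> \<in> PiE J (\<lambda>_. {..K i})" "k \<le> K i" "c i \<alpha> k \<noteq> 0" using nz by blast
    have "\<exists>x\<in>W. Q i k x \<noteq> 0"
    proof (rule ccontr)
      assume "\<not> (\<exists>x\<in>W. Q i k x \<noteq> 0)"
      then have zero: "\<And>x. x \<in> W \<Longrightarrow> (\<Sum>\<alpha>\<in>PiE J (\<lambda>_. {..K i}). c i \<alpha> k * monomial_at J (\<lambda>j. f j x) \<alpha>) = 0"
        unfolding Q_def by blast
      have "\<forall>\<alpha>\<in>PiE J (\<lambda>_. {..K i}). c i \<alpha> k = 0"
      proof (rule algebraic_independence_aux[OF J(1) W(1,2), where f = f and df = df and n = "card J * K i"])
        show "(\<Sum>j\<in>J. \<beta> j) \<le> card J * K i" if "\<beta> \<in> PiE J (\<lambda>_. {..K i})" for \<beta>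
          using that sum_bounded_above[of J \<beta> "K i"] by auto
        show "((\<lambda>t. f j (\<lambda>i. x i + t * h i)) has_real_derivative df j x h) (at 0)"
          if "j \<in> J" "x \<in> W" for j x h using df that W by blast
        show "c' j = 0" if "x \<in> W" "\<And>h. (\<Sum>j\<in>J. c' j * df j x h) = 0" "j \<in> J" for x c' j
          using indep[of x c' j] that W by blast
        show "finite (PiE J (\<lambda>_. {..K i}))" using J by (intro finite_PiE) auto
        show "PiE J (\<lambda>_. {..K i}) \<subseteq> extensional J" by (auto simp: PiE_def)
      qed (use zero in blast)
      then show False using ak by blast
    qed
    then show ?thesis using ak by blast
  qed
  have "\<exists>W k. open W \<and> W \<noteq> {} \<and> W \<subseteq> U \<and> (\<forall>i\<in>T. k i \<le> K i \<and> (\<forall>x\<in>W. Q i (k i) x \<noteq> 0))" if "finite T" for T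
    using that
  proof (induction T rule: finite_induct)
    case empty
    then show ?case using U by (intro exI[of _ U]) auto
  next
    case (insert i T)
    then obtain W k where W: "open W" "W \<noteq> {}" "W \<subseteq> U" "\<And>i. i \<in> T \<Longrightarrow> k i \<le> K i"
      "\<And>i x. i \<in> T \<Longrightarrow> x \<in> W \<Longrightarrow> Q i (k i) x \<noteq> 0" by blast
    obtain k' x where k': "k' \<le> K i" "x \<in> W" "Q i k' x \<noteq> 0" using ex[OF W(1-3), of i] by blast
    have "open {x. Q i k' x \<noteq> 0}" using open_vimage[OF _ contQ, of "- {0}"]
      by (simp add: vimage_def open_Compl)
    then show ?case
      using W k' insert.hyps
      by (intro exI[of _ "W \<inter> {x. Q i k' x \<noteq> 0}"] exI[of _ "k(i := k')"]) auto
  qed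
  from this[OF I] obtain W k where W: "W \<noteq> {}" "W \<subseteq> U" "\<And>i. i \<in> I \<Longrightarrow> k i \<le> K i"
    "\<And>i x. i \<in> I \<Longrightarrow> x \<in> W \<Longrightarrow> Q i (k i) x \<noteq> 0" by blast
  then obtain x where x: "x \<in> W" by blast
  \<comment> \<open>The coefficients are taken at the base point; they are the same at every
    \<open>y\<close> of the fibre, since they depend on the values of the \<open>f j\<close>
    only.\<close>
  define P where "P i = (\<Sum>k\<le>K i. monom (Q i k x) k)" for i
  have "P i \<noteq> 0" if "i \<in> I" for i
  proof -
    have "coeff (P i) (k i) = Q i (k i) x"
      using W(3)[OF that] by (simp add: P_def coeff_sum if_distrib cong: if_cong)
    then show ?thesis using W(4)[OF that x] by auto
  qed
  then have fin: "finite {t. poly (P i) t = 0}" if "i \<in> I" for i using poly_roots_finite that by blast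
  have "{y. (\<forall>i. i \<notin> I \<longrightarrow> y i = 0) \<and> (\<forall>j\<in>J. f j y = f j x)} \<subseteq>
    (\<lambda>e i. if i \<in> I then e i else 0) ` PiE I (\<lambda>i. {t. poly (P i) t = 0})"
  proof
    fix y assume "y \<in> {y. (\<forall>i. i \<notin> I \<longrightarrow> y i = 0) \<and> (\<forall>j\<in>J. f j y = f j x)}"
    then have y: "\<And>i. i \<notin> I \<Longrightarrow> y i = 0" "\<And>j. j \<in> J \<Longrightarrow> f j y = f j x" by auto
    have "monomial_at J (\<lambda>j. f j y) \<alpha> = monomial_at J (\<lambda>j. f j x) \<alpha>" for \<alpha>
      unfolding monomial_at_def by (intro prod.cong) (auto simp: y)
    then have "poly (P i) (y i) = 0" for i
      using rel[of y i] y(1) by (simp add: P_def Q_def poly_sum poly_monom)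
    then have "y = (\<lambda>i. if i \<in> I then restrict y I i else 0)" "restrict y I \<in> PiE I (\<lambda>i. {t. poly (P i) t = 0})"
      using y(1) by auto
    then show "y \<in> (\<lambda>e i. if i \<in> I then e i else 0) ` PiE I (\<lambda>i. {t. poly (P i) t = 0})" by blast
  qed
  moreover have "finite (PiE I (\<lambda>i. {t. poly (P i) t = 0}))" using I fin by (intro finite_PiE)
  ultimately have "finite {y. (\<forall>i. i \<notin> I \<longrightarrow> y i = 0) \<and> (\<forall>j\<in>J. f j y = f j x)}"
    by (rule finite_subset[OF _ finite_imageI])
  then show ?thesis using x W(2) by blast
qed

section \<open>Finitely many equivalent placements\<close>

lemma inner_2: "(a :: real ^ 2) \<bullet> b = a $ 1 * b $ 1 + a $ 2 * b $ 2"
  by (simp add: inner_vec_def sum_2)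

lemma norm_sq_2: "(norm (a :: real ^ 2))\<^sup>2 = a $ 1 * a $ 1 + a $ 2 * a $ 2"
  by (simp add: power2_norm_eq_inner inner_2)

lemma vec_eq_iff_2: "(a :: real ^ 2) = b \<longleftrightarrow> a $ 1 = b $ 1 \<and> a $ 2 = b $ 2"
  by (simp add: vec_eq_iff forall_2)

definition cross :: "real ^ 2 \<Rightarrow> real ^ 2 \<Rightarrow> real" where
  "cross a b = a $ 1 * b $ 2 - a $ 2 * b $ 1"

lemma orthogonal_to_independent:
  assumes "cross a b \<noteq> 0" "a \<bullet> m = 0" "b \<bullet> m = 0"
  shows "m = 0"
proof -
  have "cross a b * m $ 1 = b $ 2 * (a \<bullet> m) - a $ 2 * (b \<bullet> m)"
    "cross a b * m $ 2 = a $ 1 * (b \<bullet> m) - b $ 1 * (a \<bullet> m)"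
    by (simp_all add: cross_def inner_2 algebra_simps)
  then show ?thesis using assms by (simp add: vec_eq_iff_2)
qed

lemma separately_polynomial_diff:
  assumes "separately_polynomial I n f" "separately_polynomial I n g"
  shows "separately_polynomial I n (\<lambda>x. f x - g x)"
proof -
  have "separately_polynomial I (0 + n) (\<lambda>x. - 1 * g x)"
    by (intro separately_polynomial_mult separately_polynomial_const assms)
  then show ?thesis using separately_polynomial_add[OF assms(1)] by fastforce
qed

lemma inf_rigid_cong:
  assumes "\<And>v k. v \<in> V \<Longrightarrow> X (v, k) = Y (v, k)"
  shows "inf_rigid V adj l X \<longleftrightarrow> inf_rigid V adj l Y"
proof -
  have "row_value X r m = row_value Y r m" if "r \<in> graph_rows V adj l" for r m
    using that assms by (auto simp: graph_rows_def)
  then show ?thesis by (auto simp: inf_rigid_def motions_def)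
qed

lemma equivalent_placement_cong:
  assumes "\<And>v k. v \<in> V \<Longrightarrow> X (v, k) = Y (v, k)"
  shows "equivalent_placement V adj l X p \<longleftrightarrow> equivalent_placement V adj l Y p"
  using assms by (simp add: equivalent_placement_def)

lemma finite_graph_rows:
  assumes "finite V"
  shows "finite (graph_rows V adj l)"
proof -
  have "graph_rows V adj l \<subseteq> (\<lambda>(u, v). Edge u v) ` (V \<times> V) \<union> (\<lambda>(v, i). Loop v i) ` (SIGMA v:V. {..<l v})"
    by (auto simp: graph_rows_def)
  then show ?thesis using assms by (auto intro: finite_subset)
qed

text \<open>A smallest set of rows without nonzero motion: fewer rows than coordinates would leave a
  motion, and a row with nonzero coefficient in a linear dependence could be dropped. Independence
  of the rows is expressed as injectivity of the transposed system.\<close>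

lemma independent_rigid_rows:
  assumes V: "finite V" and rigid: "inf_rigid V adj l X"
  shows "\<exists>J \<subseteq> graph_rows V adj l. card (V \<times> (UNIV :: 2 set)) \<le> card J \<and>
    injective_system J (V \<times> UNIV) (\<lambda>a j. row_value X j (unit_motion a))"
proof -
  let ?P = "\<lambda>J. J \<subseteq> graph_rows V adj l \<and> motions X V J \<subseteq> {\<lambda>_. 0}"
  define J where "J = (ARG_MIN card J. ?P J)"
  have "?P (graph_rows V adj l)" using rigid by (simp add: inf_rigid_def)
  then have J: "?P J" and min: "\<And>K. ?P K \<Longrightarrow> card J \<le> card K"
    unfolding J_def using arg_min_natI[of ?P _ card] arg_min_nat_le[of ?P _ card] by blast+
  have finJ: "finite J" using J finite_graph_rows[OF V] finite_subset by blast
  let ?I = "V \<times> (UNIV :: 2 set)"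
  have "card ?I \<le> card J"
  proof (rule ccontr)
    assume "\<not> card ?I \<le> card J"
    then obtain x where x: "\<And>j. j \<in> J \<Longrightarrow> (\<Sum>a\<in>?I. row_value X j (unit_motion a) * x a) = 0" "\<exists>a\<in>?I. x a \<noteq> 0"
      using underdetermined_system[of J ?I "\<lambda>j a. row_value X j (unit_motion a)"] finJ V by auto
    define m where "m v = (if v \<in> V then \<chi> j. x (v, j) else 0)" for v
    have mx: "(\<Sum>a\<in>?I. h a * m (fst a) $ snd a) = (\<Sum>a\<in>?I. h a * x a)" for h
      by (intro sum.cong) (auto simp: m_def)
    have "row_value X j m = 0" if "j \<in> J" for j
      using row_value_coordinates[of V m X j] V x(1)[OF that] unfolding mx by (simp add: m_def)
    then have "m \<in> motions X V J" by (auto simp: motions_def m_def)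
    then have m0: "m = (\<lambda>_. 0)" using J by blast
    obtain v j where "v \<in> V" "x (v, j) \<noteq> 0" using x(2) by auto
    moreover have "m v $ j = 0" by (simp add: m0)
    ultimately show False by (simp add: m_def)
  qed
  moreover have "injective_system J ?I (\<lambda>a j. row_value X j (unit_motion a))"
    unfolding injective_system_def
  proof (intro allI impI ballI)
    fix c j0
    assume c: "\<forall>a\<in>?I. (\<Sum>j\<in>J. row_value X j (unit_motion a) * c j) = 0" and j0: "j0 \<in> J"
    show "c j0 = 0"
    proof (rule ccontr)
      assume "c j0 \<noteq> 0"
      have "motions X V (J - {j0}) \<subseteq> {\<lambda>_. 0}"
      proof
        fix m assume m: "m \<in> motions X V (J - {j0})"
        then have supp: "\<And>v. v \<notin> V \<Longrightarrow> m v = 0" and z: "\<And>j. j \<in> J - {j0} \<Longrightarrow> row_value X j m = 0"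
          by (auto simp: motions_def)
        have "(\<Sum>j\<in>J. c j * row_value X j m) =
          (\<Sum>j\<in>J. \<Sum>a\<in>?I. row_value X j (unit_motion a) * c j * m (fst a) $ snd a)"
          using row_value_coordinates[of V m X] V supp
          by (simp add: sum_distrib_left mult_ac)
        also have "\<dots> = (\<Sum>a\<in>?I. \<Sum>j\<in>J. row_value X j (unit_motion a) * c j * m (fst a) $ snd a)"
          by (rule sum.swap)
        also have "\<dots> = (\<Sum>a\<in>?I. (\<Sum>j\<in>J. row_value X j (unit_motion a) * c j) * m (fst a) $ snd a)"
          by (simp only: sum_distrib_right)
        also have "\<dots> = 0"
          by (rule sum.neutral) (use c in auto)
        finally have "c j0 * row_value X j0 m + (\<Sum>j\<in>J-{j0}. c j * row_value X j m) = 0"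
          using finJ j0 by (simp add: sum.remove)
        moreover have "(\<Sum>j\<in>J-{j0}. c j * row_value X j m) = 0"
          by (rule sum.neutral) (use z in auto)
        ultimately have "row_value X j0 m = 0" using \<open>c j0 \<noteq> 0\<close> by simp
        then have "m \<in> motions X V J" using supp z by (auto simp: motions_def)
        then show "m \<in> {\<lambda>_. 0}" using J by blast
      qed
      then have "card J \<le> card (J - {j0})" using J by (intro min) auto
      then show False using card_Diff1_less[OF finJ j0] by simp
    qed
  qed
  ultimately show ?thesis using J by blast
qed

lemma open_polynomial_nonzero:
  assumes "polynomial_map \<delta>"
  shows "open {X. \<delta> X \<noteq> 0}"
  using open_vimage[of "- {0}" \<delta>] assms
  by (simp add: polynomial_map_def vimage_def open_Compl)

text \<open>Equivalent placements lie in one fibre of the map that records the squared lengths and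
  normal components belonging to \<open>J\<close>. Its gradients are the rows of \<open>J\<close>,
  up to a factor 2 for edges, and they stay independent on an open set. Only the positions on
  \<open>V\<close> vary; the normals remain those of \<open>X1\<close>.\<close>

lemma finite_equivalent_placements:
  fixes \<Omega> :: "'v config set"
  assumes V: "finite V" and \<Omega>: "open \<Omega>" "X1 \<in> \<Omega>" and rigid: "inf_rigid V adj l X1"
  shows "\<exists>X\<in>\<Omega>. finite {p. (\<forall>v. v \<notin> V \<longrightarrow> p v = 0) \<and> equivalent_placement V adj l X p}"
proof -
  let ?I = "V \<times> (UNIV :: 2 set)"
  obtain J where J: "J \<subseteq> graph_rows V adj l" "card ?I \<le> card J"
    and inj: "injective_system J ?I (\<lambda>a j. row_value X1 j (unit_motion a))"
    using independent_rigid_rows[OF V rigid] by blast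
  have finJ: "finite J" using J finite_graph_rows[OF V] finite_subset by blast
  obtain \<delta> where \<delta>: "polynomial_map \<delta>" "\<delta> X1 \<noteq> 0"
    "\<And>X. \<delta> X \<noteq> 0 \<Longrightarrow> injective_system J ?I (\<lambda>a j. row_value X j (unit_motion a))"
    using injective_system_polynomial[of J ?I "\<lambda>X a j. row_value X j (unit_motion a)" X1,
        OF finJ inj row_value_polynomial] by blast
  define P where "P g v = (\<chi> j. g (v, j))" for g :: "'v \<times> 2 \<Rightarrow> real" and v
  define C where "C g = (\<lambda>(v, k). if k = 0 \<and> v \<in> V then P g v else X1 (v, k))" for g
  define U where "U = {g. C g \<in> \<Omega> \<and> \<delta> (C g) \<noteq> 0}"
  define f where "f r g = (case r of
      Edge u v \<Rightarrow> (\<Sum>j\<in>UNIV. (g (u, j) - g (v, j)) * (g (u, j) - g (v, j)))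
    | Loop v i \<Rightarrow> (\<Sum>j\<in>UNIV. g (v, j) * X1 (v, Suc i) $ j))" for r and g :: "'v \<times> 2 \<Rightarrow> real"
  define sc where "sc r = (case r of Edge u v \<Rightarrow> 2 | Loop v i \<Rightarrow> (1::real))" for r :: "'v row"
  define g1 where "g1 = (\<lambda>(v, j). X1 (v, 0) $ j)"
  have "continuous_on UNIV C"
  proof (intro continuous_on_coordinatewise_then_product)
    fix a :: "'v \<times> nat"
    obtain v k where a: "a = (v, k)" by force
    have "continuous_on UNIV (\<lambda>g. P g v)"
      unfolding P_def by (intro continuous_on_vec_lambda continuous_on_product_coordinates)
    then show "continuous_on UNIV (\<lambda>g. C g a)"
      by (cases "k = 0 \<and> v \<in> V") (auto simp: C_def a)
  qed
  then have "open (C -` (\<Omega> \<inter> {X. \<delta> X \<noteq> 0}))"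
    using \<Omega>(1) open_polynomial_nonzero[OF \<delta>(1)] by (intro open_vimage) auto
  moreover have "C -` (\<Omega> \<inter> {X. \<delta> X \<noteq> 0}) = U" by (auto simp: U_def)
  ultimately have "open U" by simp
  have "C g1 = X1" by (auto simp: C_def P_def g1_def vec_eq_iff)
  then have "g1 \<in> U" using \<Omega> \<delta> by (simp add: U_def)
  have "\<exists>x\<in>U. finite {y. (\<forall>i. i \<notin> ?I \<longrightarrow> y i = 0) \<and> (\<forall>j\<in>J. f j y = f j x)}"
  proof (rule finite_fibre[where df = "\<lambda>r g h. sc r * row_value (C g) r (P h)"])
    show "continuous_on UNIV (f j)" for j
      unfolding f_def by (cases j) (auto intro!: continuous_intros continuous_on_product_coordinates)
    show "separately_polynomial ?I 2 (f j)" for j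
    proof (cases j)
      case (Edge u v)
      have "separately_polynomial ?I (1 + 1) (f j)"
        unfolding f_def Edge row.case
        by (intro separately_polynomial_sum separately_polynomial_mult separately_polynomial_diff
            separately_polynomial_coordinate)
      then show ?thesis by (simp add: numeral_2_eq_2)
    next
      case (Loop v i)
      have "separately_polynomial ?I (1 + 0) (f j)"
        unfolding f_def Loop row.case
        by (intro separately_polynomial_sum separately_polynomial_mult
            separately_polynomial_coordinate separately_polynomial_const)
      then show ?thesis by (rule separately_polynomial_mono) simp
    qed
    show "((\<lambda>t. f r (\<lambda>i. x i + t * h i)) has_real_derivative sc r * row_value (C x) r (P h)) (at 0)"
      if "r \<in> J" "x \<in> U" for r x h
    proof -
      have "r \<in> graph_rows V adj l" using that J by auto
      then consider u v where "r = Edge u v" "u \<in> V" "v \<in> V" | v i where "r = Loop v i" "v \<in> V"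
        by (auto simp: graph_rows_def)
      then show ?thesis
      proof cases
        case 1
        define d e where "d j = x (u, j) - x (v, j)" and "e j = h (u, j) - h (v, j)" for j
        have "(\<lambda>t. f r (\<lambda>i. x i + t * h i)) =
            (\<lambda>t. (d 1 + t * e 1) * (d 1 + t * e 1) + (d 2 + t * e 2) * (d 2 + t * e 2))"
          by (simp add: f_def 1 sum_2 d_def e_def algebra_simps)
        moreover have "sc r * row_value (C x) r (P h) = 2 * d 1 * e 1 + 2 * d 2 * e 2"
          using 1 by (simp add: sc_def C_def P_def inner_2 d_def e_def algebra_simps)
        moreover have "((\<lambda>t. (a + t * b) * (a + t * b)) has_real_derivative 2 * a * b) (at 0)" for a b
          by (auto intro!: derivative_eq_intros)
        ultimately show ?thesis by (simp only: DERIV_add)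
      next
        case 2
        define d e where "d j = x (v, j)" and "e j = h (v, j)" for j
        have "(\<lambda>t. f r (\<lambda>i. x i + t * h i)) =
            (\<lambda>t. (d 1 + t * e 1) * X1 (v, Suc i) $ 1 + (d 2 + t * e 2) * X1 (v, Suc i) $ 2)"
          by (simp add: f_def 2 sum_2 d_def e_def)
        moreover have "sc r * row_value (C x) r (P h) = e 1 * X1 (v, Suc i) $ 1 + e 2 * X1 (v, Suc i) $ 2"
          using 2 by (simp add: sc_def C_def P_def inner_2 e_def mult.commute)
        moreover have "((\<lambda>t. (a + t * b) * c) has_real_derivative b * c) (at 0)" for a b c
          by (auto intro!: derivative_eq_intros)
        ultimately show ?thesis by (simp only: DERIV_add)
      qed
    qed
    show "c j = 0" if x: "x \<in> U" and z: "\<And>h. (\<Sum>j\<in>J. c j * (sc j * row_value (C x) j (P h))) = 0"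
      and j: "j \<in> J" for x c j
    proof -
      have "P (\<lambda>b. if b = a then 1 else 0) = unit_motion a" for a
        by (cases a) (auto simp: P_def unit_motion_def vec_eq_iff axis_def)
      then have "(\<Sum>j\<in>J. row_value (C x) j (unit_motion a) * (c j * sc j)) = 0" for a
        using z[of "\<lambda>b. if b = a then 1 else 0"] by (simp add: mult_ac)
      then have "c j * sc j = 0"
        using injective_systemD[OF \<delta>(3), of "C x" "\<lambda>j. c j * sc j" j] x j by (simp add: U_def)
      then show ?thesis by (cases j) (auto simp: sc_def)
    qed
  qed (use V finJ J \<open>open U\<close> \<open>g1 \<in> U\<close> in auto)
  then obtain x where x: "x \<in> U" and fin: "finite {y. (\<forall>i. i \<notin> ?I \<longrightarrow> y i = 0) \<and> (\<forall>j\<in>J. f j y = f j x)}"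
    by blast
  let ?F = "{p. (\<forall>v. v \<notin> V \<longrightarrow> p v = 0) \<and> equivalent_placement V adj l (C x) p}"
  let ?h = "\<lambda>p (v, j). p v $ j"
  have "?h ` ?F \<subseteq> {y. (\<forall>i. i \<notin> ?I \<longrightarrow> y i = 0) \<and> (\<forall>j\<in>J. f j y = f j x)}"
  proof
    fix y assume "y \<in> ?h ` ?F"
    then obtain p where p: "\<And>v. v \<notin> V \<Longrightarrow> p v = 0" "equivalent_placement V adj l (C x) p" "y = ?h p"
      by auto
    have "f r y = f r x" if "r \<in> J" for r
    proof -
      have "r \<in> graph_rows V adj l" using that J by auto
      then consider u v where "r = Edge u v" "u \<in> V" "v \<in> V" "adj u v"
        | v i where "r = Loop v i" "v \<in> V" "i < l v"
        by (auto simp: graph_rows_def)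
      then show ?thesis
      proof cases
        case 1
        then have "(norm (p u - p v))\<^sup>2 = (norm (P x u - P x v))\<^sup>2"
          using p(2) by (simp add: equivalent_placement_def C_def)
        then show ?thesis using 1 by (simp add: f_def p(3) sum_2 norm_sq_2 P_def)
      next
        case 2
        then have "p v \<bullet> X1 (v, Suc i) = P x v \<bullet> X1 (v, Suc i)"
          using p(2) by (simp add: equivalent_placement_def C_def)
        then show ?thesis using 2 by (simp add: f_def p(3) sum_2 inner_2 P_def)
      qed
    qed
    then show "y \<in> {y. (\<forall>i. i \<notin> ?I \<longrightarrow> y i = 0) \<and> (\<forall>j\<in>J. f j y = f j x)}"
      using p(1,3) by auto
  qed
  then have "finite (?h ` ?F)" using fin finite_subset by blast
  moreover have "inj_on ?h ?F"
  proof (rule inj_onI)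
    fix p p' :: "'v \<Rightarrow> real ^ 2" assume eq: "?h p = ?h p'"
    have "p v $ j = p' v $ j" for v j using fun_cong[OF eq, of "(v, j)"] by simp
    then show "p = p'" by (auto simp: vec_eq_iff)
  qed
  ultimately have "finite ?F" by (rule finite_imageD)
  then show ?thesis using x by (auto simp: U_def)
qed

lemma inf_rigid_polynomial:
  assumes "finite V" "inf_rigid V adj l Y"
  shows "\<exists>\<delta>. polynomial_map \<delta> \<and> \<delta> Y \<noteq> 0 \<and> (\<forall>X. \<delta> X \<noteq> 0 \<longrightarrow> inf_rigid V adj l X)"
  using killed_by_polynomial[OF assms(1), of Y "graph_rows V adj l" 0 "\<lambda>_ _. 0"] assms(2)
  unfolding inf_rigid_iff_killed[where f = "\<lambda>_ _. 0"] by blast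

text \<open>The demands hold at different configurations at first. Global rigidity for the modified
  graph holds near \<open>X0\<close>; within that neighbourhood, rigidity and the
  \<open>\<psi> t\<close> are secured by avoiding algebraic sets, and the finite fibre exists in
  every open set around a rigid configuration.\<close>

lemma generic_finite_fibre:
  assumes V: "finite V" and good: "inf_rigid V adj' l' X0" "glob_rigid V adj' l' X0"
    and rigid: "inf_rigid V adj l X1"
    and T: "finite T" "\<And>t. t \<in> T \<Longrightarrow> polynomial_map (\<psi> t)" "\<And>t. t \<in> T \<Longrightarrow> \<exists>Y. \<psi> t Y \<noteq> 0"
  shows "\<exists>X. glob_rigid V adj' l' X \<and> inf_rigid V adj l X \<and> (\<forall>t\<in>T. \<psi> t X \<noteq> 0) \<and>
    finite {p. (\<forall>v. v \<notin> V \<longrightarrow> p v = 0) \<and> equivalent_placement V adj l X p}"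
proof -
  obtain \<Omega> where \<Omega>: "open \<Omega>" "X0 \<in> \<Omega>" "\<And>X. X \<in> \<Omega> \<Longrightarrow> glob_rigid V adj' l' X"
    using glob_rigid_stable[OF V good] by blast
  obtain \<delta> where \<delta>: "polynomial_map \<delta>" "\<delta> X1 \<noteq> 0" "\<And>X. \<delta> X \<noteq> 0 \<Longrightarrow> inf_rigid V adj l X"
    using inf_rigid_polynomial[OF V rigid] by blast
  define \<Psi> where "\<Psi> t = (case t of None \<Rightarrow> \<delta> | Some t \<Rightarrow> \<psi> t)" for t
  let ?T = "insert None (Some ` T)"
  have pol: "polynomial_map (\<Psi> t)" if "t \<in> ?T" for t
    using that \<delta>(1) T(2) by (auto simp: \<Psi>_def)
  have nz: "\<exists>Y. \<Psi> t Y \<noteq> 0" if "t \<in> ?T" for t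
    using that \<delta>(2) T(3) by (auto simp: \<Psi>_def)
  have "finite ?T" using T(1) by simp
  then have "\<exists>X\<in>\<Omega>. \<forall>t\<in>?T. \<Psi> t X \<noteq> 0"
    by (rule polynomial_maps_avoid[OF _ \<Omega>(1,2) pol nz])
  then obtain X2 where X2: "X2 \<in> \<Omega>" "\<And>t. t \<in> ?T \<Longrightarrow> \<Psi> t X2 \<noteq> 0" by blast
  let ?\<Omega> = "\<Omega> \<inter> (\<Inter>t\<in>?T. {X. \<Psi> t X \<noteq> 0})"
  have "open {X. \<Psi> t X \<noteq> 0}" if "t \<in> ?T" for t
    by (rule open_polynomial_nonzero[OF pol[OF that]])
  then have op: "open ?\<Omega>" using \<Omega>(1) T(1) by (intro open_Int open_INT finite_insert[THEN iffD2] finite_imageI ballI)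
  have mem: "X2 \<in> ?\<Omega>" using X2 by auto
  have rig: "inf_rigid V adj l X2" using X2(2)[of None] by (intro \<delta>(3)) (simp add: \<Psi>_def)
  obtain X where X: "X \<in> ?\<Omega>"
    "finite {p. (\<forall>v. v \<notin> V \<longrightarrow> p v = 0) \<and> equivalent_placement V adj l X p}"
    using finite_equivalent_placements[OF V op mem rig] by blast
  have "\<Psi> None X \<noteq> 0" "\<And>t. t \<in> T \<Longrightarrow> \<Psi> (Some t) X \<noteq> 0" using X(1) by auto
  then have nz: "\<delta> X \<noteq> 0" "\<And>t. t \<in> T \<Longrightarrow> \<psi> t X \<noteq> 0" by (auto simp: \<Psi>_def)
  have "glob_rigid V adj' l' X" using X(1) by (intro \<Omega>(3)) blast
  moreover have "inf_rigid V adj l X" by (rule \<delta>(3)[OF nz(1)])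
  ultimately show ?thesis using X(2) nz(2) by blast
qed

section \<open>Deleting a vertex\<close>

definition polynomial_vec :: "(('c \<Rightarrow> real ^ 2) \<Rightarrow> real ^ 2) \<Rightarrow> bool" where
  "polynomial_vec F \<longleftrightarrow> (\<forall>j. polynomial_map (\<lambda>X. F X $ j))"

lemma polynomial_vec_intros:
  "polynomial_vec (\<lambda>X. c)"
  "polynomial_vec (\<lambda>X. X a)"
  "polynomial_vec F \<Longrightarrow> polynomial_vec G \<Longrightarrow> polynomial_vec (\<lambda>X. F X - G X)"
  by (simp_all add: polynomial_vec_def polynomial_map_intros)

lemma polynomial_map_inner:
  "polynomial_vec F \<Longrightarrow> polynomial_vec G \<Longrightarrow> polynomial_map (\<lambda>X. F X \<bullet> G X)"
  unfolding polynomial_vec_def inner_2 by (intro polynomial_map_intros) auto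

lemma polynomial_map_cross:
  "polynomial_vec F \<Longrightarrow> polynomial_vec G \<Longrightarrow> polynomial_map (\<lambda>X. cross (F X) (G X))"
  unfolding polynomial_vec_def cross_def by (intro polynomial_map_intros) auto

lemma polynomial_map_power:
  "polynomial_map f \<Longrightarrow> polynomial_map (\<lambda>X. f X ^ n)"
  by (induction n) (simp_all add: polynomial_map_intros)

lemmas polynomial_vec_rules =
  polynomial_map_const polynomial_map_add polynomial_map_mult polynomial_map_diff
  polynomial_map_power polynomial_map_inner polynomial_map_cross polynomial_vec_intros

text \<open>For a deleted vertex whose position \<open>x\<close> is fixed by its loops: if a
  neighbour moves from \<open>a\<close> to \<open>b\<close> and keeps its distance, then
  \<open>x\<close> lies on the perpendicular bisector, whose equation is \<phi>. Polynomiality is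
  stated through composition so that \<phi> can be applied to any entry of a configuration.\<close>

lemma point_obstruction:
  fixes a b :: "real ^ 2"
  assumes "a \<noteq> b"
  obtains \<phi> where "\<And>F :: ('c \<Rightarrow> real ^ 2) \<Rightarrow> _. polynomial_vec F \<Longrightarrow> polynomial_map (\<lambda>X. \<phi> (F X))"
    and "\<exists>x. \<phi> x \<noteq> (0::real)" and "\<And>x. (norm (x - b))\<^sup>2 = (norm (x - a))\<^sup>2 \<Longrightarrow> \<phi> x = 0"
proof
  let ?\<phi> = "\<lambda>x. (x - a) \<bullet> (x - a) - (x - b) \<bullet> (x - b)"
  show "polynomial_map (\<lambda>X. ?\<phi> (F X))" if "polynomial_vec F" for F :: "('c \<Rightarrow> real ^ 2) \<Rightarrow> _"
    by (intro polynomial_vec_rules that)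
  show "\<exists>x. ?\<phi> x \<noteq> 0" using assms by (intro exI[of _ a]) simp
  show "?\<phi> x = 0" if "(norm (x - b))\<^sup>2 = (norm (x - a))\<^sup>2" for x
    using that by (simp add: power2_norm_eq_inner)
qed

text \<open>The Gram determinant of three vectors in the plane vanishes; here it is expressed in terms
  of the distances from \<open>x\<close> to the \<open>a i\<close>, which are those from a point to the \<open>b i\<close>.\<close>

lemma triangle_obstruction:
  fixes a1 a2 a3 b1 b2 b3 :: "real ^ 2"
  assumes nc: "cross (a2 - a1) (a3 - a1) \<noteq> 0"
    and ne: "(norm (b2 - b1))\<^sup>2 \<noteq> (norm (a2 - a1))\<^sup>2"
  obtains \<phi> where "\<And>F :: ('c \<Rightarrow> real ^ 2) \<Rightarrow> _. polynomial_vec F \<Longrightarrow> polynomial_map (\<lambda>X. \<phi> (F X))"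
    and "\<exists>x. \<phi> x \<noteq> (0::real)"
    and "\<And>x y. (norm (y - b1))\<^sup>2 = (norm (x - a1))\<^sup>2 \<Longrightarrow> (norm (y - b2))\<^sup>2 = (norm (x - a2))\<^sup>2 \<Longrightarrow>
      (norm (y - b3))\<^sup>2 = (norm (x - a3))\<^sup>2 \<Longrightarrow> \<phi> x = 0"
proof (cases "b2 = b1")
  case True
  \<comment> \<open>For \<open>b1 = b2\<close> the factor \<open>D\<close> below is zero and the
    argument by it breaks down, but then \<open>x\<close> is equidistant from \<open>a1\<close> and
    \<open>a2\<close>.\<close>
  let ?\<phi> = "\<lambda>x. (x - a1) \<bullet> (x - a1) - (x - a2) \<bullet> (x - a2)"
  show ?thesis
  proof
    show "polynomial_map (\<lambda>X. ?\<phi> (F X))" if "polynomial_vec F" for F :: "('c \<Rightarrow> real ^ 2) \<Rightarrow> _"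
      by (intro polynomial_vec_rules that)
    have "a1 \<noteq> a2" using nc by (auto simp: cross_def)
    then show "\<exists>x. ?\<phi> x \<noteq> 0" by (intro exI[of _ a1]) simp
    show "?\<phi> x = 0" if "(norm (y - b1))\<^sup>2 = (norm (x - a1))\<^sup>2" "(norm (y - b2))\<^sup>2 = (norm (x - a2))\<^sup>2"
      for x y using that True by (simp add: power2_norm_eq_inner)
  qed
next
  case False
  define e f E F where "e = b2 - b1" and "f = b3 - b1" and "E = a2 - a1" and "F = a3 - a1"
  define b c where "b = (e \<bullet> e - E \<bullet> E) / 2" and "c = (f \<bullet> f - F \<bullet> F) / 2"
  define D where "D = (e \<bullet> e) * (f \<bullet> f) - (e \<bullet> f)\<^sup>2"
  \<comment> \<open>The Gram determinant of \<open>z = y - b1\<close>, \<open>e\<close> and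
    \<open>f\<close>, in which \<open>z \<bullet> e\<close> and \<open>z \<bullet> f\<close> appear
    as \<open>\<xi> \<bullet> E + b\<close> and \<open>\<xi> \<bullet> F + c\<close>, with
    \<open>\<xi> = x - a1\<close>.\<close>
  define \<phi> where "\<phi> \<xi> = (\<xi> \<bullet> \<xi>) * D - (\<xi> \<bullet> E + b)\<^sup>2 * (f \<bullet> f) - (\<xi> \<bullet> F + c)\<^sup>2 * (e \<bullet> e)
    + 2 * (\<xi> \<bullet> E + b) * (\<xi> \<bullet> F + c) * (e \<bullet> f)" for \<xi>
  show ?thesis
  proof
    show "polynomial_map (\<lambda>X. \<phi> (G X - a1))" if "polynomial_vec G" for G :: "('c \<Rightarrow> real ^ 2) \<Rightarrow> _"
      unfolding \<phi>_def by (intro polynomial_vec_rules that)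
    show "\<phi> (x - a1) = 0"
      if h: "(norm (y - b1))\<^sup>2 = (norm (x - a1))\<^sup>2" "(norm (y - b2))\<^sup>2 = (norm (x - a2))\<^sup>2"
        "(norm (y - b3))\<^sup>2 = (norm (x - a3))\<^sup>2" for x y
    proof -
      define z \<xi> where "z = y - b1" and "\<xi> = x - a1"
      have eqs: "y - b2 = z - e" "x - a2 = \<xi> - E" "y - b3 = z - f" "x - a3 = \<xi> - F"
        by (simp_all add: z_def \<xi>_def e_def E_def f_def F_def)
      have zz: "z \<bullet> z = \<xi> \<bullet> \<xi>" using h(1) unfolding power2_norm_eq_inner z_def \<xi>_def .
      have ze: "(z - e) \<bullet> (z - e) = (\<xi> - E) \<bullet> (\<xi> - E)"
        using h(2) unfolding eqs power2_norm_eq_inner .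
      have zf: "(z - f) \<bullet> (z - f) = (\<xi> - F) \<bullet> (\<xi> - F)"
        using h(3) unfolding eqs power2_norm_eq_inner .
      have ze: "\<xi> \<bullet> E + b = z \<bullet> e" using zz ze by (simp add: b_def inner_diff inner_commute field_simps)
      have zf: "\<xi> \<bullet> F + c = z \<bullet> f" using zz zf by (simp add: c_def inner_diff inner_commute field_simps)
      have "\<phi> \<xi> = 0"
        unfolding \<phi>_def ze zf zz[symmetric] D_def unfolding inner_2 by algebra
      then show ?thesis by (simp add: \<xi>_def)
    qed
    have "\<exists>\<xi>. \<phi> \<xi> \<noteq> 0"
    proof (rule ccontr)
      assume "\<not> (\<exists>\<xi>. \<phi> \<xi> \<noteq> 0)"
      then have z: "\<phi> \<xi> = 0" for \<xi> by blast
      define k where "k = cross E F"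
      have k: "k \<noteq> 0" using nc by (simp add: k_def E_def F_def)
      \<comment> \<open>The basis dual to \<open>E\<close> and \<open>F\<close>. The values of
        \<phi> at 0 and at plus and minus these vectors isolate its coefficients, which force
        \<open>b = 0\<close>, that is, an unchanged length.\<close>
      define u v :: "real ^ 2" where "u = vector [F $ 2 / k, - F $ 1 / k]" and "v = vector [- E $ 2 / k, E $ 1 / k]"
      have uv: "u \<bullet> E = 1" "u \<bullet> F = 0" "v \<bullet> E = 0" "v \<bullet> F = 1"
        using k unfolding u_def v_def inner_2 vector_2
        by (simp_all add: field_simps) (simp_all add: k_def cross_def)
      note exp = \<phi>_def uv inner_minus_left power2_eq_square algebra_simps
      have 0: "b * b * (f \<bullet> f) + c * c * (e \<bullet> e) = 2 * b * c * (e \<bullet> f)"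
        using z[of 0] by (simp add: exp)
      have 1: "b * (f \<bullet> f) = c * (e \<bullet> f)" "(u \<bullet> u) * D = f \<bullet> f"
        using z[of u] z[of "- u"] 0 by (simp_all add: exp)
      have 2: "c * (e \<bullet> e) = b * (e \<bullet> f)" "(v \<bullet> v) * D = e \<bullet> e"
        using z[of v] z[of "- v"] 0 by (simp_all add: exp)
      have "D \<noteq> 0" using 2(2) False by (auto simp: e_def)
      moreover have "b * D = 0"
        using 1(1) 2(1) unfolding D_def by algebra
      ultimately have "b = 0" by simp
      then show False using ne by (simp add: b_def e_def E_def power2_norm_eq_inner)
    qed
    then obtain \<xi> where "\<phi> \<xi> \<noteq> 0" by blast
    then show "\<exists>x. \<phi> (x - a1) \<noteq> 0" by (intro exI[of _ "\<xi> + a1"]) simp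
  qed
qed

text \<open>The loop confines the vertex to the line through \<open>x\<close> with normal
  \<open>q\<close>, so \<open>y\<close> is \<open>x\<close> shifted by a parameter \<open>s\<close>.
  Both distance conditions are quadratic in \<open>s\<close> with the same leading coefficient;
  their difference is linear in \<open>s\<close>, and eliminating \<open>s\<close> gives
  \<phi>.\<close>

lemma slider_obstruction:
  fixes a1 a2 b1 b2 :: "real ^ 2"
  assumes "a1 \<noteq> a2" "b1 \<noteq> a1"
  obtains \<phi> where "\<And>F G :: ('c \<Rightarrow> real ^ 2) \<Rightarrow> _. polynomial_vec F \<Longrightarrow> polynomial_vec G \<Longrightarrow>
      polynomial_map (\<lambda>X. \<phi> (F X) (G X))"
    and "\<exists>x q. \<phi> x q \<noteq> (0::real)"
    and "\<And>x q y. y \<bullet> q = x \<bullet> q \<Longrightarrow> (norm (y - b1))\<^sup>2 = (norm (x - a1))\<^sup>2 \<Longrightarrow>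
      (norm (y - b2))\<^sup>2 = (norm (x - a2))\<^sup>2 \<Longrightarrow> \<phi> x q = 0"
proof -
  define \<alpha> where "\<alpha> a b x = (x - a) \<bullet> (x - a) - (x - b) \<bullet> (x - b)" for a b x :: "real ^ 2"
  define d where "d = b2 - b1"
  define \<phi> where "\<phi> x q = 4 * \<alpha> a1 b1 x * (cross q d)\<^sup>2
    - 4 * (\<alpha> a1 b1 x - \<alpha> a2 b2 x) * cross q d * cross q (x - b1)
    - (\<alpha> a1 b1 x - \<alpha> a2 b2 x)\<^sup>2 * (q \<bullet> q)" for x q
  show thesis
  proof (rule that[of \<phi>])
    show "polynomial_map (\<lambda>X. \<phi> (F X) (G X))" if "polynomial_vec F" "polynomial_vec G"
      for F G :: "('c \<Rightarrow> real ^ 2) \<Rightarrow> _"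
      unfolding \<phi>_def \<alpha>_def by (intro polynomial_vec_rules that)
    show "\<phi> x q = 0" if h: "y \<bullet> q = x \<bullet> q" "(norm (y - b1))\<^sup>2 = (norm (x - a1))\<^sup>2"
      "(norm (y - b2))\<^sup>2 = (norm (x - a2))\<^sup>2" for x q y
    proof (cases "q = 0")
      case True
      then show ?thesis by (simp add: \<phi>_def cross_def)
    next
      case False
      then have qq: "q \<bullet> q \<noteq> 0" by simp
      define s where "s = cross q (y - x) / (q \<bullet> q)"
      have "(q \<bullet> q) * (y $ 1 - x $ 1) = - (cross q (y - x)) * q $ 2 + q $ 1 * (y \<bullet> q - x \<bullet> q)"
        "(q \<bullet> q) * (y $ 2 - x $ 2) = (cross q (y - x)) * q $ 1 + q $ 2 * (y \<bullet> q - x \<bullet> q)"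
        by (simp_all add: cross_def inner_2 algebra_simps)
      then have y: "y $ 1 = x $ 1 - s * q $ 2" "y $ 2 = x $ 2 + s * q $ 1"
        using qq h(1) by (simp_all add: s_def field_simps)
      have A: "\<alpha> a b x = 2 * s * cross q (x - b) + s * s * (q \<bullet> q)"
        if "(norm (y - b))\<^sup>2 = (norm (x - a))\<^sup>2" for a b
        using that unfolding \<alpha>_def power2_norm_eq_inner by (simp add: inner_2 cross_def y algebra_simps)
      have D: "\<alpha> a1 b1 x - \<alpha> a2 b2 x = 2 * s * cross q d"
        unfolding A[OF h(2)] A[OF h(3)] d_def by (simp add: cross_def algebra_simps)
      show ?thesis
        unfolding \<phi>_def D unfolding A[OF h(2)] by (simp add: algebra_simps power2_eq_square)
    qed
    \<comment> \<open>The point is \<open>x = a1\<close>. If the two values of \<alpha> differ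
      there, a normal with \<open>cross q d = 0\<close> leaves only the last term of \<phi>. If they
      agree, \<open>q\<close> orthogonal to \<open>d\<close> leaves only the first, where \<alpha>
      is nonzero because \<open>b1\<close> differs from \<open>a1\<close>.\<close>
    show "\<exists>x q. \<phi> x q \<noteq> 0"
    proof (cases "d = 0")
      case True
      then have "\<alpha> a1 b1 a1 - \<alpha> a2 b2 a1 = - ((a1 - a2) \<bullet> (a1 - a2))"
        by (simp add: \<alpha>_def d_def)
      then have "\<alpha> a1 b1 a1 - \<alpha> a2 b2 a1 \<noteq> 0" using assms by simp
      moreover have "\<phi> a1 (axis 1 1) = - (\<alpha> a1 b1 a1 - \<alpha> a2 b2 a1)\<^sup>2"
        using True by (simp add: \<phi>_def cross_def inner_axis_axis)
      ultimately show ?thesis by (intro exI[of _ a1] exI[of _ "axis 1 1"]) simp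
    next
      case False
      then have dd: "d \<bullet> d \<noteq> 0" by simp
      have a: "\<alpha> a1 b1 a1 \<noteq> 0" using assms by (simp add: \<alpha>_def)
      show ?thesis
      proof (cases "\<alpha> a1 b1 a1 = \<alpha> a2 b2 a1")
        case True
        have "cross (vector [d $ 2, - d $ 1]) d = d \<bullet> d" by (simp add: cross_def inner_2)
        then have "\<phi> a1 (vector [d $ 2, - d $ 1]) \<noteq> 0" using True a dd by (simp add: \<phi>_def)
        then show ?thesis by blast
      next
        case False
        have "cross d d = 0" by (simp add: cross_def)
        then have "\<phi> a1 d \<noteq> 0" using False dd by (simp add: \<phi>_def)
        then show ?thesis by blast
      qed
    qed
  qed
qed

section \<open>Placing the deleted vertex\<close>

lemma inf_rigidI:
  assumes "\<And>m. (\<And>u v. u \<in> V \<Longrightarrow> v \<in> V \<Longrightarrow> adj u v \<Longrightarrow> (X (u, 0) - X (v, 0)) \<bullet> (m u - m v) = 0) \<Longrightarrow>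
    (\<And>v i. v \<in> V \<Longrightarrow> i < l v \<Longrightarrow> X (v, Suc i) \<bullet> m v = 0) \<Longrightarrow> (\<And>v. v \<in> V \<Longrightarrow> m v = 0)"
  shows "inf_rigid V adj l X"
  unfolding inf_rigid_def
proof
  fix m assume m: "m \<in> motions X V (graph_rows V adj l)"
  have "row_value X (Edge u v) m = 0" if "u \<in> V" "v \<in> V" "adj u v" for u v
    using m that by (force simp: motions_def graph_rows_def simp del: row_value.simps)
  moreover have "row_value X (Loop v i) m = 0" if "v \<in> V" "i < l v" for v i
    using m that by (force simp: motions_def graph_rows_def simp del: row_value.simps)
  ultimately have "m v = 0" if "v \<in> V" for v using that by (intro assms) auto
  moreover have "m v = 0" if "v \<notin> V" for v using m that by (simp add: motions_def)
  ultimately have "m = (\<lambda>_. 0)" by (intro ext) blast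
  then show "m \<in> {\<lambda>_. 0}" by simp
qed

lemma three_distances:
  fixes a1 a2 a3 x y :: "real ^ 2"
  assumes "cross (a2 - a1) (a3 - a1) \<noteq> 0" "(norm (y - a1))\<^sup>2 = (norm (x - a1))\<^sup>2"
    "(norm (y - a2))\<^sup>2 = (norm (x - a2))\<^sup>2" "(norm (y - a3))\<^sup>2 = (norm (x - a3))\<^sup>2"
  shows "y = x"
proof -
  have "(a2 - a1) \<bullet> (y - x) = 0" "(a3 - a1) \<bullet> (y - x) = 0"
    using assms(2-4) by (simp_all add: power2_norm_eq_inner inner_2 algebra_simps)
  then show ?thesis using orthogonal_to_independent[OF assms(1), of "y - x"] by simp
qed

lemma slider_distances:
  fixes a1 a2 x y :: "real ^ 2"
  assumes "cross q (a2 - a1) \<noteq> 0" "y \<bullet> q = x \<bullet> q" "(norm (y - a1))\<^sup>2 = (norm (x - a1))\<^sup>2"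
    "(norm (y - a2))\<^sup>2 = (norm (x - a2))\<^sup>2"
  shows "y = x"
proof -
  have "q \<bullet> (y - x) = 0" "(a2 - a1) \<bullet> (y - x) = 0"
    using assms(2-4) by (simp_all add: power2_norm_eq_inner inner_2 algebra_simps)
  then show ?thesis using orthogonal_to_independent[OF assms(1), of "y - x"] by simp
qed

lemma inf_rigid_insert:
  assumes rigid: "inf_rigid V adj l X"
    and w: "\<And>m. (\<And>v. v \<in> V \<Longrightarrow> adj w v \<Longrightarrow> (X (w, 0) - X (v, 0)) \<bullet> m = 0) \<Longrightarrow>
      (\<And>i. i < l w \<Longrightarrow> X (w, Suc i) \<bullet> m = 0) \<Longrightarrow> m = 0"
  shows "inf_rigid (insert w V) adj l X"
proof (rule inf_rigidI)
  fix m :: "'a \<Rightarrow> real ^ 2" and v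
  assume e: "\<And>u v. u \<in> insert w V \<Longrightarrow> v \<in> insert w V \<Longrightarrow> adj u v \<Longrightarrow> (X (u, 0) - X (v, 0)) \<bullet> (m u - m v) = 0"
    and lo: "\<And>v i. v \<in> insert w V \<Longrightarrow> i < l v \<Longrightarrow> X (v, Suc i) \<bullet> m v = 0"
    and v: "v \<in> insert w V"
  have z: "m v = 0" if "v \<in> V" for v
    by (rule inf_rigidD[OF rigid _ _ that]) (use e lo in auto)
  have "m w = 0"
  proof (rule w)
    show "(X (w, 0) - X (v, 0)) \<bullet> m w = 0" if "v \<in> V" "adj w v" for v
      using e[of w v] z[of v] that by simp
    show "X (w, Suc i) \<bullet> m w = 0" if "i < l w" for i using lo[of w i] that by simp
  qed
  then show "m v = 0" using v z by auto
qed

lemma equivalent_placement_restrict: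
  assumes "equivalent_placement (insert w V) adj l X p"
  shows "equivalent_placement V adj l X (\<lambda>v. if v \<in> V then p v else 0)"
  using assms by (simp add: equivalent_placement_def)

lemma three_elements:
  assumes "card N \<ge> 3"
  obtains a b c where "a \<in> N" "b \<in> N" "c \<in> N" "a \<noteq> b" "a \<noteq> c" "b \<noteq> c"
proof -
  obtain M where M: "M \<subseteq> N" "card M = 3" using obtain_subset_with_card_n[OF assms] by metis
  then obtain a b c where "M = {a, b, c}" "a \<noteq> b" "b \<noteq> c" "a \<noteq> c" by (auto simp: card_3_iff)
  then show thesis using M(1) that[of a b c] by auto
qed

text \<open>Without a loop at \<open>w\<close>, its edges only say that some point of the plane has
  given distances to the neighbours. This can recover their mutual distances but not their
  positions, hence the clique on \<open>N\<close>. Only finitely many placements change one of these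
  distances, and each excludes only the zero set of a nonzero polynomial as a place for
  \<open>w\<close>.\<close>

lemma delete_loopless_vertex:
  fixes V :: "'v set"
  assumes V: "finite V" "w \<notin> V" and N: "N = {v \<in> V. adj w v}" "card N \<ge> 3" and lw: "l w = 0"
    and rigid: "inf_rigid V adj l X1"
    and good: "inf_rigid V (\<lambda>u v. adj u v \<or> (u \<in> N \<and> v \<in> N \<and> u \<noteq> v)) l X0"
      "glob_rigid V (\<lambda>u v. adj u v \<or> (u \<in> N \<and> v \<in> N \<and> u \<noteq> v)) l X0"
  shows "\<exists>X. inf_rigid (insert w V) adj l X \<and> glob_rigid (insert w V) adj l X"
proof -
  let ?adj = "\<lambda>u v. adj u v \<or> (u \<in> N \<and> v \<in> N \<and> u \<noteq> v)"
  define T where "T = {(i, j, k). i \<in> N \<and> j \<in> N \<and> k \<in> N \<and> i \<noteq> j \<and> i \<noteq> k \<and> j \<noteq> k}"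
  define \<psi> where "\<psi> = (\<lambda>(i, j, k) X :: 'v config. cross (X (j, 0) - X (i, 0)) (X (k, 0) - X (i, 0)))"
  have finN: "finite N" using V N by simp
  have "T \<subseteq> N \<times> N \<times> N" by (auto simp: T_def)
  then have finT: "finite T" using finN finite_subset by blast
  have pol\<psi>: "polynomial_map (\<psi> t)" if "t \<in> T" for t
    unfolding \<psi>_def by (cases t) (simp, intro polynomial_vec_rules)
  have nz\<psi>: "\<exists>Y. \<psi> t Y \<noteq> 0" if tT: "t \<in> T" for t
  proof -
    obtain i j k where t: "t = (i, j, k)" by (cases t)
    have "\<psi> t (\<lambda>(v, _). if v = j then axis 1 1 else if v = k then axis 2 1 else 0) = 1"
      using tT unfolding t by (auto simp: \<psi>_def T_def cross_def axis_def)
    then show ?thesis by (metis zero_neq_one)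
  qed
  obtain X where X: "glob_rigid V ?adj l X" "inf_rigid V adj l X" "\<forall>t\<in>T. \<psi> t X \<noteq> 0"
    and fin: "finite {p. (\<forall>v. v \<notin> V \<longrightarrow> p v = 0) \<and> equivalent_placement V adj l X p}"
    using generic_finite_fibre[where T = T and \<psi> = \<psi>, OF V(1) good rigid finT pol\<psi> nz\<psi>] by blast
  have nc: "cross (X (j, 0) - X (i, 0)) (X (k, 0) - X (i, 0)) \<noteq> 0"
    if "i \<in> N" "j \<in> N" "k \<in> N" "i \<noteq> j" "i \<noteq> k" "j \<noteq> k" for i j k
    using X(3)[rule_format, of "(i, j, k)"] that by (simp add: T_def \<psi>_def)
  obtain n1 n2 n3 where n: "n1 \<in> N" "n2 \<in> N" "n3 \<in> N" "n1 \<noteq> n2" "n1 \<noteq> n3" "n2 \<noteq> n3"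
    using three_elements[OF N(2)] by metis
  define a where "a v = X (v, 0)" for v
  define B where "B = {p. (\<forall>v. v \<notin> V \<longrightarrow> p v = 0) \<and> equivalent_placement V adj l X p \<and>
    (\<exists>i\<in>N. \<exists>j\<in>N. i \<noteq> j \<and> (norm (p j - p i))\<^sup>2 \<noteq> (norm (a j - a i))\<^sup>2)}"
  have finB: "finite B" by (rule finite_subset[OF _ fin]) (auto simp: B_def)
  define ok where "ok p \<phi> \<longleftrightarrow> polynomial_map (\<lambda>X :: 'v config. \<phi> (X (w, 0))) \<and> (\<exists>x. \<phi> x \<noteq> 0) \<and>
    (\<forall>x y. (\<forall>i\<in>N. (norm (y - p i))\<^sup>2 = (norm (x - a i))\<^sup>2) \<longrightarrow> \<phi> x = (0::real))" for p :: "'v \<Rightarrow> real ^ 2" and \<phi>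
  have ex\<phi>: "\<exists>\<phi>. ok p \<phi>" if pB: "p \<in> B" for p
  proof -
    obtain i j where ij: "i \<in> N" "j \<in> N" "i \<noteq> j" "(norm (p j - p i))\<^sup>2 \<noteq> (norm (a j - a i))\<^sup>2"
      using pB unfolding B_def by blast
    \<comment> \<open>A third neighbour is required, since two distances alone put no condition on
      \<open>w\<close>.\<close>
    obtain k where k: "k \<in> N" "k \<noteq> i" "k \<noteq> j" using n by metis
    obtain \<phi> where \<phi>: "\<And>F :: 'v config \<Rightarrow> _. polynomial_vec F \<Longrightarrow> polynomial_map (\<lambda>X. \<phi> (F X))"
      "\<exists>x. \<phi> x \<noteq> (0::real)"
      "\<And>x y. (norm (y - p i))\<^sup>2 = (norm (x - a i))\<^sup>2 \<Longrightarrow> (norm (y - p j))\<^sup>2 = (norm (x - a j))\<^sup>2 \<Longrightarrow>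
        (norm (y - p k))\<^sup>2 = (norm (x - a k))\<^sup>2 \<Longrightarrow> \<phi> x = 0"
      using triangle_obstruction[of "a j" "a i" "a k" "p j" "p i" "p k"] nc[of i j k] ij k
      unfolding a_def by blast
    show ?thesis unfolding ok_def
      using \<phi>(1)[OF polynomial_vec_intros(2)] \<phi>(2,3) ij k by (intro exI[of _ \<phi>]) blast
  qed
  obtain \<phi> where ok: "\<forall>p\<in>B. ok p (\<phi> p)"
    using bchoice[of B ok] ex\<phi> by blast
  have \<phi>: "\<And>p. p \<in> B \<Longrightarrow> polynomial_map (\<lambda>X :: 'v config. \<phi> p (X (w, 0)))"
    "\<And>p. p \<in> B \<Longrightarrow> \<exists>x. \<phi> p x \<noteq> 0"
    "\<And>p x y. p \<in> B \<Longrightarrow> (\<And>i. i \<in> N \<Longrightarrow> (norm (y - p i))\<^sup>2 = (norm (x - a i))\<^sup>2) \<Longrightarrow> \<phi> p x = (0::real)"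
    using ok unfolding ok_def by blast+
  define \<Phi> where "\<Phi> = (\<lambda>t X :: 'v config. case t of
    None \<Rightarrow> cross (X (w, 0) - a n1) (X (w, 0) - a n2) | Some p \<Rightarrow> \<phi> p (X (w, 0)))"
  have "\<exists>Y\<in>UNIV. \<forall>t\<in>insert None (Some ` B). \<Phi> t Y \<noteq> 0"
  proof (rule polynomial_maps_avoid)
    show "polynomial_map (\<Phi> t)" if "t \<in> insert None (Some ` B)" for t
    proof (cases t)
      case None
      then show ?thesis unfolding \<Phi>_def by (simp only: option.case) (intro polynomial_vec_rules)
    next
      case (Some p)
      then show ?thesis using that \<phi>(1)[of p] by (auto simp: \<Phi>_def)
    qed
    show "\<exists>Y. \<Phi> t Y \<noteq> 0" if "t \<in> insert None (Some ` B)" for t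
    proof (cases t)
      case None
      have "cross (a n3 - a n1) (a n3 - a n2) = cross (a n2 - a n1) (a n3 - a n1)"
        by (simp add: cross_def algebra_simps)
      then have "\<Phi> t (\<lambda>_. a n3) \<noteq> 0" using nc n None by (simp add: \<Phi>_def a_def)
      then show ?thesis by blast
    next
      case (Some p)
      then have "p \<in> B" using that by auto
      then obtain x where "\<phi> p x \<noteq> 0" using \<phi>(2) by blast
      then have "\<Phi> t (\<lambda>_. x) \<noteq> 0" using Some by (simp add: \<Phi>_def)
      then show ?thesis by blast
    qed
  qed (use finB in auto)
  then obtain Y where Y: "\<Phi> None Y \<noteq> 0" "\<And>p. p \<in> B \<Longrightarrow> \<Phi> (Some p) Y \<noteq> 0" by blast
  define Z where "Z = X((w, 0) := Y (w, 0))"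
  have ZX: "Z (v, k) = X (v, k)" if "v \<in> V" for v k using that V by (auto simp: Z_def)
  have Zw: "Z (w, 0) = Y (w, 0)" by (simp add: Z_def)
  have Nw: "v \<in> V" "adj w v" if "v \<in> N" for v using that N by auto
  have rigidZ: "inf_rigid (insert w V) adj l Z"
  proof (rule inf_rigid_insert)
    show "inf_rigid V adj l Z" using X(2) inf_rigid_cong[of V Z X] ZX by blast
    fix m assume m: "\<And>v. v \<in> V \<Longrightarrow> adj w v \<Longrightarrow> (Z (w, 0) - Z (v, 0)) \<bullet> m = 0"
    show "m = 0"
    proof (rule orthogonal_to_independent)
      show "cross (Y (w, 0) - a n1) (Y (w, 0) - a n2) \<noteq> 0" using Y(1) by (simp add: \<Phi>_def)
      show "(Y (w, 0) - a n1) \<bullet> m = 0" "(Y (w, 0) - a n2) \<bullet> m = 0"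
        using m Nw n ZX by (auto simp: a_def Zw[symmetric] simp del: Zw)
    qed
  qed
  have globZ: "glob_rigid (insert w V) adj l Z"
    unfolding glob_rigid_def
  proof (intro allI impI)
    fix p assume p: "equivalent_placement (insert w V) adj l Z p"
    define p' where "p' v = (if v \<in> V then p v else 0)" for v
    have "equivalent_placement V adj l Z p'"
      using equivalent_placement_restrict[OF p] by (simp add: p'_def[abs_def])
    then have eq: "equivalent_placement V adj l X p'"
      using equivalent_placement_cong[of V Z X] ZX by blast
    have dist: "(norm (p w - p i))\<^sup>2 = (norm (Y (w, 0) - a i))\<^sup>2" if "i \<in> N" for i
      using p Nw[OF that] ZX by (simp add: equivalent_placement_def Zw a_def)
    have "p' \<notin> B"
    proof
      assume B: "p' \<in> B"
      have "\<phi> p' (Y (w, 0)) = 0"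
        by (rule \<phi>(3)[OF B, of "p w"]) (use dist Nw in \<open>auto simp: p'_def\<close>)
      then show False using Y(2)[OF B] by (simp add: \<Phi>_def)
    qed
    moreover have "\<forall>v. v \<notin> V \<longrightarrow> p' v = 0" by (simp add: p'_def)
    ultimately have "(norm (p' j - p' i))\<^sup>2 = (norm (a j - a i))\<^sup>2" if "i \<in> N" "j \<in> N" "i \<noteq> j" for i j
      using eq that unfolding B_def by blast
    then have "equivalent_placement V ?adj l X p'"
      using eq by (auto simp: equivalent_placement_def a_def)
    then have p'X: "p' v = X (v, 0)" if "v \<in> V" for v
      using X(1) that by (auto simp: glob_rigid_def)
    have pX: "p v = a v" if "v \<in> V" for v using p'X[OF that] that by (simp add: p'_def a_def)
    have "p w = Y (w, 0)"
      by (rule three_distances[of "a n2" "a n1" "a n3"])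
        (use nc n dist pX Nw in \<open>auto simp: a_def\<close>)
    then show "\<forall>v\<in>insert w V. p v = Z (v, 0)" using pX ZX Zw by (auto simp: a_def)
  qed
  show ?thesis using rigidZ globZ by blast
qed


text \<open>A loop ties \<open>w\<close> to a line in the fixed plane, so the neighbours cannot be
  moved even by a congruence and their positions are recovered. Loops added at \<open>N\<close> are
  then satisfied whatever their number \<open>k\<close> and their normals.\<close>

lemma delete_looped_vertex:
  fixes V :: "'v set"
  assumes V: "finite V" "w \<notin> V" and N: "N = {v \<in> V. adj w v}"
    and lw: "l w \<ge> 2 \<or> (l w = 1 \<and> card N \<ge> 2)"
    and rigid: "inf_rigid V adj l X1"
    and good: "inf_rigid V adj (\<lambda>v. if v \<in> N then l v + k else l v) X0"
      "glob_rigid V adj (\<lambda>v. if v \<in> N then l v + k else l v) X0"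
  shows "\<exists>X. inf_rigid (insert w V) adj l X \<and> glob_rigid (insert w V) adj l X"
proof -
  let ?l = "\<lambda>v. if v \<in> N then l v + k else l v"
  define T where "T = {(i, j). i \<in> N \<and> j \<in> N \<and> i \<noteq> j}"
  define \<psi> where "\<psi> = (\<lambda>(i, j) X :: 'v config. (X (i, 0) - X (j, 0)) \<bullet> (X (i, 0) - X (j, 0)))"
  have finN: "finite N" using V N by simp
  have "T \<subseteq> N \<times> N" by (auto simp: T_def)
  then have finT: "finite T" using finN finite_subset by blast
  have pol\<psi>: "polynomial_map (\<psi> t)" if "t \<in> T" for t
    unfolding \<psi>_def by (cases t) (simp, intro polynomial_vec_rules)
  have nz\<psi>: "\<exists>Y. \<psi> t Y \<noteq> 0" if tT: "t \<in> T" for t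
  proof -
    obtain i j where t: "t = (i, j)" by (cases t)
    have "\<psi> t (\<lambda>(v, _). if v = j then axis 1 1 else 0) \<noteq> 0"
      using tT unfolding t by (auto simp: \<psi>_def T_def)
    then show ?thesis by blast
  qed
  obtain X where X: "glob_rigid V adj ?l X" "inf_rigid V adj l X" "\<forall>t\<in>T. \<psi> t X \<noteq> 0"
    and fin: "finite {p. (\<forall>v. v \<notin> V \<longrightarrow> p v = 0) \<and> equivalent_placement V adj l X p}"
    using generic_finite_fibre[where T = T and \<psi> = \<psi>, OF V(1) good rigid finT pol\<psi> nz\<psi>] by blast
  define a where "a v = X (v, 0)" for v
  have ne: "a i \<noteq> a j" if "i \<in> N" "j \<in> N" "i \<noteq> j" for i j
    using X(3)[rule_format, of "(i, j)"] that by (simp add: T_def \<psi>_def a_def)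
  define B where "B = {p. (\<forall>v. v \<notin> V \<longrightarrow> p v = 0) \<and> equivalent_placement V adj l X p \<and>
    (\<exists>i\<in>N. p i \<noteq> a i)}"
  have finB: "finite B" by (rule finite_subset[OF _ fin]) (auto simp: B_def)
  have Nw: "v \<in> V" "adj w v" if "v \<in> N" for v using that N by auto
  \<comment> \<open>It remains to place \<open>w\<close> and its loops so as to exclude the finitely many placements in \<open>B\<close>.\<close>
  have "\<exists>Z. (\<forall>v k. v \<in> V \<longrightarrow> Z (v, k) = X (v, k)) \<and>
    (\<forall>m. (\<forall>v\<in>N. (Z (w, 0) - a v) \<bullet> m = 0) \<longrightarrow> (\<forall>i<l w. Z (w, Suc i) \<bullet> m = 0) \<longrightarrow> m = 0) \<and>
    (\<forall>y. (\<forall>v\<in>N. (norm (y - a v))\<^sup>2 = (norm (Z (w, 0) - a v))\<^sup>2) \<longrightarrow>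
      (\<forall>i<l w. y \<bullet> Z (w, Suc i) = Z (w, 0) \<bullet> Z (w, Suc i)) \<longrightarrow> y = Z (w, 0)) \<and>
    (\<forall>p\<in>B. \<forall>y. (\<forall>v\<in>N. (norm (y - p v))\<^sup>2 = (norm (Z (w, 0) - a v))\<^sup>2) \<longrightarrow>
      \<not> (\<forall>i<l w. y \<bullet> Z (w, Suc i) = Z (w, 0) \<bullet> Z (w, Suc i)))"
  proof (cases "l w \<ge> 2")
    case True
    \<comment> \<open>Two loops determine the position of \<open>w\<close>, and a perpendicular
      bisector excludes each placement in \<open>B\<close>.\<close>
    define ok where "ok p \<phi> \<longleftrightarrow> polynomial_map (\<lambda>X :: 'v config. \<phi> (X (w, 0))) \<and> (\<exists>x. \<phi> x \<noteq> 0) \<and>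
      (\<forall>x. (\<forall>i\<in>N. (norm (x - p i))\<^sup>2 = (norm (x - a i))\<^sup>2) \<longrightarrow> \<phi> x = (0::real))" for p :: "'v \<Rightarrow> real ^ 2" and \<phi>
    have ex\<phi>: "\<exists>\<phi>. ok p \<phi>" if pB: "p \<in> B" for p
    proof -
      obtain i where i: "i \<in> N" "p i \<noteq> a i" using pB unfolding B_def by blast
      obtain \<phi> where \<phi>: "\<And>F :: 'v config \<Rightarrow> _. polynomial_vec F \<Longrightarrow> polynomial_map (\<lambda>X. \<phi> (F X))"
        "\<exists>x. \<phi> x \<noteq> (0::real)" "\<And>x. (norm (x - p i))\<^sup>2 = (norm (x - a i))\<^sup>2 \<Longrightarrow> \<phi> x = 0"
        using point_obstruction[OF i(2)[symmetric]] by blast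
      show ?thesis unfolding ok_def using \<phi>(1)[OF polynomial_vec_intros(2)] \<phi>(2,3) i(1) by (intro exI[of _ \<phi>]) blast
    qed
    obtain \<phi> where ok: "\<forall>p\<in>B. ok p (\<phi> p)"
      using bchoice[of B ok] ex\<phi> by blast
    have \<phi>: "\<And>p. p \<in> B \<Longrightarrow> polynomial_map (\<lambda>X :: 'v config. \<phi> p (X (w, 0)))"
      "\<And>p. p \<in> B \<Longrightarrow> \<exists>x. \<phi> p x \<noteq> 0"
      "\<And>p x. p \<in> B \<Longrightarrow> (\<And>i. i \<in> N \<Longrightarrow> (norm (x - p i))\<^sup>2 = (norm (x - a i))\<^sup>2) \<Longrightarrow> \<phi> p x = (0::real)"
      using ok unfolding ok_def by blast+
    have nz: "\<exists>Y :: 'v config. \<phi> p (Y (w, 0)) \<noteq> 0" if pB: "p \<in> B" for p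
    proof -
      obtain x where "\<phi> p x \<noteq> 0" using \<phi>(2)[OF pB] by blast
      then show ?thesis by (intro exI[of _ "\<lambda>_. x"])
    qed
    have "\<exists>Y\<in>UNIV. \<forall>p\<in>B. \<phi> p ((Y :: 'v config) (w, 0)) \<noteq> 0"
      by (rule polynomial_maps_avoid[OF finB open_UNIV UNIV_I]) (rule \<phi>(1), assumption, rule nz, assumption)
    then obtain Y :: "'v config" where Y: "\<And>p. p \<in> B \<Longrightarrow> \<phi> p (Y (w, 0)) \<noteq> 0" by blast
    \<comment> \<open>Coordinate axes as the first two normals determine the position; further loops
      keep the normals of \<open>X\<close>.\<close>
    define Z where "Z = X((w, 0) := Y (w, 0), (w, 1) := axis 1 1, (w, 2) := axis 2 1)"
    have two: "y = z" if h: "\<forall>i<l w. y \<bullet> Z (w, Suc i) = z \<bullet> Z (w, Suc i)" for y z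
    proof -
      have "y \<bullet> Z (w, Suc 0) = z \<bullet> Z (w, Suc 0)" "y \<bullet> Z (w, Suc 1) = z \<bullet> Z (w, Suc 1)"
        using h True by auto
      then show ?thesis
        by (simp add: Z_def inner_axis vec_eq_iff_2 numeral_2_eq_2[symmetric])
    qed
    have ZX: "Z (v, k) = X (v, k)" if "v \<in> V" for v k using that V(2) by (auto simp: Z_def)
    have Zw: "Z (w, 0) = Y (w, 0)" by (simp add: Z_def)
    have "m = 0" if "\<forall>i<l w. Z (w, Suc i) \<bullet> m = 0" for m
      using two[of m 0] that by (simp add: inner_commute)
    moreover have False if pB: "p \<in> B" and d: "\<forall>v\<in>N. (norm (y - p v))\<^sup>2 = (norm (Z (w, 0) - a v))\<^sup>2"
      and e: "\<forall>i<l w. y \<bullet> Z (w, Suc i) = Z (w, 0) \<bullet> Z (w, Suc i)" for p y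
    proof -
      have "y = Y (w, 0)" using two[OF e] Zw by simp
      then have "\<phi> p (Y (w, 0)) = 0" using d Zw by (intro \<phi>(3)[OF pB]) auto
      then show False using Y[OF pB] by simp
    qed
    ultimately show ?thesis using ZX two by (intro exI[of _ Z]) blast
  next
    case False
    then have l1: "l w = 1" and N2: "card N \<ge> 2" using lw by auto
    obtain M where M: "M \<subseteq> N" "card M = 2" using obtain_subset_with_card_n[OF N2] by metis
    obtain n1 n2 where n: "n1 \<in> N" "n2 \<in> N" "n1 \<noteq> n2"
      using M(1) card_2_iff[THEN iffD1, OF M(2)] by blast
    \<comment> \<open>With a single loop, the obstruction depends on the position and the normal,
      and it takes a second neighbour besides the moved one.\<close>
    define ok where "ok p \<phi> \<longleftrightarrow> polynomial_map (\<lambda>X :: 'v config. \<phi> (X (w, 0)) (X (w, 1))) \<and> (\<exists>x q. \<phi> x q \<noteq> 0) \<and>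
      (\<forall>x q y. y \<bullet> q = x \<bullet> q \<longrightarrow> (\<forall>i\<in>N. (norm (y - p i))\<^sup>2 = (norm (x - a i))\<^sup>2) \<longrightarrow> \<phi> x q = (0::real))" for p :: "'v \<Rightarrow> real ^ 2" and \<phi>
    have ex\<phi>: "\<exists>\<phi>. ok p \<phi>" if pB: "p \<in> B" for p
    proof -
      obtain i where i: "i \<in> N" "p i \<noteq> a i" using pB unfolding B_def by blast
      obtain j where j: "j \<in> N" "j \<noteq> i" using n by metis
      obtain \<phi> where \<phi>: "\<And>F G :: 'v config \<Rightarrow> _. polynomial_vec F \<Longrightarrow> polynomial_vec G \<Longrightarrow>
          polynomial_map (\<lambda>X. \<phi> (F X) (G X))"
        "\<exists>x q. \<phi> x q \<noteq> (0::real)" "\<And>x q y. y \<bullet> q = x \<bullet> q \<Longrightarrow> (norm (y - p i))\<^sup>2 = (norm (x - a i))\<^sup>2 \<Longrightarrow>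
          (norm (y - p j))\<^sup>2 = (norm (x - a j))\<^sup>2 \<Longrightarrow> \<phi> x q = 0"
        using slider_obstruction[OF ne[OF i(1) j(1) j(2)[symmetric]] i(2)] by blast
      show ?thesis unfolding ok_def
        using \<phi>(1)[OF polynomial_vec_intros(2) polynomial_vec_intros(2)] \<phi>(2,3) i(1) j(1)
        by (intro exI[of _ \<phi>]) blast
    qed
    obtain \<phi> where ok: "\<forall>p\<in>B. ok p (\<phi> p)"
      using bchoice[of B ok] ex\<phi> by blast
    have \<phi>: "\<And>p. p \<in> B \<Longrightarrow> polynomial_map (\<lambda>X :: 'v config. \<phi> p (X (w, 0)) (X (w, 1)))"
      "\<And>p. p \<in> B \<Longrightarrow> \<exists>x q. \<phi> p x q \<noteq> 0"
      "\<And>p x q y. p \<in> B \<Longrightarrow> y \<bullet> q = x \<bullet> q \<Longrightarrow>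
        (\<And>i. i \<in> N \<Longrightarrow> (norm (y - p i))\<^sup>2 = (norm (x - a i))\<^sup>2) \<Longrightarrow> \<phi> p x q = (0::real)"
      using ok unfolding ok_def by blast+
    \<comment> \<open>In the case \<open>None\<close>, the first factor gives infinitesimal rigidity
      at \<open>w\<close> and the second the uniqueness of its position.\<close>
    define \<Phi> where "\<Phi> = (\<lambda>t X :: 'v config. case t of
      None \<Rightarrow> cross (X (w, 1)) (X (w, 0) - a n1) * cross (X (w, 1)) (a n2 - a n1)
      | Some p \<Rightarrow> \<phi> p (X (w, 0)) (X (w, 1)))"
    have "\<exists>Y\<in>UNIV. \<forall>t\<in>insert None (Some ` B). \<Phi> t Y \<noteq> 0"
    proof (rule polynomial_maps_avoid)
      show "polynomial_map (\<Phi> t)" if "t \<in> insert None (Some ` B)" for t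
      proof (cases t)
        case None
        then show ?thesis unfolding \<Phi>_def by (simp only: option.case) (intro polynomial_vec_rules)
      next
        case (Some p)
        then show ?thesis using that \<phi>(1)[of p] by (auto simp: \<Phi>_def)
      qed
      show "\<exists>Y. \<Phi> t Y \<noteq> 0" if "t \<in> insert None (Some ` B)" for t
      proof (cases t)
        case None
        define e where "e = a n2 - a n1"
        have "e \<bullet> e \<noteq> 0" using ne n by (simp add: e_def)
        moreover have "cross (vector [e $ 2, - e $ 1]) e = e \<bullet> e" by (simp add: cross_def inner_2)
        ultimately have "\<Phi> t (\<lambda>(v, k). if k = 0 then a n2 else vector [e $ 2, - e $ 1]) \<noteq> 0"
          using None by (simp add: \<Phi>_def e_def[symmetric])
        then show ?thesis by blast
      next
        case (Some p)
        then have "p \<in> B" using that by auto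
        then obtain x q where "\<phi> p x q \<noteq> 0" using \<phi>(2) by blast
        then have "\<Phi> t (\<lambda>(v, k). if k = 0 then x else q) \<noteq> 0" using Some by (simp add: \<Phi>_def)
        then show ?thesis by blast
      qed
    qed (use finB in auto)
    then obtain Y where Y: "\<Phi> None Y \<noteq> 0" "\<And>p. p \<in> B \<Longrightarrow> \<Phi> (Some p) Y \<noteq> 0" by blast
    define Z where "Z = X((w, 0) := Y (w, 0), (w, 1) := Y (w, 1))"
    have ZX: "Z (v, k) = X (v, k)" if "v \<in> V" for v k using that V(2) by (auto simp: Z_def)
    have Zw: "Z (w, 0) = Y (w, 0)" "Z (w, Suc 0) = Y (w, 1)" by (simp_all add: Z_def)
    have nz: "cross (Y (w, 1)) (Y (w, 0) - a n1) \<noteq> 0" "cross (Y (w, 1)) (a n2 - a n1) \<noteq> 0"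
      using Y(1) by (auto simp: \<Phi>_def)
    have "m = 0" if "\<forall>v\<in>N. (Z (w, 0) - a v) \<bullet> m = 0" "\<forall>i<l w. Z (w, Suc i) \<bullet> m = 0" for m
      by (rule orthogonal_to_independent[OF nz(1)]) (use that n Zw l1 in auto)
    moreover have "y = Z (w, 0)" if d: "\<forall>v\<in>N. (norm (y - a v))\<^sup>2 = (norm (Z (w, 0) - a v))\<^sup>2"
      and e: "\<forall>i<l w. y \<bullet> Z (w, Suc i) = Z (w, 0) \<bullet> Z (w, Suc i)" for y
      by (rule slider_distances[OF nz(2)]) (use d e n Zw l1 in auto)
    moreover have False if pB: "p \<in> B" and d: "\<forall>v\<in>N. (norm (y - p v))\<^sup>2 = (norm (Z (w, 0) - a v))\<^sup>2"
      and e: "\<forall>i<l w. y \<bullet> Z (w, Suc i) = Z (w, 0) \<bullet> Z (w, Suc i)" for p y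
    proof -
      have "\<phi> p (Y (w, 0)) (Y (w, 1)) = 0"
        by (rule \<phi>(3)[OF pB, of y]) (use d e Zw l1 in auto)
      then show False using Y(2)[OF pB] by (simp add: \<Phi>_def)
    qed
    ultimately show ?thesis using ZX by (intro exI[of _ Z]) blast
  qed
  then obtain Z where ZX: "\<And>v k. v \<in> V \<Longrightarrow> Z (v, k) = X (v, k)"
    and Zm: "\<And>m. \<forall>v\<in>N. (Z (w, 0) - a v) \<bullet> m = 0 \<Longrightarrow> \<forall>i<l w. Z (w, Suc i) \<bullet> m = 0 \<Longrightarrow> m = 0"
    and Zy: "\<And>y. \<forall>v\<in>N. (norm (y - a v))\<^sup>2 = (norm (Z (w, 0) - a v))\<^sup>2 \<Longrightarrow>
      \<forall>i<l w. y \<bullet> Z (w, Suc i) = Z (w, 0) \<bullet> Z (w, Suc i) \<Longrightarrow> y = Z (w, 0)"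
    and ZB: "\<And>p y. p \<in> B \<Longrightarrow> \<forall>v\<in>N. (norm (y - p v))\<^sup>2 = (norm (Z (w, 0) - a v))\<^sup>2 \<Longrightarrow>
      \<not> (\<forall>i<l w. y \<bullet> Z (w, Suc i) = Z (w, 0) \<bullet> Z (w, Suc i))"
    by blast
  have rigidZ: "inf_rigid (insert w V) adj l Z"
  proof (rule inf_rigid_insert)
    show "inf_rigid V adj l Z" using X(2) inf_rigid_cong[of V Z X] ZX by blast
    fix m assume "\<And>v. v \<in> V \<Longrightarrow> adj w v \<Longrightarrow> (Z (w, 0) - Z (v, 0)) \<bullet> m = 0"
      "\<And>i. i < l w \<Longrightarrow> Z (w, Suc i) \<bullet> m = 0"
    then show "m = 0" using Nw ZX by (intro Zm) (auto simp: a_def)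
  qed
  have globZ: "glob_rigid (insert w V) adj l Z"
    unfolding glob_rigid_def
  proof (intro allI impI)
    fix p assume p: "equivalent_placement (insert w V) adj l Z p"
    define p' where "p' v = (if v \<in> V then p v else 0)" for v
    have "equivalent_placement V adj l Z p'"
      using equivalent_placement_restrict[OF p] by (simp add: p'_def[abs_def])
    then have eq: "equivalent_placement V adj l X p'"
      using equivalent_placement_cong[of V Z X] ZX by blast
    have dist: "\<forall>i\<in>N. (norm (p w - p i))\<^sup>2 = (norm (Z (w, 0) - a i))\<^sup>2"
      using p Nw ZX by (simp add: equivalent_placement_def a_def)
    have loop: "\<forall>i<l w. p w \<bullet> Z (w, Suc i) = Z (w, 0) \<bullet> Z (w, Suc i)"
      using p by (simp add: equivalent_placement_def)
    have pp: "p' i = p i" if "i \<in> N" for i using Nw(1)[OF that] by (simp add: p'_def)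
    have "p' \<notin> B" using ZB[of p' "p w"] loop dist pp by auto
    moreover have "\<forall>v. v \<notin> V \<longrightarrow> p' v = 0" by (simp add: p'_def)
    ultimately have pN: "p' i = a i" if "i \<in> N" for i
      using eq that unfolding B_def by blast
    then have "equivalent_placement V adj ?l X p'"
      using eq by (auto simp: equivalent_placement_def a_def)
    then have p'X: "p' v = X (v, 0)" if "v \<in> V" for v
      using X(1) that by (auto simp: glob_rigid_def)
    have pX: "p v = a v" if "v \<in> V" for v using p'X[OF that] that by (simp add: p'_def a_def)
    have "p w = Z (w, 0)" using dist loop pX Nw by (intro Zy) auto
    then show "\<forall>v\<in>insert w V. p v = Z (v, 0)" using pX ZX by (auto simp: a_def)
  qed
  show ?thesis using rigidZ globZ by blast
qed

section \<open>Motions of a generic configuration\<close>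

lemma killed_by_mono:
  assumes "killed_by X Q R k f" "k \<le> k'"
  shows "killed_by X Q R k' f"
  using assms unfolding killed_by_def by (meson order_less_le_trans)

text \<open>The least \<open>k\<close> over all configurations is attained at some \<open>Y\<close>,
  and the functionals that work there work wherever \<delta> is nonzero. So the dimension of the
  motion space is smallest at generic configurations.\<close>

lemma generic_rank_polynomial:
  assumes "finite Q"
  shows "\<exists>\<delta>. polynomial_map \<delta> \<and> (\<exists>Y. \<delta> Y \<noteq> 0) \<and>
    (\<forall>X. \<delta> X \<noteq> 0 \<longrightarrow> (\<forall>Y k f. killed_by Y Q R k f \<longrightarrow> (\<exists>f. killed_by X Q R k f)))"
proof (cases "\<exists>k Y f. killed_by Y Q R k f")
  case False
  then show ?thesis by (intro exI[of _ "\<lambda>_. 1"]) (auto simp: polynomial_map_const)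
next
  case True
  define k where "k = (LEAST k. \<exists>Y f. killed_by Y Q R k f)"
  have "\<exists>Y f. killed_by Y Q R k f" unfolding k_def by (rule LeastI_ex[OF True])
  then obtain Y f where Yf: "killed_by Y Q R k f" by blast
  have least: "k \<le> k'" if "killed_by Y' Q R k' f'" for k' Y' f'
    unfolding k_def by (rule Least_le) (use that in blast)
  obtain \<delta> where \<delta>: "polynomial_map \<delta>" "\<delta> Y \<noteq> 0" "\<forall>X. \<delta> X \<noteq> 0 \<longrightarrow> killed_by X Q R k f"
    using killed_by_polynomial[OF assms Yf] by blast
  show ?thesis
    using \<delta> least killed_by_mono[of _ Q R k f] by (intro exI[of _ \<delta>]) blast
qed

text \<open>The rows of the complete graph. Which pairs are linked depends on the configuration, so
  genericity is required for all row sets before the configuration is chosen.\<close>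

definition link_rows :: "'v set \<Rightarrow> ('v \<Rightarrow> nat) \<Rightarrow> 'v row set" where
  "link_rows V l = graph_rows V (\<lambda>_ _. True) l"

text \<open>The condition \<open>generic\<close> transfers a bound found at a convenient special
  configuration to \<open>X\<close>. The conditions after it exclude coincidences that would make
  constraints at a vertex trivial or dependent.\<close>

locale generic_config =
  fixes V :: "'v set" and adj :: "'v \<Rightarrow> 'v \<Rightarrow> bool" and l :: "'v \<Rightarrow> nat" and X :: "'v config"
  assumes finV: "finite V"
    and adj_sym: "adj u v \<Longrightarrow> adj v u"
    and adj_irrefl: "\<not> adj v v"
    and generic: "Q \<subseteq> V \<Longrightarrow> R \<subseteq> link_rows V l \<Longrightarrow> killed_by Y Q R k f \<Longrightarrow> \<exists>f. killed_by X Q R k f"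
    and noncollinear: "a \<in> V \<Longrightarrow> b \<in> V \<Longrightarrow> c \<in> V \<Longrightarrow> a \<noteq> b \<Longrightarrow> a \<noteq> c \<Longrightarrow> b \<noteq> c \<Longrightarrow>
      cross (X (b, 0) - X (a, 0)) (X (c, 0) - X (a, 0)) \<noteq> 0"
    and distinct_points: "a \<in> V \<Longrightarrow> b \<in> V \<Longrightarrow> a \<noteq> b \<Longrightarrow> X (a, 0) \<noteq> X (b, 0)"
    and loop_nonzero: "a \<in> V \<Longrightarrow> i < l a \<Longrightarrow> X (a, Suc i) \<noteq> 0"
    and loop_loop: "a \<in> V \<Longrightarrow> 1 < l a \<Longrightarrow> cross (X (a, 1)) (X (a, 2)) \<noteq> 0"
    and loop_edge: "a \<in> V \<Longrightarrow> b \<in> V \<Longrightarrow> a \<noteq> b \<Longrightarrow> cross (X (a, 1)) (X (a, 0) - X (b, 0)) \<noteq> 0"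

lemma generic_config_exists:
  fixes V :: "'v set"
  assumes V: "finite V" and adj: "\<And>u v. adj u v \<Longrightarrow> adj v u" "\<And>v. \<not> adj v v"
  shows "\<exists>X. generic_config V adj l X"
proof -
  define G :: "('v config \<Rightarrow> real) set" where
    "G = {\<delta>. polynomial_map \<delta> \<and> (\<exists>Y. \<delta> Y \<noteq> 0)}"
  define good where "good QR \<delta> \<longleftrightarrow> \<delta> \<in> G \<and> (\<forall>X. \<delta> X \<noteq> 0 \<longrightarrow>
    (\<forall>Y k f. killed_by Y (fst QR) (snd QR) k f \<longrightarrow> (\<exists>f. killed_by X (fst QR) (snd QR) k f)))"
    for QR :: "'v set \<times> 'v row set" and \<delta>
  let ?QR = "Pow V \<times> Pow (link_rows V l)"
  have "\<exists>\<delta>. good QR \<delta>" if "QR \<in> ?QR" for QR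
    using generic_rank_polynomial[of "fst QR" "snd QR"] that V finite_subset
    unfolding good_def G_def by (auto simp: mem_Times_iff)
  then obtain \<delta> where \<delta>: "\<forall>QR\<in>?QR. good QR (\<delta> QR)" using bchoice[of ?QR good] by blast
  define S1 where "S1 = \<delta> ` ?QR"
  define S2 :: "('v config \<Rightarrow> real) set" where
    "S2 = (\<lambda>(a, b, c) X. cross (X (b, 0) - X (a, 0)) (X (c, 0) - X (a, 0))) `
      {(a, b, c) \<in> V \<times> V \<times> V. a \<noteq> b \<and> a \<noteq> c \<and> b \<noteq> c}"
  define S3 :: "('v config \<Rightarrow> real) set" where
    "S3 = (\<lambda>(a, b) X. (X (a, 0) - X (b, 0)) \<bullet> (X (a, 0) - X (b, 0))) ` {(a, b) \<in> V \<times> V. a \<noteq> b}"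
  define S4 :: "('v config \<Rightarrow> real) set" where
    "S4 = (\<lambda>(a, i) X. X (a, Suc i) \<bullet> X (a, Suc i)) ` (SIGMA a:V. {..<l a})"
  define S5 :: "('v config \<Rightarrow> real) set" where
    "S5 = (\<lambda>a X. cross (X (a, 1)) (X (a, 2))) ` V"
  define S6 :: "('v config \<Rightarrow> real) set" where
    "S6 = (\<lambda>(a, b) X. cross (X (a, 1)) (X (a, 0) - X (b, 0))) ` {(a, b) \<in> V \<times> V. a \<noteq> b}"
  have "S1 \<subseteq> G" using \<delta> by (auto simp: S1_def good_def)
  moreover have "S2 \<subseteq> G"
  proof
    fix \<psi> assume "\<psi> \<in> S2"
    then obtain a b c where abc: "a \<noteq> b" "a \<noteq> c" "b \<noteq> c"
      "\<psi> = (\<lambda>X. cross (X (b, 0) - X (a, 0)) (X (c, 0) - X (a, 0)))" by (auto simp: S2_def)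
    have "\<psi> (\<lambda>(v, _). if v = b then axis 1 1 else if v = c then axis 2 1 else 0) \<noteq> 0"
      using abc by (simp add: cross_def axis_def)
    moreover have "polynomial_map \<psi>" unfolding abc(4) by (intro polynomial_vec_rules)
    ultimately show "\<psi> \<in> G" unfolding G_def by blast
  qed
  moreover have "S3 \<subseteq> G"
  proof
    fix \<psi> assume "\<psi> \<in> S3"
    then obtain a b where ab: "a \<noteq> b" "\<psi> = (\<lambda>X. (X (a, 0) - X (b, 0)) \<bullet> (X (a, 0) - X (b, 0)))"
      by (auto simp: S3_def)
    have "\<psi> (\<lambda>(v, _). if v = b then axis 1 1 else 0) \<noteq> 0"
      using ab by (simp add: inner_axis_axis)
    moreover have "polynomial_map \<psi>" unfolding ab(2) by (intro polynomial_vec_rules)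
    ultimately show "\<psi> \<in> G" unfolding G_def by blast
  qed
  moreover have "S4 \<subseteq> G"
  proof
    fix \<psi> assume "\<psi> \<in> S4"
    then obtain a i where ab: "\<psi> = (\<lambda>X. X (a, Suc i) \<bullet> X (a, Suc i))" by (auto simp: S4_def)
    have "\<psi> (\<lambda>_. axis 1 1) \<noteq> 0" using ab by (simp add: inner_axis_axis)
    moreover have "polynomial_map \<psi>" unfolding ab by (intro polynomial_vec_rules)
    ultimately show "\<psi> \<in> G" unfolding G_def by blast
  qed
  moreover have "S5 \<subseteq> G"
  proof
    fix \<psi> assume "\<psi> \<in> S5"
    then obtain a where ab: "\<psi> = (\<lambda>X. cross (X (a, 1)) (X (a, 2)))" by (auto simp: S5_def)
    have "\<psi> (\<lambda>(_, k). if k = 1 then axis 1 1 else axis 2 1) \<noteq> 0"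
      using ab by (simp add: cross_def axis_def)
    moreover have "polynomial_map \<psi>" unfolding ab by (intro polynomial_vec_rules)
    ultimately show "\<psi> \<in> G" unfolding G_def by blast
  qed
  moreover have "S6 \<subseteq> G"
  proof
    fix \<psi> assume "\<psi> \<in> S6"
    then obtain a b where ab: "a \<noteq> b" "\<psi> = (\<lambda>X. cross (X (a, 1)) (X (a, 0) - X (b, 0)))"
      by (auto simp: S6_def)
    have "\<psi> (\<lambda>(v, k). if k = 1 then axis 1 1 else if v = b then axis 2 1 else 0) \<noteq> 0"
      using ab by (simp add: cross_def axis_def)
    moreover have "polynomial_map \<psi>" unfolding ab(2) by (intro polynomial_vec_rules)
    ultimately show "\<psi> \<in> G" unfolding G_def by blast
  qed
  ultimately have SG: "S1 \<union> S2 \<union> S3 \<union> S4 \<union> S5 \<union> S6 \<subseteq> G" by blast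
  have fin: "finite (S1 \<union> S2 \<union> S3 \<union> S4 \<union> S5 \<union> S6)"
  proof -
    have f1: "finite S1" unfolding S1_def
      using V finite_graph_rows[OF V, of "\<lambda>_ _. True" l] by (simp add: link_rows_def)
    have f2: "finite S2" unfolding S2_def
      by (rule finite_imageI, rule finite_subset[of _ "V \<times> V \<times> V"]) (use V in auto)
    have f3: "finite S3" unfolding S3_def
      by (rule finite_imageI, rule finite_subset[of _ "V \<times> V"]) (use V in auto)
    have f6: "finite S6" unfolding S6_def
      by (rule finite_imageI, rule finite_subset[of _ "V \<times> V"]) (use V in auto)
    show ?thesis using f1 f2 f3 f6 V by (simp add: S4_def S5_def)
  qed
  have "\<exists>X\<in>UNIV. \<forall>\<psi>\<in>S1 \<union> S2 \<union> S3 \<union> S4 \<union> S5 \<union> S6. \<psi> X \<noteq> 0"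
    by (rule polynomial_maps_avoid[OF fin open_UNIV UNIV_I, of "\<lambda>\<psi>. \<psi>"]) (use SG in \<open>auto simp: G_def\<close>)
  then obtain X where X: "\<And>\<psi>. \<psi> \<in> S1 \<union> S2 \<union> S3 \<union> S4 \<union> S5 \<union> S6 \<Longrightarrow> \<psi> X \<noteq> 0" by blast
  have "generic_config V adj l X"
  proof
    show "\<exists>f. killed_by X Q R k f" if "Q \<subseteq> V" "R \<subseteq> link_rows V l" "killed_by Y Q R k f" for Q R Y k f
    proof -
      have QR: "(Q, R) \<in> ?QR" using that by auto
      then have "\<delta> (Q, R) X \<noteq> 0" by (intro X) (auto simp: S1_def)
      then show ?thesis using bspec[OF \<delta> QR] that(3) unfolding good_def fst_conv snd_conv by blast
    qed
    show "cross (X (b, 0) - X (a, 0)) (X (c, 0) - X (a, 0)) \<noteq> 0"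
      if "a \<in> V" "b \<in> V" "c \<in> V" "a \<noteq> b" "a \<noteq> c" "b \<noteq> c" for a b c
    proof -
      have "(\<lambda>X. cross (X (b, 0) - X (a, 0)) (X (c, 0) - X (a, 0))) \<in> S2"
        unfolding S2_def by (rule image_eqI[of _ _ "(a, b, c)"]) (use that in auto)
      then show ?thesis using X by blast
    qed
    show "X (a, 0) \<noteq> X (b, 0)" if "a \<in> V" "b \<in> V" "a \<noteq> b" for a b
    proof -
      have "(\<lambda>X. (X (a, 0) - X (b, 0)) \<bullet> (X (a, 0) - X (b, 0))) \<in> S3"
        unfolding S3_def by (rule image_eqI[of _ _ "(a, b)"]) (use that in auto)
      then have "(X (a, 0) - X (b, 0)) \<bullet> (X (a, 0) - X (b, 0)) \<noteq> 0" using X by blast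
      then show ?thesis by auto
    qed
    show "X (a, Suc i) \<noteq> 0" if "a \<in> V" "i < l a" for a i
    proof -
      have "(\<lambda>X. X (a, Suc i) \<bullet> X (a, Suc i)) \<in> S4"
        unfolding S4_def by (rule image_eqI[of _ _ "(a, i)"]) (use that in auto)
      then have "X (a, Suc i) \<bullet> X (a, Suc i) \<noteq> 0" using X by blast
      then show ?thesis by auto
    qed
    show "cross (X (a, 1)) (X (a, 2)) \<noteq> 0" if "a \<in> V" for a
    proof -
      have "(\<lambda>X. cross (X (a, 1)) (X (a, 2))) \<in> S5" unfolding S5_def using that by blast
      then show ?thesis using X by blast
    qed
    show "cross (X (a, 1)) (X (a, 0) - X (b, 0)) \<noteq> 0" if "a \<in> V" "b \<in> V" "a \<noteq> b" for a b
    proof -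
      have "(\<lambda>X. cross (X (a, 1)) (X (a, 0) - X (b, 0))) \<in> S6"
        unfolding S6_def by (rule image_eqI[of _ _ "(a, b)"]) (use that in auto)
      then show ?thesis using X by blast
    qed
  qed (use V adj in blast)+
  then show ?thesis by blast
qed

text \<open>Steinitz exchange in the dual space: \<phi> replaces a functional \<open>f j\<close>
  that is nonzero on \<open>m0\<close>, and the others are corrected by multiples of
  \<open>f j\<close> so as to vanish on \<open>m0\<close>. Subtracting the right multiple of
  \<open>m0\<close> from a motion then brings it into the kernel of all the old functionals.\<close>

lemma exchange:
  assumes K: "killed_by X Q R k f" and m0: "m0 \<in> motions X Q R"
    and lin: "\<And>a b m n. \<phi> (\<lambda>v. a *\<^sub>R m v + b *\<^sub>R n v) = a * \<phi> m + b * \<phi> n" and ne: "\<phi> m0 \<noteq> (0::real)"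
  shows "k \<ge> 1 \<and> (\<exists>f'. \<forall>m\<in>motions X Q R. \<phi> m = 0 \<longrightarrow> (\<forall>i<k - 1. (\<Sum>v\<in>Q. f' i v \<bullet> m v) = 0) \<longrightarrow>
    m = (\<lambda>_. 0))"
proof -
  define F where "F i m = (\<Sum>v\<in>Q. f i v \<bullet> m v)" for i m
  have Flin: "F i (\<lambda>v. m v - c *\<^sub>R n v) = F i m - c * F i n" for i m n c
    by (simp add: F_def inner_diff_right sum_subtractf sum_distrib_left)
  have "\<phi> (\<lambda>_. 0) = 0" using lin[of 0 m0 0 m0] by simp
  then have "m0 \<noteq> (\<lambda>_. 0)" using ne by auto
  then obtain j where j: "j < k" "F j m0 \<noteq> 0"
    using K m0 unfolding killed_by_def F_def by blast
  define s where "s i = (if i < j then i else Suc i)" for i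
  define f' where "f' i v = f (s i) v - (F (s i) m0 / F j m0) *\<^sub>R f j v" for i v
  have "m = (\<lambda>_. 0)" if m: "m \<in> motions X Q R" "\<phi> m = 0" "\<forall>i<k - 1. (\<Sum>v\<in>Q. f' i v \<bullet> m v) = 0" for m
  proof -
    define c where "c = F j m / F j m0"
    define n where "n = (\<lambda>v. m v - c *\<^sub>R m0 v)"
    have f'm: "(\<Sum>v\<in>Q. f' i v \<bullet> m v) = F (s i) m - (F (s i) m0 / F j m0) * F j m" for i
      by (simp add: f'_def F_def inner_diff_left sum_subtractf sum_distrib_left)
    have "F i n = 0" if i: "i < k" for i
    proof (cases "i = j")
      case True
      then show ?thesis using j by (simp add: n_def Flin c_def)
    next
      case False
      define i' where "i' = (if i < j then i else i - 1)"
      have i': "s i' = i" "i' < k - 1" using False i j by (auto simp: s_def i'_def)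
      then have "F i m - (F i m0 / F j m0) * F j m = 0" using m(3) f'm[of i'] by auto
      then show ?thesis by (simp add: n_def Flin c_def)
    qed
    moreover have "n \<in> motions X Q R"
    proof -
      have "row_value X r n = row_value X r m - c * row_value X r m0" for r
        using row_value_linear[of X r 1 m "- c" m0] by (simp add: n_def)
      then show ?thesis using m(1) m0 by (auto simp: motions_def n_def)
    qed
    ultimately have "n = (\<lambda>_. 0)" using K unfolding killed_by_def F_def by blast
    then have mc: "m = (\<lambda>v. c *\<^sub>R m0 v)" by (auto simp: n_def fun_eq_iff)
    then have "\<phi> m = c * \<phi> m0" using lin[of c m0 0 m0] by simp
    then have "c = 0" using m(2) ne by simp
    then show ?thesis using mc by simp
  qed
  then show ?thesis using j(1) by (intro conjI exI[of _ f']) auto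
qed

section \<open>Closure of the graph: pinned vertices and links\<close>

context generic_config
begin

definition graph_motions where "graph_motions = motions X V (graph_rows V adj l)"
definition pinned where "pinned = {v \<in> V. \<forall>m\<in>graph_motions. m v = 0}"
text \<open>The closure of the edge set: the rows of these pairs vanish on all motions of the graph,
  so adding them leaves the motions unchanged. The loops take part in forming the closure.\<close>

definition linked where
  "linked u v \<longleftrightarrow> u \<in> V \<and> v \<in> V \<and> u \<noteq> v \<and> (\<forall>m\<in>graph_motions. (X (u, 0) - X (v, 0)) \<bullet> (m u - m v) = 0)"
text \<open>Pinned vertices are treated as fixed points: their loops are dropped, and a link to one
  of them constrains only its other end.\<close>

definition link_system where
  "link_system W = {Edge u v | u v. u \<in> W \<and> v \<in> W \<and> linked u v} \<union> {Loop v i | v i. v \<in> W - pinned \<and> i < l v}"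
definition dof where "dof W k \<longleftrightarrow> (\<exists>f. killed_by X (W - pinned) (link_system W) k f)"

lemma linkedD: "linked u v \<Longrightarrow> u \<in> V \<and> v \<in> V \<and> u \<noteq> v"
  by (simp add: linked_def)

lemma linked_sym: "linked u v \<Longrightarrow> linked v u"
  unfolding linked_def by (simp add: inner_diff algebra_simps) metis

lemma graph_motions_supp: "m \<in> graph_motions \<Longrightarrow> v \<notin> V \<Longrightarrow> m v = 0"
  by (simp add: graph_motions_def motions_def)

lemma graph_motions_loop: "m \<in> graph_motions \<Longrightarrow> v \<in> V \<Longrightarrow> i < l v \<Longrightarrow> X (v, Suc i) \<bullet> m v = 0"
  by (force simp: graph_motions_def motions_def graph_rows_def)

lemma adj_linked:
  assumes "u \<in> V" "v \<in> V" "adj u v"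
  shows "linked u v"
proof -
  have "Edge u v \<in> graph_rows V adj l" using assms by (auto simp: graph_rows_def)
  then have "row_value X (Edge u v) m = 0" if "m \<in> graph_motions" for m
    using that unfolding graph_motions_def motions_def by blast
  moreover have "u \<noteq> v" using assms adj_irrefl by blast
  ultimately show ?thesis using assms by (simp add: linked_def)
qed

lemma pinnedD: "z \<in> pinned \<Longrightarrow> m \<in> graph_motions \<Longrightarrow> m z = 0"
  by (simp add: pinned_def)

lemma not_pinned: "u \<in> V \<Longrightarrow> u \<notin> pinned \<Longrightarrow> \<exists>m\<in>graph_motions. m u \<noteq> 0"
  by (simp add: pinned_def)

lemma in_pinned: "u \<in> V \<Longrightarrow> (\<And>m. m \<in> graph_motions \<Longrightarrow> m u = 0) \<Longrightarrow> u \<in> pinned"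
  by (simp add: pinned_def)

lemma linked_pinned: "linked u z \<Longrightarrow> z \<in> pinned \<Longrightarrow> m \<in> graph_motions \<Longrightarrow> (X (u, 0) - X (z, 0)) \<bullet> m u = 0"
  using pinnedD[of z m] unfolding linked_def by force

text \<open>Two independent constraints on the velocity of one vertex make it pinned. The next two
  lemmas rest on the same reason, with links to pinned vertices as constraints.\<close>

lemma one_loop: "u \<in> V - pinned \<Longrightarrow> l u \<le> 1"
proof (rule ccontr)
  assume u: "u \<in> V - pinned" and "\<not> l u \<le> 1"
  then have "X (u, 1) \<bullet> m u = 0" "X (u, 2) \<bullet> m u = 0" if "m \<in> graph_motions" for m
    using graph_motions_loop[OF that, of u 0] graph_motions_loop[OF that, of u 1] by (simp_all add: numeral_2_eq_2)
  then have "m u = 0" if "m \<in> graph_motions" for m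
    using orthogonal_to_independent[OF loop_loop[of u]] u that \<open>\<not> l u \<le> 1\<close> by auto
  then show False using u in_pinned by blast
qed

lemma one_pinned_neighbour:
  assumes "u \<in> V - pinned" "linked u z" "linked u z'" "z \<in> pinned" "z' \<in> pinned"
  shows "z = z'"
proof (rule ccontr)
  assume ne: "z \<noteq> z'"
  have "cross (X (z, 0) - X (u, 0)) (X (z', 0) - X (u, 0)) \<noteq> 0"
    using assms ne linkedD[of u z] linkedD[of u z'] by (intro noncollinear) auto
  then have nc: "cross (X (u, 0) - X (z, 0)) (X (u, 0) - X (z', 0)) \<noteq> 0"
    by (simp add: cross_def algebra_simps)
  have "m u = 0" if "m \<in> graph_motions" for m
    by (rule orthogonal_to_independent[OF nc]) (use linked_pinned assms that in auto)
  then show False using assms in_pinned by blast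
qed

lemma loop_no_pinned_neighbour:
  assumes "u \<in> V - pinned" "l u \<ge> 1" "linked u z"
  shows "z \<notin> pinned"
proof
  assume z: "z \<in> pinned"
  have nc: "cross (X (u, 1)) (X (u, 0) - X (z, 0)) \<noteq> 0"
    using assms linkedD[of u z] by (intro loop_edge) auto
  have "m u = 0" if m: "m \<in> graph_motions" for m
  proof (rule orthogonal_to_independent[OF nc])
    show "X (u, 1) \<bullet> m u = 0" using graph_motions_loop[OF m, of u 0] assms by simp
    show "(X (u, 0) - X (z, 0)) \<bullet> m u = 0" by (rule linked_pinned[OF assms(3) z m])
  qed
  then show False using assms in_pinned by blast
qed

text \<open>Each relative velocity is orthogonal to its edge, hence a multiple of its quarter turn.
  The third edge equates the two multiples; their common value is the angular velocity.\<close>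

lemma triangle_rotation:
  fixes a b :: "real ^ 2"
  assumes "cross a b \<noteq> 0" "a \<bullet> x = 0" "b \<bullet> y = 0" "(a - b) \<bullet> (x - y) = 0"
  shows "\<exists>t. x = t *\<^sub>R vector [- a $ 2, a $ 1] \<and> y = t *\<^sub>R vector [- b $ 2, b $ 1]"
proof -
  have ne: "a \<noteq> 0" "b \<noteq> 0" using assms by (auto simp: cross_def)
  define s t where "s = cross a x / (a \<bullet> a)" and "t = cross b y / (b \<bullet> b)"
  have rot: "z = (cross c z / (c \<bullet> c)) *\<^sub>R vector [- c $ 2, c $ 1]" if "c \<noteq> 0" "c \<bullet> z = 0"
    for c z :: "real ^ 2"
  proof -
    have "(c \<bullet> c) * z $ 1 = - cross c z * c $ 2 + c $ 1 * (c \<bullet> z)"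
      "(c \<bullet> c) * z $ 2 = cross c z * c $ 1 + c $ 2 * (c \<bullet> z)"
      by (simp_all add: cross_def inner_2 algebra_simps)
    moreover have "c \<bullet> c \<noteq> 0" using that by simp
    ultimately show ?thesis using that(2) by (simp add: vec_eq_iff_2 field_simps)
  qed
  have x: "x = s *\<^sub>R vector [- a $ 2, a $ 1]" and y: "y = t *\<^sub>R vector [- b $ 2, b $ 1]"
    unfolding s_def t_def using rot ne assms by blast+
  have "(a - b) \<bullet> (x - y) = (t - s) * cross a b"
    unfolding x y by (simp add: inner_2 cross_def algebra_simps)
  then have "s = t" using assms by simp
  then show ?thesis using x y by blast
qed

text \<open>The triangles \<open>u x y\<close> and \<open>u y z\<close> share an edge and so rotate
  about \<open>u\<close> with the same angular velocity. Among the vertices linked to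
  \<open>u\<close>, being equal or linked is therefore transitive: they fall into disjoint cliques,
  the rigid bodies through \<open>u\<close>.\<close>

lemma linked_diamond:
  assumes "linked u x" "linked u y" "linked u z" "linked x y" "linked y z" "x \<noteq> z"
  shows "linked x z"
proof -
  have V: "u \<in> V" "x \<in> V" "y \<in> V" "z \<in> V" "u \<noteq> x" "u \<noteq> y" "u \<noteq> z" "x \<noteq> y" "y \<noteq> z"
    using assms linkedD by blast+
  have tri: "\<exists>t. m c - m u = t *\<^sub>R vector [- (X (c, 0) - X (u, 0)) $ 2, (X (c, 0) - X (u, 0)) $ 1] \<and>
      m d - m u = t *\<^sub>R vector [- (X (d, 0) - X (u, 0)) $ 2, (X (d, 0) - X (u, 0)) $ 1]"
    if "m \<in> graph_motions" "linked u c" "linked u d" "linked c d" for m c d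
  proof (rule triangle_rotation)
    show "cross (X (c, 0) - X (u, 0)) (X (d, 0) - X (u, 0)) \<noteq> 0"
      using that linkedD[of u c] linkedD[of u d] linkedD[of c d] by (intro noncollinear) auto
    show "(X (c, 0) - X (u, 0)) \<bullet> (m c - m u) = 0" "(X (d, 0) - X (u, 0)) \<bullet> (m d - m u) = 0"
      using that linked_sym[of u c] linked_sym[of u d] unfolding linked_def by blast+
    show "(X (c, 0) - X (u, 0) - (X (d, 0) - X (u, 0))) \<bullet> (m c - m u - (m d - m u)) = 0"
      using that unfolding linked_def by simp
  qed
  have "(X (x, 0) - X (z, 0)) \<bullet> (m x - m z) = 0" if m: "m \<in> graph_motions" for m
  proof -
    define J :: "real ^ 2 \<Rightarrow> real ^ 2" where "J a = vector [- a $ 2, a $ 1]" for a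
    obtain s where s: "m x - m u = s *\<^sub>R J (X (x, 0) - X (u, 0))" "m y - m u = s *\<^sub>R J (X (y, 0) - X (u, 0))"
      using tri[OF m assms(1,2,4)] unfolding J_def by blast
    obtain t where t: "m y - m u = t *\<^sub>R J (X (y, 0) - X (u, 0))" "m z - m u = t *\<^sub>R J (X (z, 0) - X (u, 0))"
      using tri[OF m assms(2,3,5)] unfolding J_def by blast
    have "J (X (y, 0) - X (u, 0)) \<noteq> 0"
      using distinct_points[of y u] V by (auto simp: J_def vec_eq_iff_2)
    moreover have "s *\<^sub>R J (X (y, 0) - X (u, 0)) = t *\<^sub>R J (X (y, 0) - X (u, 0))"
      by (rule trans[OF s(2)[symmetric] t(1)])
    ultimately have "s = t" using scaleR_cancel_right by blast
    have e: "m x - m z = s *\<^sub>R J (X (x, 0) - X (u, 0)) - s *\<^sub>R J (X (z, 0) - X (u, 0))"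
      using s(1) t(2) \<open>s = t\<close> by (simp add: algebra_simps)
    show ?thesis unfolding e by (simp add: J_def inner_2 algebra_simps)
  qed
  then show ?thesis using V assms by (simp add: linked_def)
qed

text \<open>Links hold in every motion of the graph, so killing the motions of the link system on
  \<open>W\<close> makes every motion of the graph vanish on \<open>W\<close>.\<close>

lemma graph_motions_restrict:
  assumes "m \<in> graph_motions" "W \<subseteq> V"
  shows "(\<lambda>v. if v \<in> W then m v else 0) \<in> motions X (W - pinned) (link_system W)"
  unfolding motions_def
proof (intro CollectI conjI allI impI ballI)
  show "(if v \<in> W then m v else 0) = 0" if "v \<notin> W - pinned" for v using that assms pinnedD by auto
  show "row_value X r (\<lambda>v. if v \<in> W then m v else 0) = 0" if "r \<in> link_system W" for r
    using that assms graph_motions_loop by (auto simp: link_system_def linked_def)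
qed

lemma link_system_mono: "W' \<subseteq> W \<Longrightarrow> link_system W' \<subseteq> link_system W"
  by (auto simp: link_system_def)

lemma link_system_subset: "W \<subseteq> V \<Longrightarrow> link_system W \<subseteq> link_rows V l"
  by (auto simp: link_system_def link_rows_def graph_rows_def)

text \<open>\<open>Y\<close> may differ from \<open>X\<close> in the position and the normals of
  \<open>u\<close>, which the rows within \<open>W - {u}\<close> do not involve.\<close>

lemma motions_remove:
  assumes m: "m \<in> motions Y (W - pinned) (link_system W)" and Y: "\<And>v i. v \<noteq> u \<Longrightarrow> Y (v, i) = X (v, i)"
  shows "m(u := 0) \<in> motions X (W - {u} - pinned) (link_system (W - {u}))"
  unfolding motions_def
proof (intro CollectI conjI allI impI ballI)
  show "(m(u := 0)) v = 0" if "v \<notin> W - {u} - pinned" for v using that m by (auto simp: motions_def)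
  show "row_value X r (m(u := 0)) = 0" if r: "r \<in> link_system (W - {u})" for r
  proof -
    have "r \<in> link_system W" using r link_system_mono[of "W - {u}" W] by blast
    then have "row_value Y r m = 0" using m by (simp add: motions_def)
    moreover have "row_value Y r m = row_value X r (m(u := 0))"
      using r Y by (auto simp: link_system_def)
    ultimately show ?thesis by simp
  qed
qed

lemma sum_remove_zero:
  assumes "W \<subseteq> V"
  shows "(\<Sum>v\<in>W - pinned. (if v = u then 0 else f v) \<bullet> m v) = (\<Sum>v\<in>W - {u} - pinned. f v \<bullet> (m(u := 0)) v)"
proof -
  have "finite W" using assms finV finite_subset by blast
  have "(\<Sum>v\<in>W - pinned. (if v = u then 0 else f v) \<bullet> m v) = (\<Sum>v\<in>W - {u} - pinned. (if v = u then 0 else f v) \<bullet> m v)"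
    using \<open>finite W\<close> by (intro sum.mono_neutral_right) auto
  also have "\<dots> = (\<Sum>v\<in>W - {u} - pinned. f v \<bullet> (m(u := 0)) v)" by (intro sum.cong) auto
  finally show ?thesis .
qed

text \<open>The functionals for \<open>W - {u}\<close> are extended by 0 at \<open>u\<close>. Once
  they have killed the rest of a motion, the \<open>c\<close> new ones only have to finish it at
  \<open>u\<close>.\<close>

lemma dof_insert:
  assumes W: "W \<subseteq> V" "u \<in> W" and k: "dof (W - {u}) k"
    and g: "\<And>m. m \<in> motions X (W - pinned) (link_system W) \<Longrightarrow> (\<And>v. v \<noteq> u \<Longrightarrow> m v = 0) \<Longrightarrow>
      (\<And>i. i < c \<Longrightarrow> g i \<bullet> m u = 0) \<Longrightarrow> m u = 0"
  shows "dof W (k + c)"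
proof -
  obtain f where f: "killed_by X (W - {u} - pinned) (link_system (W - {u})) k f" using k by (auto simp: dof_def)
  define f' where "f' i v = (if i < k then (if v = u then 0 else f i v) else (if v = u then g (i - k) else 0))" for i v
  have "finite W" using W finV finite_subset by blast
  have "m = (\<lambda>_. 0)" if m: "m \<in> motions X (W - pinned) (link_system W)" "\<forall>i<k + c. (\<Sum>v\<in>W - pinned. f' i v \<bullet> m v) = 0" for m
  proof -
    have m0: "m(u := 0) \<in> motions X (W - {u} - pinned) (link_system (W - {u}))" by (rule motions_remove[OF m(1)]) simp
    have "(\<Sum>v\<in>W - {u} - pinned. f i v \<bullet> (m(u := 0)) v) = 0" if "i < k" for i
      using m(2)[rule_format, of i] that sum_remove_zero[OF W(1), of u "f i" m] by (simp add: f'_def)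
    then have "m(u := 0) = (\<lambda>_. 0)" using f m0 unfolding killed_by_def by blast
    then have z: "m v = 0" if "v \<noteq> u" for v using that by (metis fun_upd_other)
    have "m u = 0"
    proof (cases "u \<in> pinned")
      case True
      then show ?thesis using m(1) by (simp add: motions_def)
    next
      case False
      show ?thesis
      proof (rule g[OF m(1) z])
        fix i assume "i < c"
        then have "(\<Sum>v\<in>W - pinned. f' (k + i) v \<bullet> m v) = 0" using m(2) by simp
        moreover have "(\<Sum>v\<in>W - pinned. f' (k + i) v \<bullet> m v) = (\<Sum>v\<in>W - pinned. if v = u then g i \<bullet> m u else 0)"
          by (intro sum.cong) (auto simp: f'_def)
        ultimately show "g i \<bullet> m u = 0" using False W \<open>finite W\<close> by (simp add: sum.delta)
      qed
    qed
    then show ?thesis using z by (intro ext) metis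
  qed
  then show ?thesis unfolding dof_def killed_by_def by blast
qed

text \<open>The abstract 1-extension. Moving \<open>u\<close> alone to a special place makes the
  rows at \<open>u\<close> imply a new condition \<phi> on the other vertices while still fixing
  \<open>u\<close>. As \<phi> is nonzero on the motion \<open>m0\<close>, one functional is saved at
  \<open>Y\<close>, and genericity carries the bound back to \<open>X\<close>.\<close>

lemma dof_bonus:
  assumes W: "W \<subseteq> V" "u \<in> W" and k: "dof (W - {u}) k"
    and m0: "m0 \<in> motions X (W - {u} - pinned) (link_system (W - {u}))"
    and lin: "\<And>a b m n. \<phi> (\<lambda>v. a *\<^sub>R m v + b *\<^sub>R n v) = a * \<phi> m + b * \<phi> n" and ne: "\<phi> m0 \<noteq> (0::real)"
    and Y: "\<And>v i. v \<noteq> u \<Longrightarrow> Y (v, i) = X (v, i)"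
    and H: "\<And>m. m \<in> motions Y (W - pinned) (link_system W) \<Longrightarrow> \<phi> (m(u := 0)) = 0"
      "\<And>m. m \<in> motions Y (W - pinned) (link_system W) \<Longrightarrow> (\<And>v. v \<noteq> u \<Longrightarrow> m v = 0) \<Longrightarrow> m u = 0"
  shows "k \<ge> 1 \<and> dof W (k - 1)"
proof -
  obtain f where f: "killed_by X (W - {u} - pinned) (link_system (W - {u})) k f" using k by (auto simp: dof_def)
  have ex: "k \<ge> 1 \<and> (\<exists>f'. \<forall>m\<in>motions X (W - {u} - pinned) (link_system (W - {u})). \<phi> m = 0 \<longrightarrow>
      (\<forall>i<k - 1. (\<Sum>v\<in>W - {u} - pinned. f' i v \<bullet> m v) = 0) \<longrightarrow> m = (\<lambda>_. 0))"
    by (rule exchange[OF f m0, of \<phi>]) (rule lin, rule ne)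
  then obtain f' where k1: "k \<ge> 1" and f': "\<And>m. m \<in> motions X (W - {u} - pinned) (link_system (W - {u})) \<Longrightarrow> \<phi> m = 0 \<Longrightarrow>
      (\<forall>i<k - 1. (\<Sum>v\<in>W - {u} - pinned. f' i v \<bullet> m v) = 0) \<Longrightarrow> m = (\<lambda>_. 0)"
    by blast
  have "killed_by Y (W - pinned) (link_system W) (k - 1) (\<lambda>i v. if v = u then 0 else f' i v)"
    unfolding killed_by_def
  proof (intro ballI impI)
    fix m assume m: "m \<in> motions Y (W - pinned) (link_system W)"
      and z: "\<forall>i<k - 1. (\<Sum>v\<in>W - pinned. (if v = u then 0 else f' i v) \<bullet> m v) = 0"
    have "(\<Sum>v\<in>W - {u} - pinned. f' i v \<bullet> (m(u := 0)) v) = 0" if "i < k - 1" for i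
      using z[rule_format, OF that] sum_remove_zero[OF W(1), of u "f' i" m] by simp
    then have "m(u := 0) = (\<lambda>_. 0)"
      by (intro f'[OF motions_remove[OF m Y] H(1)[OF m]]) auto
    then have z: "m v = 0" if "v \<noteq> u" for v using that by (metis fun_upd_other)
    moreover have "m u = 0" by (rule H(2)[OF m z])
    ultimately show "m = (\<lambda>_. 0)" by (intro ext) metis
  qed
  then have "dof W (k - 1)"
    unfolding dof_def using W by (intro generic[OF _ link_system_subset]) auto
  then show ?thesis using k1 by simp
qed

end

section \<open>The expected rank for a random order of the vertices\<close>

lemma sum_bound_except_one:
  fixes f :: "'a \<Rightarrow> real"
  assumes "finite Y" "\<And>x. x \<in> Y \<Longrightarrow> x \<noteq> b \<Longrightarrow> c \<le> f x" "b \<in> Y \<Longrightarrow> c - d \<le> f b" "0 \<le> d"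
  shows "real (card Y) * c - d \<le> sum f Y"
proof (cases "b \<in> Y")
  case True
  have "real (card (Y - {b})) * c \<le> sum f (Y - {b})"
    using assms sum_bounded_below[of "Y - {b}" c f] by auto
  moreover have "sum f Y = f b + sum f (Y - {b})" using True assms(1) by (simp add: sum.remove)
  moreover have "real (card Y) = real (card (Y - {b})) + 1"
    using True assms(1) card_Suc_Diff1[of Y b] by linarith
  ultimately show ?thesis using assms(3)[OF True] by (simp add: algebra_simps)
next
  case False
  have "c \<le> f x" if "x \<in> Y" for x using assms(2)[OF that] that False by blast
  then have "real (card Y) * c \<le> sum f Y"
    using sum_bounded_below[of Y c f] by auto
  then show ?thesis using assms(4) by simp
qed

lemma two_elements:
  assumes "card N \<ge> 2"
  shows "\<exists>x y. x \<in> N \<and> y \<in> N \<and> x \<noteq> y"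
proof -
  obtain T where "T \<subseteq> N" "card T = 2" using assms by (rule obtain_subset_with_card_n)
  then show ?thesis unfolding card_2_iff by blast
qed

section \<open>The gain of a vertex and its expectation\<close>

context generic_config
begin

definition links where "links u W = {v \<in> W. linked u v}"
definition link_clique where "link_clique S \<longleftrightarrow> (\<forall>x\<in>S. \<forall>y\<in>S. x \<noteq> y \<longrightarrow> linked x y)"

text \<open>The rank guaranteed when \<open>u\<close> joins \<open>W - {u}\<close>: the degrees of
  freedom change by at most 2 minus the gain. A pinned vertex counts 2, as both its coordinates are
  removed, and earns a third unit if it has an unpinned link.\<close>

definition gain :: "'v \<Rightarrow> 'v set \<Rightarrow> nat" where
  "gain u W =
    (if u \<in> pinned then (if links u W \<subseteq> pinned then 2 else 3)
     else if l u \<ge> 1 then min 3 (1 + card (links u W))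
     else if card (links u W) \<ge> 3 \<and> \<not> link_clique (links u W) then 3 else min 2 (card (links u W)))"

text \<open>A lower bound for the expected gain of \<open>u\<close> in a uniformly random order of
  \<open>W\<close>, where the number \<open>i\<close> of links preceding \<open>u\<close> is uniform
  on 0 to \<open>j\<close>. For \<open>j > 0\<close>, averaging \<open>min 2 i\<close> gives
  \<open>2 - 3 / (j + 1)\<close>, and averaging \<open>min 3 (1 + i)\<close> gives
  \<open>3 - 3 / (j + 1)\<close>. For links that are not a clique, the worst case is a clique of
  \<open>j - 1\<close> and one further vertex: the third unit is earned if that vertex and at least
  two others precede \<open>u\<close>, which adds \<open>1 / 2 - 3 / (j * (j + 1))\<close>. An
  unpinned link precedes a pinned \<open>u\<close> with probability 1/2.\<close>

definition charge :: "'v \<Rightarrow> 'v set \<Rightarrow> real" where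
  "charge u W = (let j = real (card (links u W)) in
    if u \<in> pinned then (if links u W \<subseteq> pinned then 2 else 5 / 2)
    else if l u \<ge> 1 then (if links u W = {} then 1 else 3 - 3 / (j + 1))
    else if link_clique (links u W) then (if links u W = {} then 0 else 2 - 3 / (j + 1))
    else 5 / 2 - 3 / j)"

lemma finite_links: "W \<subseteq> V \<Longrightarrow> finite (links u W)"
  using finite_subset[OF _ finV, of "links u W"] by (auto simp: links_def)

lemma motions_edge:
  assumes "m \<in> motions Y (W - pinned) (link_system W)" "u \<in> W" "x \<in> W" "linked u x"
  shows "(Y (u, 0) - Y (x, 0)) \<bullet> (m u - m x) = 0"
proof -
  have "Edge u x \<in> link_system W" using assms by (auto simp: link_system_def)
  then have "row_value Y (Edge u x) m = 0" using assms(1) unfolding motions_def by blast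
  then show ?thesis by simp
qed

lemma motions_loop:
  assumes "m \<in> motions Y (W - pinned) (link_system W)" "u \<in> W - pinned" "i < l u"
  shows "Y (u, Suc i) \<bullet> m u = 0"
proof -
  have "Loop u i \<in> link_system W" using assms by (auto simp: link_system_def)
  then have "row_value Y (Loop u i) m = 0" using assms(1) unfolding motions_def by blast
  then show ?thesis by simp
qed

lemma motions_supp: "m \<in> motions Y (W - pinned) (link_system W) \<Longrightarrow> v \<notin> W - pinned \<Longrightarrow> m v = 0"
  by (simp add: motions_def)

definition perp :: "real ^ 2 \<Rightarrow> real ^ 2" where "perp a = vector [- a $ 2, a $ 1]"

lemma cross_perp: "cross a (perp a) = a \<bullet> a"
  by (simp add: cross_def perp_def inner_2)

lemma two_constraints:
  assumes "a \<noteq> 0" "a \<bullet> m = 0" "perp a \<bullet> m = 0"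
  shows "m = 0"
  by (rule orthogonal_to_independent[OF _ assms(2,3)]) (simp add: cross_perp assms(1))

lemma dof_step_pinned:
  assumes W: "W \<subseteq> V" "u \<in> W" and k: "dof (W - {u}) k" and u: "u \<in> pinned"
  shows "dof W k"
proof -
  have "dof W (k + 0)"
  proof (rule dof_insert[OF W k, where g = "\<lambda>_. 0"])
    fix m assume "m \<in> motions X (W - pinned) (link_system W)"
    then show "m u = 0" using motions_supp u by blast
  qed
  then show ?thesis by simp
qed

text \<open>In the link system \<open>u\<close> is held still wherever it stands. Placed so that its
  bar to \<open>x\<close> points along \<open>m1 x\<close>, it blocks this motion.\<close>

lemma dof_bonus_pinned:
  assumes W: "W \<subseteq> V" "u \<in> W" and k: "dof (W - {u}) k" and u: "u \<in> pinned"
    and x: "x \<in> W" "x \<notin> pinned" "linked u x"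
  shows "k \<ge> 1 \<and> dof W (k - 1)"
proof -
  obtain m1 where m1: "m1 \<in> graph_motions" "m1 x \<noteq> 0" using not_pinned x W by blast
  have ux: "u \<noteq> x" using x linkedD by blast
  define m0 where "m0 v = (if v \<in> W - {u} then m1 v else 0)" for v
  have m0: "m0 \<in> motions X (W - {u} - pinned) (link_system (W - {u}))"
    unfolding m0_def using graph_motions_restrict[OF m1(1), of "W - {u}"] W by auto
  define Y where "Y = X((u, 0) := X (x, 0) + m1 x)"
  show ?thesis
  proof (rule dof_bonus[OF W k m0, where \<phi> = "\<lambda>m. m1 x \<bullet> m x" and Y = Y])
    show "m1 x \<bullet> (a *\<^sub>R m x + b *\<^sub>R n x) = a * (m1 x \<bullet> m x) + b * (m1 x \<bullet> n x)" for a b and m n :: "'v \<Rightarrow> real ^ 2"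
      by (simp add: inner_add_right)
    show "m1 x \<bullet> m0 x \<noteq> 0" using m1 x ux by (simp add: m0_def)
    show "Y (v, i) = X (v, i)" if "v \<noteq> u" for v i using that by (simp add: Y_def)
    fix m assume m: "m \<in> motions Y (W - pinned) (link_system W)"
    have mu: "m u = 0" using motions_supp[OF m] u by blast
    have "(Y (u, 0) - Y (x, 0)) \<bullet> (m u - m x) = 0" by (rule motions_edge[OF m W(2) x(1,3)])
    then show "m1 x \<bullet> (m(u := 0)) x = 0" using mu ux by (simp add: Y_def)
    show "m u = 0" by (rule mu)
  qed
qed

lemma avoid_two_lines:
  fixes a b :: "real ^ 2"
  assumes "a \<noteq> 0" "b \<noteq> 0"
  obtains n where "n \<bullet> a \<noteq> 0" "cross n b \<noteq> 0"
proof (cases "cross a b = 0")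
  case False
  then show thesis using that[of a] assms by simp
next
  case True
  have "a \<bullet> b \<noteq> 0"
  proof
    assume "a \<bullet> b = 0"
    then have "b = 0" using True
      by (intro two_constraints[OF assms(1)]) (simp_all add: perp_def inner_2 cross_def)
    then show False using assms by simp
  qed
  moreover have "cross (a + perp a) b = cross a b - a \<bullet> b"
    by (simp add: cross_def perp_def inner_2 algebra_simps)
  moreover have "(a + perp a) \<bullet> a = a \<bullet> a" by (simp add: perp_def inner_2 algebra_simps)
  ultimately show thesis using True assms by (intro that[of "a + perp a"]) auto
qed

text \<open>The normal at \<open>u\<close> and the bar to \<open>x\<close> are both given the
  direction \<open>n\<close>: the loop stops \<open>u\<close> in this direction, so the bar stops
  \<open>x\<close>. The bar to \<open>y\<close> is not parallel to \<open>n\<close> and fixes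
  \<open>u\<close> once the other vertices are still.\<close>

lemma dof_bonus_loop:
  assumes W: "W \<subseteq> V" "u \<in> W" and k: "dof (W - {u}) k" and u: "u \<notin> pinned" "l u \<ge> 1"
    and x: "x \<in> W" "linked u x" and y: "y \<in> W" "linked u y" "x \<noteq> y"
  shows "k \<ge> 1 \<and> dof W (k - 1)"
proof -
  have uV: "u \<in> V - pinned" using u W by auto
  have "x \<notin> pinned" using loop_no_pinned_neighbour[OF uV u(2) x(2)] .
  then obtain m1 where m1: "m1 \<in> graph_motions" "m1 x \<noteq> 0" using not_pinned x W by blast
  have ne: "u \<noteq> x" "u \<noteq> y" using x y linkedD by blast+
  define m0 where "m0 v = (if v \<in> W - {u} then m1 v else 0)" for v
  have m0: "m0 \<in> motions X (W - {u} - pinned) (link_system (W - {u}))"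
    unfolding m0_def using graph_motions_restrict[OF m1(1), of "W - {u}"] W by auto
  have "X (x, 0) - X (y, 0) \<noteq> 0" using distinct_points[of x y] x y W by auto
  then obtain n where n: "n \<bullet> m1 x \<noteq> 0" "cross n (X (x, 0) - X (y, 0)) \<noteq> 0"
    using avoid_two_lines[OF m1(2)] by blast
  define Y where "Y = X((u, 0) := X (x, 0) + n, (u, 1) := n)"
  show ?thesis
  proof (rule dof_bonus[OF W k m0, where \<phi> = "\<lambda>m. n \<bullet> m x" and Y = Y])
    show "n \<bullet> (a *\<^sub>R m x + b *\<^sub>R m' x) = a * (n \<bullet> m x) + b * (n \<bullet> m' x)" for a b and m m' :: "'v \<Rightarrow> real ^ 2"
      by (simp add: inner_add_right)
    show "n \<bullet> m0 x \<noteq> 0" using n x ne by (simp add: m0_def)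
    show "Y (v, i) = X (v, i)" if "v \<noteq> u" for v i using that by (simp add: Y_def)
    fix m assume m: "m \<in> motions Y (W - pinned) (link_system W)"
    have "Y (u, Suc 0) \<bullet> m u = 0" using u W by (intro motions_loop[OF m]) auto
    then have nu: "n \<bullet> m u = 0" by (simp add: Y_def)
    have "(Y (u, 0) - Y (x, 0)) \<bullet> (m u - m x) = 0" by (rule motions_edge[OF m W(2) x])
    then show "n \<bullet> (m(u := 0)) x = 0" using nu ne by (simp add: Y_def inner_diff_right)
    assume z: "\<And>v. v \<noteq> u \<Longrightarrow> m v = 0"
    have "(Y (u, 0) - Y (y, 0)) \<bullet> (m u - m y) = 0" by (rule motions_edge[OF m W(2) y(1,2)])
    then have yu: "(X (x, 0) + n - X (y, 0)) \<bullet> m u = 0" using z[of y] ne by (simp add: Y_def)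
    have "cross n (X (x, 0) + n - X (y, 0)) = cross n (X (x, 0) - X (y, 0))"
      by (simp add: cross_def algebra_simps)
    then show "m u = 0" using orthogonal_to_independent[OF _ nu yu] n by simp
  qed
qed

text \<open>With \<open>u\<close> at the midpoint of \<open>x\<close> and \<open>y\<close>, two
  collinear bars act as a bar between \<open>x\<close> and \<open>y\<close>, which some motion
  violates as they are not linked. The third link leaves that line and fixes
  \<open>u\<close>.\<close>

lemma dof_bonus_edge:
  assumes W: "W \<subseteq> V" "u \<in> W" and k: "dof (W - {u}) k" and u: "u \<notin> pinned"
    and x: "x \<in> W" "linked u x" and y: "y \<in> W" "linked u y" "x \<noteq> y" and z: "z \<in> W" "linked u z" "z \<noteq> x" "z \<noteq> y"
    and xy: "\<not> linked x y"
  shows "k \<ge> 1 \<and> dof W (k - 1)"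
proof -
  obtain m1 where m1: "m1 \<in> graph_motions" "(X (x, 0) - X (y, 0)) \<bullet> (m1 x - m1 y) \<noteq> 0"
    using xy x y W by (auto simp: linked_def)
  have ne: "u \<noteq> x" "u \<noteq> y" "u \<noteq> z" using x y z linkedD by blast+
  define m0 where "m0 v = (if v \<in> W - {u} then m1 v else 0)" for v
  have m0: "m0 \<in> motions X (W - {u} - pinned) (link_system (W - {u}))"
    unfolding m0_def using graph_motions_restrict[OF m1(1), of "W - {u}"] W by auto
  define d where "d = X (x, 0) - X (y, 0)"
  define Y where "Y = X((u, 0) := (1 / 2) *\<^sub>R (X (x, 0) + X (y, 0)))"
  have Yx: "Y (u, 0) - Y (x, 0) = - (1 / 2) *\<^sub>R d"
    using ne by (simp add: Y_def d_def vec_eq_iff field_simps)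
  have Yy: "Y (u, 0) - Y (y, 0) = (1 / 2) *\<^sub>R d"
    using ne by (simp add: Y_def d_def vec_eq_iff field_simps)
  show ?thesis
  proof (rule dof_bonus[OF W k m0, where \<phi> = "\<lambda>m. d \<bullet> (m x - m y)" and Y = Y])
    show "d \<bullet> (a *\<^sub>R m x + b *\<^sub>R m' x - (a *\<^sub>R m y + b *\<^sub>R m' y)) = a * (d \<bullet> (m x - m y)) + b * (d \<bullet> (m' x - m' y))"
      for a b and m m' :: "'v \<Rightarrow> real ^ 2"
      by (simp add: inner_add_right inner_diff_right algebra_simps)
    show "d \<bullet> (m0 x - m0 y) \<noteq> 0" using m1 x y ne by (simp add: m0_def d_def)
    show "Y (v, i) = X (v, i)" if "v \<noteq> u" for v i using that by (simp add: Y_def)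
    fix m assume m: "m \<in> motions Y (W - pinned) (link_system W)"
    have mx: "d \<bullet> (m u - m x) = 0" using motions_edge[OF m W(2) x] unfolding Yx by simp
    have my: "d \<bullet> (m u - m y) = 0" using motions_edge[OF m W(2) y(1,2)] unfolding Yy by simp
    show "d \<bullet> ((m(u := 0)) x - (m(u := 0)) y) = 0"
      using mx my ne by (simp add: inner_diff_right)
    assume zero: "\<And>v. v \<noteq> u \<Longrightarrow> m v = 0"
    have du: "d \<bullet> m u = 0" using mx zero[of x] ne by simp
    have zu: "(Y (u, 0) - X (z, 0)) \<bullet> m u = 0"
      using motions_edge[OF m W(2) z(1,2)] zero[of z] ne by (simp add: Y_def)
    have "cross (X (y, 0) - X (x, 0)) (X (z, 0) - X (x, 0)) \<noteq> 0"
      using x y z W by (intro noncollinear) auto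
    moreover have "cross d (Y (u, 0) - X (z, 0)) = cross (X (y, 0) - X (x, 0)) (X (z, 0) - X (x, 0))"
      by (simp add: Y_def d_def cross_def field_simps)
    ultimately show "m u = 0" using orthogonal_to_independent[OF _ du zu] by simp
  qed
qed

text \<open>Each of the first two constraints at \<open>u\<close>, links or a loop, removes one of
  its two degrees of freedom; truncated subtraction stops at 0 for further ones.\<close>

lemma dof_step_free:
  assumes W: "W \<subseteq> V" "u \<in> W" and k: "dof (W - {u}) k" and u: "u \<notin> pinned"
  shows "dof W (k + (2 - (card (links u W) + l u)))"
proof -
  have fin: "finite (links u W)" using W by (intro finite_links) auto
  have l1: "l u \<le> 1" using one_loop u W by blast
  have edge: "(X (u, 0) - X (x, 0)) \<bullet> m u = 0"
    if "m \<in> motions X (W - pinned) (link_system W)" "\<And>v. v \<noteq> u \<Longrightarrow> m v = 0" "x \<in> links u W" for m x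
  proof -
    have "x \<in> W" "linked u x" "x \<noteq> u" using that(3) linkedD by (auto simp: links_def)
    then show ?thesis using motions_edge[OF that(1) W(2), of x] that(2)[of x] by simp
  qed
  have pne: "X (u, 0) - X (x, 0) \<noteq> 0" if "x \<in> links u W" for x
    using that linkedD[of u x] distinct_points[of u x] by (auto simp: links_def)
  consider "card (links u W) + l u = 0" | x where "l u = 0" "links u W = {x}" | "l u = 1" "card (links u W) = 0"
    | x y where "x \<in> links u W" "y \<in> links u W" "x \<noteq> y" | x where "l u = 1" "x \<in> links u W"
  proof -
    consider "l u = 0" | "l u = 1" using l1 by linarith
    then show thesis
    proof cases
      case 1
      consider "card (links u W) = 0" | "card (links u W) = 1" | "card (links u W) \<ge> 2" by linarith
      then show thesis
      proof cases
        case 3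
        then show thesis using that(4) two_elements[of "links u W"] by blast
      qed (use 1 that(1,2) in \<open>auto simp: card_1_singleton_iff\<close>)
    next
      case 2
      then show thesis using that(3,5) fin by (cases "links u W = {}") auto
    qed
  qed
  then show ?thesis
  proof cases
    case 1
    have "dof W (k + 2)"
    proof (rule dof_insert[OF W k, where g = "\<lambda>i. if i = 0 then axis 1 1 else axis 2 1"])
      fix m :: "'v \<Rightarrow> real ^ 2" assume g: "\<And>i :: nat. i < 2 \<Longrightarrow> (if i = 0 then axis 1 1 else axis 2 1) \<bullet> m u = 0"
      show "m u = 0" using g[of 0] g[of 1] by (simp add: inner_axis' vec_eq_iff_2)
    qed
    then show ?thesis using 1 by simp
  next
    case (2 x)
    then have x: "x \<in> links u W" by simp
    have "dof W (k + 1)"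
    proof (rule dof_insert[OF W k, where g = "\<lambda>i. perp (X (u, 0) - X (x, 0))"])
      fix m assume m: "m \<in> motions X (W - pinned) (link_system W)" "\<And>v. v \<noteq> u \<Longrightarrow> m v = 0"
        and g: "\<And>i :: nat. i < 1 \<Longrightarrow> perp (X (u, 0) - X (x, 0)) \<bullet> m u = 0"
      show "m u = 0" by (rule two_constraints[OF pne[OF x] edge[OF m x] g[of 0]]) auto
    qed
    then show ?thesis using 2 by simp
  next
    case 3
    have "dof W (k + 1)"
    proof (rule dof_insert[OF W k, where g = "\<lambda>i. perp (X (u, Suc 0))"])
      fix m assume m: "m \<in> motions X (W - pinned) (link_system W)"
        and g: "\<And>i :: nat. i < 1 \<Longrightarrow> perp (X (u, Suc 0)) \<bullet> m u = 0"
      have "X (u, Suc 0) \<bullet> m u = 0" using 3 u W by (intro motions_loop[OF m]) auto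
      then show "m u = 0"
        using 3 W by (intro two_constraints[OF loop_nonzero[of u 0] _ g[of 0]]) auto
    qed
    then show ?thesis using 3 by simp
  next
    case (4 x y)
    then have "u \<in> V" "x \<in> V" "y \<in> V" "x \<noteq> u" "y \<noteq> u" using linkedD W by (auto simp: links_def)
    then have nc: "cross (X (u, 0) - X (x, 0)) (X (u, 0) - X (y, 0)) \<noteq> 0"
      using noncollinear[of u x y] 4 by (simp add: cross_def algebra_simps)
    have "dof W (k + 0)"
    proof (rule dof_insert[OF W k])
      fix m assume m: "m \<in> motions X (W - pinned) (link_system W)" "\<And>v. v \<noteq> u \<Longrightarrow> m v = 0"
      show "m u = 0" by (rule orthogonal_to_independent[OF nc edge[OF m] edge[OF m]]) (use 4 in auto)
    qed
    moreover have "card {x, y} \<le> card (links u W)" using 4 by (intro card_mono fin) auto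
    ultimately show ?thesis using 4 by simp
  next
    case (5 x)
    then have "u \<in> V" "x \<in> V" "x \<noteq> u" using linkedD W by (auto simp: links_def)
    then have nc: "cross (X (u, 1)) (X (u, 0) - X (x, 0)) \<noteq> 0" by (intro loop_edge) auto
    have "dof W (k + 0)"
    proof (rule dof_insert[OF W k])
      fix m assume m: "m \<in> motions X (W - pinned) (link_system W)" "\<And>v. v \<noteq> u \<Longrightarrow> m v = 0"
      have "X (u, Suc 0) \<bullet> m u = 0" using 5 u W by (intro motions_loop[OF m(1)]) auto
      then show "m u = 0"
        by (intro orthogonal_to_independent[OF nc _ edge[OF m]]) (use 5 in auto)
    qed
    moreover have "card (links u W) \<ge> 1" using 5(2) fin by (simp add: Suc_le_eq card_gt_0_iff) blast
    ultimately show ?thesis using 5 by simp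
  qed
qed

lemma dof_step:
  assumes W: "W \<subseteq> V" "u \<in> W" and k: "dof (W - {u}) k"
  shows "\<exists>k'. dof W k' \<and> k' + gain u W \<le> k + 2"
proof -
  have fin: "finite (links u W)" using W by (intro finite_links) auto
  show ?thesis
  proof (cases "u \<in> pinned")
    case True
    show ?thesis
    proof (cases "links u W \<subseteq> pinned")
      case True
      then show ?thesis
        using dof_step_pinned[OF W k \<open>u \<in> pinned\<close>] \<open>u \<in> pinned\<close> by (intro exI[of _ k]) (simp add: gain_def)
    next
      case False
      then obtain x where "x \<in> W" "x \<notin> pinned" "linked u x" by (auto simp: links_def)
      then have "k \<ge> 1 \<and> dof W (k - 1)" using dof_bonus_pinned[OF W k \<open>u \<in> pinned\<close>] by blast
      then show ?thesis using False \<open>u \<in> pinned\<close> by (intro exI[of _ "k - 1"]) (simp add: gain_def)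
    qed
  next
    case u: False
    have l1: "l u \<le> 1" using one_loop u W by blast
    have plain: ?thesis if "gain u W \<le> 2" "gain u W \<le> card (links u W) + l u"
      using dof_step_free[OF W k u] that by (intro exI[of _ "k + (2 - (card (links u W) + l u))"]) auto
    show ?thesis
    proof (cases "l u \<ge> 1")
      case True
      show ?thesis
      proof (cases "card (links u W) \<ge> 2")
        case True
        then obtain x y where "x \<in> links u W" "y \<in> links u W" "x \<noteq> y" using two_elements[OF True] by blast
        then have "k \<ge> 1 \<and> dof W (k - 1)"
          using dof_bonus_loop[OF W k u \<open>l u \<ge> 1\<close>] by (auto simp: links_def)
        then show ?thesis using u True \<open>l u \<ge> 1\<close> by (intro exI[of _ "k - 1"]) (auto simp: gain_def)
      next
        case False
        then show ?thesis using u \<open>l u \<ge> 1\<close> by (intro plain) (auto simp: gain_def)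
      qed
    next
      case l0: False
      show ?thesis
      proof (cases "card (links u W) \<ge> 3 \<and> \<not> link_clique (links u W)")
        case True
        then obtain x y where xy: "x \<in> links u W" "y \<in> links u W" "x \<noteq> y" "\<not> linked x y" by (auto simp: link_clique_def)
        have "\<not> links u W \<subseteq> {x, y}"
        proof
          assume "links u W \<subseteq> {x, y}"
          then have "card (links u W) \<le> card {x, y}" by (intro card_mono) auto
          then show False using True xy by simp
        qed
        then obtain z where "z \<in> links u W" "z \<noteq> x" "z \<noteq> y" by blast
        then have "k \<ge> 1 \<and> dof W (k - 1)"
          using dof_bonus_edge[OF W k u, of x y z] xy by (auto simp: links_def)
        then show ?thesis using u True l0 by (intro exI[of _ "k - 1"]) (auto simp: gain_def)
      next
        case False
        then show ?thesis using u l0 by (intro plain) (auto simp: gain_def)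
      qed
    qed
  qed
qed

definition min_dof where "min_dof W = (LEAST k. dof W k)"

lemma dof_min_dof: "W \<subseteq> V \<Longrightarrow> dof W (min_dof W)"
proof -
  have "\<exists>k. dof W k" if "W \<subseteq> V" for W
    using finite_subset[OF that finV] that
  proof (induction W rule: finite_induct)
    case empty
    show ?case by (auto simp: dof_def killed_by_def motions_def)
  next
    case (insert u W)
    then obtain k where "dof W k" by auto
    moreover have "insert u W - {u} = W" using insert.hyps by auto
    ultimately show ?case using dof_step[of "insert u W" u k] insert.prems by auto
  qed
  then show "W \<subseteq> V \<Longrightarrow> dof W (min_dof W)" unfolding min_dof_def by (rule LeastI_ex)
qed

lemma min_dof_step:
  assumes "W \<subseteq> V" "u \<in> W"
  shows "min_dof W + gain u W \<le> min_dof (W - {u}) + 2"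
proof -
  have "dof (W - {u}) (min_dof (W - {u}))" using assms by (intro dof_min_dof) auto
  then obtain k where "dof W k" "k + gain u W \<le> min_dof (W - {u}) + 2" using dof_step[OF assms] by blast
  moreover have "min_dof W \<le> k" unfolding min_dof_def by (rule Least_le) fact
  ultimately show ?thesis by simp
qed

lemma links_remove: "links u (W - {x}) = links u W - {x}"
  by (auto simp: links_def)

lemma link_clique_subset: "link_clique S \<Longrightarrow> T \<subseteq> S \<Longrightarrow> link_clique T"
  by (auto simp: link_clique_def)

text \<open>The recursion of an expectation: among \<open>u\<close> and its links in
  \<open>W\<close>, each is last with equal probability. If \<open>u\<close> is last, it earns its
  gain; if a link \<open>x\<close> is last, the situation in \<open>W - {x}\<close> is left.\<close>

lemma charge_step:
  assumes W: "W \<subseteq> V"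
  shows "(real (card (links u W)) + 1) * charge u W \<le> real (gain u W) + (\<Sum>x\<in>links u W. charge u (W - {x}))"
proof -
  define Y where "Y = links u W"
  define j where "j = real (card Y)"
  have fin: "finite Y" unfolding Y_def by (rule finite_links[OF W])
  have card1: "real (card (Y - {x})) = j - 1" if "x \<in> Y" for x
    using card_Suc_Diff1[OF fin that] by (simp add: j_def)
  have rest: "Y - {x} \<noteq> {}" if "x \<in> Y" "j \<ge> 2" for x
  proof
    assume e: "Y - {x} = {}"
    have "card (Y - {x}) = 0" by (simp only: e card.empty)
    then show False using card1[OF that(1)] that(2) by simp
  qed
  have "(j + 1) * charge u W \<le> real (gain u W) + (\<Sum>x\<in>Y. charge u (W - {x}))"
  proof (cases "u \<in> pinned")
    case True
    have h: "charge u (W - {x}) = (if Y - {x} \<subseteq> pinned then 2 else 5 / 2)" for x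
      using True by (simp add: charge_def links_remove Y_def Let_def)
    show ?thesis
    proof (cases "Y \<subseteq> pinned")
      case True
      then have "(\<Sum>x\<in>Y. charge u (W - {x})) = (\<Sum>x\<in>Y. 2)" by (intro sum.cong) (auto simp: h)
      then show ?thesis
        using True \<open>u \<in> pinned\<close> by (simp add: gain_def charge_def Y_def[symmetric] j_def)
    next
      case False
      then obtain b where b: "b \<in> Y" "b \<notin> pinned" by blast
      have "real (card Y) * (5 / 2) - 1 / 2 \<le> (\<Sum>x\<in>Y. charge u (W - {x}))"
      proof (rule sum_bound_except_one[OF fin, of b])
        show "5 / 2 \<le> charge u (W - {x})" if "x \<noteq> b" for x
        proof -
          have "\<not> Y - {x} \<subseteq> pinned" using b that by blast
          then show ?thesis by (simp add: h)
        qed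
      qed (auto simp: h)
      then show ?thesis
        using False \<open>u \<in> pinned\<close> by (simp add: gain_def charge_def Y_def[symmetric] j_def)
    qed
  next
    case u: False
    show ?thesis
    proof (cases "l u \<ge> 1")
      case True
      have h: "charge u (W - {x}) = (if Y - {x} = {} then 1 else 3 - 3 / j)" if "x \<in> Y" for x
        using True u card1[OF that] by (simp add: charge_def links_remove Y_def[symmetric] Let_def)
      have h0: "charge u W = (if Y = {} then 1 else 3 - 3 / (j + 1))"
        using True u by (simp add: charge_def Y_def[symmetric] j_def Let_def)
      have g: "gain u W = min 3 (1 + card Y)" using True u by (simp add: gain_def Y_def)
      consider "Y = {}" | x where "Y = {x}" | "card Y \<ge> 2"
      proof -
        consider "card Y = 0" | "card Y = 1" | "card Y \<ge> 2" by linarith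
        then show thesis using that fin by cases (auto simp: card_1_singleton_iff)
      qed
      then show ?thesis
      proof cases
        case 1
        then show ?thesis by (simp add: h0 g j_def)
      next
        case (2 x)
        then show ?thesis using h[of x] by (simp add: h0 g j_def)
      next
        case 3
        then have jge: "j \<ge> 2" and ne: "Y \<noteq> {}" by (auto simp: j_def)
        have "Y - {x} \<noteq> {}" if "x \<in> Y" for x using rest[OF that] jge by simp
        then have "(\<Sum>x\<in>Y. charge u (W - {x})) = (\<Sum>x\<in>Y. 3 - 3 / j)" by (intro sum.cong) (auto simp: h)
        also have "\<dots> = j * (3 - 3 / j)" by (simp add: j_def)
        also have "\<dots> = 3 * j - 3" using jge by (simp add: right_diff_distrib)
        finally have "(\<Sum>x\<in>Y. charge u (W - {x})) = 3 * j - 3" .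
        moreover have "gain u W = 3" using 3 by (simp add: g)
        moreover have "(j + 1) * charge u W = 3 * j" using ne jge by (simp add: h0 field_simps)
        ultimately show ?thesis by simp
      qed
    next
      case l0: False
      have h: "charge u (W - {x}) = (if link_clique (Y - {x}) then (if Y - {x} = {} then 0 else 2 - 3 / j)
          else 5 / 2 - 3 / (j - 1))" if "x \<in> Y" for x
        using l0 u card1[OF that] by (simp add: charge_def links_remove Y_def[symmetric] Let_def)
      have h0: "charge u W = (if link_clique Y then (if Y = {} then 0 else 2 - 3 / (j + 1)) else 5 / 2 - 3 / j)"
        using l0 u by (simp add: charge_def Y_def[symmetric] j_def Let_def)
      have g: "gain u W = (if card Y \<ge> 3 \<and> \<not> link_clique Y then 3 else min 2 (card Y))"
        using l0 u by (simp add: gain_def Y_def)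
      show ?thesis
      proof (cases "link_clique Y")
        case True
        then have cl: "link_clique (Y - {x})" for x by (rule link_clique_subset) auto
        consider "Y = {}" | x where "Y = {x}" | "card Y \<ge> 2"
        proof -
          consider "card Y = 0" | "card Y = 1" | "card Y \<ge> 2" by linarith
          then show thesis using that fin by cases (auto simp: card_1_singleton_iff)
        qed
        then show ?thesis
        proof cases
          case 1
          then show ?thesis using True by (simp add: h0)
        next
          case (2 x)
          then show ?thesis using True h[of x] cl[of x] by (simp add: h0 g j_def)
        next
          case 3
          then have jge: "j \<ge> 2" and ne: "Y \<noteq> {}" by (auto simp: j_def)
          have "2 - 3 / j \<le> charge u (W - {x})" if "x \<in> Y" for x
          proof -
            have "Y - {x} \<noteq> {}" using rest[OF that] jge by simp
            then show ?thesis using h[OF that] cl by simp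
          qed
          then have "real (card Y) * (2 - 3 / j) \<le> (\<Sum>x\<in>Y. charge u (W - {x}))"
            using sum_bounded_below[of Y "2 - 3 / j"] by auto
          moreover have "j * (2 - 3 / j) = 2 * j - 3" using jge by (simp add: right_diff_distrib)
          ultimately have "2 * j - 3 \<le> (\<Sum>x\<in>Y. charge u (W - {x}))" by (simp add: j_def)
          moreover have "gain u W = 2" using 3 True by (simp add: g)
          moreover have "(j + 1) * charge u W = 2 * j - 1" using ne jge True by (simp add: h0 field_simps)
          ultimately show ?thesis by simp
        qed
      next
        case False
        then obtain a b where ab: "a \<in> Y" "b \<in> Y" "a \<noteq> b" "\<not> linked a b" by (auto simp: link_clique_def)
        have "card {a, b} \<le> card Y" using ab by (intro card_mono fin) auto
        then have c2: "card Y \<ge> 2" using ab by simp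
        show ?thesis
        proof (cases "card Y = 2")
          case True
          then have Y: "Y = {a, b}" using ab fin card_subset_eq[of Y "{a, b}"] by auto
          have "Y - {a} = {b}" "Y - {b} = {a}" using Y ab by auto
          then have "charge u (W - {a}) = 1 / 2" "charge u (W - {b}) = 1 / 2"
            using h[of a] h[of b] ab True by (auto simp: link_clique_def j_def)
          moreover have "(\<Sum>x\<in>Y. charge u (W - {x})) = charge u (W - {a}) + charge u (W - {b})" using Y ab by simp
          moreover have "charge u W = 1" using False True by (simp add: h0 j_def)
          ultimately show ?thesis using True by (simp add: g j_def)
        next
          case False
          then have c3: "card Y \<ge> 3" using c2 by simp
          then have jge: "j \<ge> 3" by (simp add: j_def)
          \<comment> \<open>At most one vertex of \<open>Y\<close> has a clique as its complement in \<open>Y\<close>, by \<open>linked_diamond\<close>.\<close>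
          define b' where "b' = (if link_clique (Y - {a}) then a else b)"
          have other: "\<not> link_clique (Y - {x})" if x: "x \<in> Y" "x \<noteq> b'" for x
          proof
            assume cx: "link_clique (Y - {x})"
            then have "x = a \<or> x = b" using ab by (auto simp: link_clique_def)
            then have "x = b" "link_clique (Y - {a})" using cx x by (auto simp: b'_def split: if_splits)
            then have ca: "link_clique (Y - {a})" "link_clique (Y - {b})" using cx by auto
            have "\<not> Y \<subseteq> {a, b}"
            proof
              assume "Y \<subseteq> {a, b}"
              then have "card Y \<le> card {a, b}" by (intro card_mono) auto
              then show False using c3 ab by simp
            qed
            then obtain c where c: "c \<in> Y" "c \<noteq> a" "c \<noteq> b" by blast
            have "linked a c" "linked c b" using ca c ab by (auto simp: link_clique_def)
            moreover have "linked u a" "linked u b" "linked u c" using ab c by (auto simp: Y_def links_def)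
            ultimately have "linked a b" using ab(3) by (intro linked_diamond[of u a c b])
            then show False using ab by simp
          qed
          \<comment> \<open>The loss if the removal of \<open>b'\<close> leaves a clique. All other
            removals give the full charge, and the resulting bound is exactly the one
            required.\<close>
          define d where "d = (5 / 2 - 3 / (j - 1)) - (2 - 3 / j)"
          have "3 \<le> j * (j - 1) * (1 / 2)"
          proof -
            have "3 * 2 \<le> j * (j - 1)" using jge by (intro mult_mono) auto
            then show ?thesis by simp
          qed
          then have d0: "0 \<le> d" using jge unfolding d_def by (simp add: field_simps)
          have ne: "Y - {x} \<noteq> {}" if "x \<in> Y" for x using rest[OF that] jge by simp
          have "real (card Y) * (5 / 2 - 3 / (j - 1)) - d \<le> (\<Sum>x\<in>Y. charge u (W - {x}))"
          proof (rule sum_bound_except_one[OF fin, of b'])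
            show "5 / 2 - 3 / (j - 1) \<le> charge u (W - {x})" if "x \<in> Y" "x \<noteq> b'" for x
              using h[OF that(1)] other[OF that] by simp
            show "5 / 2 - 3 / (j - 1) - d \<le> charge u (W - {b'})" if "b' \<in> Y"
              using h[OF that] ne[OF that] d0 by (simp add: d_def split: if_splits)
          qed (rule d0)
          moreover have "j * (5 / 2 - 3 / (j - 1)) - d = 5 / 2 * j - 7 / 2 - 3 / j"
          proof -
            have "(j - 1) * (3 / (j - 1)) = 3" using jge by (intro nonzero_mult_div_cancel_left[of "j - 1" 3, unfolded times_divide_eq_right[symmetric]]) simp
            then show ?thesis unfolding d_def by (simp only: left_diff_distrib right_diff_distrib)
          qed
          moreover have "gain u W = 3" using c3 \<open>\<not> link_clique Y\<close> by (simp add: g)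
          moreover have "(j + 1) * charge u W = 5 / 2 * j - 1 / 2 - 3 / j"
            using \<open>\<not> link_clique Y\<close> jge by (simp add: h0 field_simps)
          ultimately show ?thesis by (simp add: j_def[symmetric])
        qed
      qed
    qed
  qed
  then show ?thesis by (simp add: Y_def j_def)
qed

text \<open>The one-step bound is averaged over the last vertex \<open>u\<close> of
  \<open>W\<close>; exchanging the sums lets each vertex \<open>v\<close> collect its own
  expectation. Removing a vertex that is not a link of \<open>v\<close> does not affect the charge
  of \<open>v\<close>.\<close>

lemma min_dof_bound:
  assumes "W \<subseteq> V"
  shows "real (min_dof W) \<le> 2 * real (card W) - (\<Sum>u\<in>W. charge u W)"
  using assms
proof (induction "card W" arbitrary: W)
  case 0
  then have "W = {}" using finite_subset[OF _ finV] by auto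
  moreover have "dof {} 0" by (auto simp: dof_def killed_by_def motions_def)
  then have "min_dof {} = 0" unfolding min_dof_def by (rule Least_eq_0)
  ultimately show ?case by simp
next
  case (Suc n)
  have fin: "finite W" using finite_subset[OF Suc.prems finV] .
  define N where "N = real (card W)"
  have N: "N = real n + 1" "N > 0" using Suc.hyps(2) by (auto simp: N_def)
  have one: "real (min_dof W) \<le> 2 * N - (\<Sum>v\<in>W - {u}. charge v (W - {u})) - real (gain u W)" if u: "u \<in> W" for u
  proof -
    have c: "card (W - {u}) = n" using Suc.hyps(2) u by simp
    then have "real (min_dof (W - {u})) \<le> 2 * real n - (\<Sum>v\<in>W - {u}. charge v (W - {u}))"
      using Suc.hyps(1)[of "W - {u}"] Suc.prems by auto
    moreover have "real (min_dof W) + real (gain u W) \<le> real (min_dof (W - {u})) + 2"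
      using min_dof_step[OF Suc.prems u] by linarith
    ultimately show ?thesis using N by simp
  qed
  have vert: "N * charge v W \<le> (\<Sum>u\<in>W - {v}. charge v (W - {u})) + real (gain v W)" if v: "v \<in> W" for v
  proof -
    have sub: "links v W \<subseteq> W - {v}" using linkedD by (auto simp: links_def)
    have "charge v (W - {u}) = charge v W" if "u \<notin> links v W" for u
    proof -
      have "links v (W - {u}) = links v W" using that by (simp add: links_remove)
      then show ?thesis unfolding charge_def by (simp only:)
    qed
    then have "(\<Sum>u\<in>W - {v} - links v W. charge v (W - {u})) = real (card (W - {v} - links v W)) * charge v W"
      by simp
    moreover have "(\<Sum>u\<in>W - {v}. charge v (W - {u})) =
        (\<Sum>u\<in>W - {v} - links v W. charge v (W - {u})) + (\<Sum>u\<in>links v W. charge v (W - {u}))"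
      using sub fin by (intro sum.subset_diff) auto
    moreover have "real (card (W - {v} - links v W)) = N - 1 - real (card (links v W))"
    proof -
      have "card (W - {v} - links v W) = card (W - {v}) - card (links v W)"
        using sub fin finite_subset[OF sub] by (intro card_Diff_subset) auto
      moreover have "card (links v W) \<le> card (W - {v})" using sub fin by (intro card_mono) auto
      moreover have "card (W - {v}) = card W - 1" "card W \<ge> 1" using v fin Suc.hyps(2) by auto
      ultimately show ?thesis unfolding N_def by linarith
    qed
    ultimately show ?thesis using charge_step[OF Suc.prems, of v] by (simp add: algebra_simps)
  qed
  have "N * real (min_dof W) = (\<Sum>u\<in>W. real (min_dof W))" by (simp add: N_def)
  also have "\<dots> \<le> (\<Sum>u\<in>W. 2 * N - (\<Sum>v\<in>W - {u}. charge v (W - {u})) - real (gain u W))"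
    by (intro sum_mono one)
  also have "\<dots> = N * (2 * N) - (\<Sum>u\<in>W. \<Sum>v\<in>W - {u}. charge v (W - {u})) - (\<Sum>u\<in>W. real (gain u W))"
    by (simp add: sum_subtractf N_def)
  also have "(\<Sum>u\<in>W. \<Sum>v\<in>W - {u}. charge v (W - {u})) = (\<Sum>v\<in>W. \<Sum>u\<in>W - {v}. charge v (W - {u}))"
  proof -
    have eq: "W - {u} = {v \<in> W. v \<noteq> u}" for u by auto
    show ?thesis unfolding eq using sum.swap_restrict[OF fin fin, of "\<lambda>u v. charge v {v \<in> W. v \<noteq> u}" "\<lambda>u v. v \<noteq> u"]
      by (simp add: eq_commute neq_commute)
  qed
  finally have "N * real (min_dof W) \<le> N * (2 * N) - (\<Sum>v\<in>W. (\<Sum>u\<in>W - {v}. charge v (W - {u})) + real (gain v W))"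
    by (simp add: sum.distrib)
  also have "\<dots> \<le> N * (2 * N) - (\<Sum>v\<in>W. N * charge v W)"
    using sum_mono[of W "\<lambda>v. N * charge v W", OF vert] by simp
  also have "\<dots> = N * (2 * N - (\<Sum>v\<in>W. charge v W))" by (simp add: sum_distrib_left algebra_simps)
  finally show ?case using N(2) by (simp add: N_def)
qed

end

section \<open>Rigidity after deleting a vertex\<close>

definition nbhd :: "'v set \<Rightarrow> ('v \<Rightarrow> 'v \<Rightarrow> bool) \<Rightarrow> 'v set \<Rightarrow> 'v set" where
  "nbhd V adj C = {u \<in> V - C. \<exists>c\<in>C. adj c u}"

definition surplus :: "'v set \<Rightarrow> ('v \<Rightarrow> 'v \<Rightarrow> bool) \<Rightarrow> ('v \<Rightarrow> nat) \<Rightarrow> 'v set \<Rightarrow> nat" where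
  "surplus V adj l C = card (nbhd V adj C) + sum l C"

definition grounded :: "nat \<Rightarrow> 'v set \<Rightarrow> ('v \<Rightarrow> 'v \<Rightarrow> bool) \<Rightarrow> ('v \<Rightarrow> nat) \<Rightarrow> bool" where
  "grounded k V adj l \<longleftrightarrow> (\<forall>C\<subseteq>V. C \<noteq> {} \<longrightarrow> k \<le> surplus V adj l C)"

lemma finite_nbhd: "finite V \<Longrightarrow> finite (nbhd V adj C)"
  by (simp add: nbhd_def)

text \<open>The neighbourhoods of intersection and union are covered, with multiplicity, by those of
  the two sets, while loops are counted exactly.\<close>

lemma surplus_submodular:
  assumes V: "finite V" "A \<subseteq> V" "boundary \<subseteq> V"
  shows "surplus V adj l (A \<inter> boundary) + surplus V adj l (A \<union> boundary) \<le> surplus V adj l A + surplus V adj l boundary"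
proof -
  let ?N = "nbhd V adj"
  note fin = finite_nbhd[OF V(1)]
  have "card (?N (A \<inter> boundary)) + card (?N (A \<union> boundary)) =
      card (?N (A \<inter> boundary) \<union> ?N (A \<union> boundary)) + card (?N (A \<inter> boundary) \<inter> ?N (A \<union> boundary))"
    by (rule card_Un_Int[OF fin fin])
  also have "\<dots> \<le> card (?N A \<union> ?N boundary) + card (?N A \<inter> ?N boundary)"
    by (intro add_mono card_mono) (use fin in \<open>auto simp: nbhd_def\<close>)
  also have "\<dots> = card (?N A) + card (?N boundary)" by (rule card_Un_Int[OF fin fin, symmetric])
  finally have N: "card (?N (A \<inter> boundary)) + card (?N (A \<union> boundary)) \<le> card (?N A) + card (?N boundary)" .
  have "sum l (A \<union> boundary) + sum l (A \<inter> boundary) = sum l A + sum l boundary"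
    using V by (intro sum.union_inter) (auto intro: finite_subset)
  then show ?thesis using N by (simp add: surplus_def)
qed

lemma sum_indicator_const:
  assumes "finite W" "T \<subseteq> W"
  shows "(\<Sum>u\<in>W. if u \<in> T then c else 0) = real (card T) * c"
proof -
  have "(\<Sum>u\<in>W. if u \<in> T then c else 0) = (\<Sum>u\<in>T. if u \<in> T then c else 0)"
    using assms by (intro sum.mono_neutral_right) auto
  then show ?thesis by simp
qed

section \<open>Rigid bodies and the count of defects\<close>

context generic_config
begin

text \<open>Such a vertex lies in a single rigid body and never earns the third unit, so its charge
  stays below 2. It is left out of the random order and recovered from its body at the end.\<close>

definition simplicial where "simplicial = {u \<in> V - pinned. l u = 0 \<and> link_clique (links u V)}"
definition body where "body u = insert u (links u V)"
definition boundary where "boundary u = body u - simplicial"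

lemma link_clique_body:
  assumes "s \<in> simplicial"
  shows "link_clique (body s)"
  unfolding link_clique_def
proof (intro ballI impI)
  fix x y assume xy: "x \<in> body s" "y \<in> body s" "x \<noteq> y"
  have c: "link_clique (links s V)" using assms by (simp add: simplicial_def)
  consider "x = s" "linked s y" | "y = s" "linked s x" | "x \<in> links s V" "y \<in> links s V"
    using xy by (auto simp: body_def links_def)
  then show "linked x y"
  proof cases
    case 3
    then show ?thesis using c xy(3) unfolding link_clique_def by blast
  qed (auto intro: linked_sym)
qed

lemma body_iff: "x \<in> body s \<longleftrightarrow> x = s \<or> linked s x"
  using linkedD by (auto simp: body_def links_def)

lemma body_eq:
  assumes "s \<in> simplicial" "t \<in> simplicial" "t \<in> body s"
  shows "body t = body s"
proof -
  have sub: "body b \<subseteq> body a" if "a \<in> simplicial" "b \<in> simplicial" "b \<in> body a" for a b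
  proof
    fix x assume x: "x \<in> body b"
    have "a \<in> body b" using that(3) linked_sym[of a b] unfolding body_iff by blast
    then have "a = x \<or> linked a x" using x link_clique_body[OF that(2)] unfolding link_clique_def by blast
    then show "x \<in> body a" unfolding body_iff by blast
  qed
  have "s \<in> body t" using assms(3) linked_sym[of s t] unfolding body_iff by blast
  then show ?thesis using sub assms by blast
qed

lemma boundary_sub: "s \<in> simplicial \<Longrightarrow> boundary s \<subseteq> V - simplicial"
  by (auto simp: boundary_def body_def links_def simplicial_def)

lemma boundary_neighbours:
  assumes "s \<in> simplicial" "u \<in> boundary s"
  shows "boundary s - {u} \<subseteq> links u (V - simplicial)"
proof
  fix b assume b: "b \<in> boundary s - {u}"
  then have "linked u b" using link_clique_body[OF assms(1)] assms(2) by (auto simp: link_clique_def boundary_def)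
  then show "b \<in> links u (V - simplicial)" using b boundary_sub[OF assms(1)] by (auto simp: links_def)
qed

lemma in_boundary: "s \<in> simplicial \<Longrightarrow> linked u s \<Longrightarrow> u \<notin> simplicial \<Longrightarrow> u \<in> boundary s"
  using linked_sym[of u s] by (auto simp: boundary_def body_iff)

lemma link_trans:
  assumes "a \<in> links u V" "b \<in> links u V" "c \<in> links u V" "a = b \<or> linked a b" "b = c \<or> linked b c"
  shows "a = c \<or> linked a c"
  using assms linked_diamond[of u a b c] by (auto simp: links_def)

text \<open>A simplicial link of \<open>u\<close> is linked to another boundary vertex of its body,
  which is a link of \<open>u\<close> as well. By transitivity among the links of \<open>u\<close>,
  a clique outside \<open>simplicial\<close> would extend to all of them and make \<open>u\<close>
  simplicial.\<close>

lemma not_link_clique_outside: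
  assumes u: "u \<in> V - simplicial - pinned" "l u = 0" and boundary: "\<And>s. s \<in> simplicial \<Longrightarrow> card (boundary s) \<ge> 2"
  shows "\<not> link_clique (links u (V - simplicial))"
proof
  assume cl: "link_clique (links u (V - simplicial))"
  have rep: "\<exists>x'\<in>links u (V - simplicial). x = x' \<or> linked x x'" if x: "x \<in> links u V" for x
  proof (cases "x \<in> simplicial")
    case False
    then show ?thesis using x by (auto simp: links_def)
  next
    case True
    have uB: "u \<in> boundary x" using in_boundary[OF True] x u by (auto simp: links_def)
    have "\<not> boundary x \<subseteq> {u}"
    proof
      assume "boundary x \<subseteq> {u}"
      then have "card (boundary x) \<le> card {u}" by (intro card_mono) auto
      then show False using boundary[OF True] by simp
    qed
    then obtain b where b: "b \<in> boundary x" "b \<noteq> u" by auto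
    have "b \<in> body x" "x \<in> body x" "b \<noteq> x" using b True by (auto simp: boundary_def body_def)
    then have "linked x b" using link_clique_body[OF True] by (auto simp: link_clique_def)
    then show ?thesis using boundary_neighbours[OF True uB] b by blast
  qed
  have "link_clique (links u V)"
    unfolding link_clique_def
  proof (intro ballI impI)
    fix x y assume xy: "x \<in> links u V" "y \<in> links u V" "x \<noteq> y"
    obtain x' where x': "x' \<in> links u (V - simplicial)" "x = x' \<or> linked x x'" using rep xy by blast
    obtain y' where y': "y' \<in> links u (V - simplicial)" "y = y' \<or> linked y y'" using rep xy by blast
    have V': "x' \<in> links u V" "y' \<in> links u V" using x' y' by (auto simp: links_def)
    have "x' = y' \<or> linked x' y'" using cl x' y' by (auto simp: link_clique_def)
    then have "x = y' \<or> linked x y'" using link_trans[of x u x' y'] x' xy V' by blast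
    moreover have "y' = y \<or> linked y' y" using y'(2) linked_sym[of y y'] by blast
    ultimately have "x = y \<or> linked x y" using link_trans[of x u y' y] xy V' by blast
    then show "linked x y" using xy by blast
  qed
  then show False using u by (auto simp: simplicial_def)
qed

text \<open>The set \<open>A\<close> will be a minimal set of surplus 6. Only the vertices with fewer than
  six usable links, all of them near \<open>A\<close>, contribute less than 2 (less than \<open>5/2\<close> with a loop)
  to the rank; the total defect is at most 3, and the excess at the loops is at least \<open>5/2\<close>.\<close>

lemma rigid_of_grounded:
  assumes w: "w \<notin> V" and gr: "grounded 6 (insert w V) adj l" and A: "w \<in> A"
    and tight: "\<And>C. C \<subseteq> V \<Longrightarrow> surplus (insert w V) adj l C = 6 \<Longrightarrow>
      C \<inter> A = {} \<and> card (nbhd (insert w V) adj A) \<le> 6"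
  shows "inf_rigid V adj l X"
proof (cases "V - pinned = {}")
  case True
  have "m = (\<lambda>_. 0)" if "m \<in> graph_motions" for m
  proof
    fix v show "m v = 0" using True pinnedD[of v m] graph_motions_supp[of m v] that by blast
  qed
  then show ?thesis unfolding inf_rigid_def graph_motions_def[symmetric] by blast
next
  case False
  let ?P = "insert w V"
  let ?W = "V - simplicial"
  define NA where "NA = nbhd ?P adj A"
  have finP: "finite ?P" using finV by simp
  have finW: "finite ?W" using finV by simp
  have fNb: "finite (links u ?W)" for u by (rule finite_links) auto
  have ge6: "6 \<le> surplus ?P adj l C" if "C \<subseteq> ?P" "C \<noteq> {}" for C
    using gr that unfolding grounded_def by blast
  have finB: "finite (boundary s)" if "s \<in> simplicial" for s using boundary_sub[OF that] finV finite_subset by blast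
  \<comment> \<open>The simplicial part of a body has neighbours only on the boundary or at
    \<open>w\<close>; its surplus of at least 6 therefore leaves at least five boundary
    vertices.\<close>
  have SX: "nbhd ?P adj (body s \<inter> simplicial) \<subseteq> insert w (boundary s)" if s: "s \<in> simplicial" for s
  proof
    fix x assume x: "x \<in> nbhd ?P adj (body s \<inter> simplicial)"
    then obtain c where c: "c \<in> body s" "c \<in> simplicial" "adj c x" "x \<in> ?P" "x \<notin> body s \<inter> simplicial" by (auto simp: nbhd_def)
    show "x \<in> insert w (boundary s)"
    proof (cases "x = w")
      case False
      then have "linked c x" using c adj_linked[of c x] by (auto simp: simplicial_def)
      then have "x \<in> body c" using linkedD by (auto simp: body_def links_def)
      then show ?thesis using body_eq[OF s c(2,1)] c by (auto simp: boundary_def)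
    qed simp
  qed
  have SXl: "surplus ?P adj l (body s \<inter> simplicial) = card (nbhd ?P adj (body s \<inter> simplicial))" for s
    by (auto simp: surplus_def simplicial_def intro!: sum.neutral)
  have SXV: "body s \<inter> simplicial \<subseteq> V" "s \<in> simplicial \<Longrightarrow> s \<in> body s \<inter> simplicial" for s by (auto simp: simplicial_def body_def)
  have w_B: "w \<notin> boundary s" if "s \<in> simplicial" for s using boundary_sub[OF that] w by auto
  have card_nSX: "6 \<le> card (nbhd ?P adj (body s \<inter> simplicial))" if s: "s \<in> simplicial" for s
    using ge6[of "body s \<inter> simplicial"] SXV[of s] s SXl by auto
  have B5: "5 \<le> card (boundary s)" if s: "s \<in> simplicial" for s
  proof -
    have "card (nbhd ?P adj (body s \<inter> simplicial)) \<le> card (insert w (boundary s))"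
      using finB[OF s] by (intro card_mono SX[OF s]) simp
    then show ?thesis using card_nSX[OF s] finB[OF s] w_B[OF s] by simp
  qed
  \<comment> \<open>A boundary of only five vertices makes the simplicial part tight and adjacent to
    \<open>w\<close>. Being disjoint from \<open>A\<close>, it contains a neighbour of
    \<open>A\<close>.\<close>
  have Btight: "\<exists>n\<in>NA. n \<in> simplicial \<and> boundary n = boundary s" "card NA \<le> 6" if s: "s \<in> simplicial" and c5: "card (boundary s) = 5" for s
  proof -
    have "card (nbhd ?P adj (body s \<inter> simplicial)) \<le> card (insert w (boundary s))"
      using finB[OF s] by (intro card_mono SX[OF s]) simp
    then have c6: "card (nbhd ?P adj (body s \<inter> simplicial)) = 6"
      using card_nSX[OF s] finB[OF s] w_B[OF s] c5 by simp
    then have t: "(body s \<inter> simplicial) \<inter> A = {}" "card NA \<le> 6"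
      using tight[OF SXV(1)] SXl unfolding NA_def by simp_all
    show "card NA \<le> 6" by (rule t)
    have "w \<in> nbhd ?P adj (body s \<inter> simplicial)"
    proof (rule ccontr)
      assume "w \<notin> nbhd ?P adj (body s \<inter> simplicial)"
      then have "nbhd ?P adj (body s \<inter> simplicial) \<subseteq> boundary s" using SX[OF s] by blast
      then have "card (nbhd ?P adj (body s \<inter> simplicial)) \<le> card (boundary s)" by (intro card_mono finB[OF s])
      then show False using c5 c6 by simp
    qed
    then obtain n where n: "n \<in> body s" "n \<in> simplicial" "adj n w" by (auto simp: nbhd_def)
    have "n \<in> NA" using n t(1) A adj_sym[OF n(3)] SXV(1)[of s] unfolding NA_def nbhd_def by blast
    moreover have "boundary n = boundary s" using body_eq[OF s n(2,1)] by (simp add: boundary_def)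
    ultimately show "\<exists>n\<in>NA. n \<in> simplicial \<and> boundary n = boundary s" using n by blast
  qed
  \<comment> \<open>Assigns to a neighbour \<open>n\<close> of \<open>A\<close> the vertices that
    may lack a link on its account: \<open>n\<close> itself, or the five-element boundary of its
    body.\<close>
  define Bs where "Bs n = (if n \<in> simplicial then (if card (boundary n) = 5 then boundary n else {}) else {n})" for n
  define bonus where "bonus u = (if l u \<ge> 1 then 1 / 2 else 0 :: real)" for u
  define Bad where "Bad = {u \<in> ?W - pinned. charge u ?W < 2 + bonus u}"
  \<comment> \<open>With five usable links, a loop counted as one, the values are
    \<open>5 / 2 - 3 / 5\<close> or \<open>3 - 3 / 5\<close>, both short by 1/10; with six they are
    \<open>5 / 2 - 3 / 6 = 2\<close> or \<open>3 - 3 / 6 = 5 / 2\<close>.\<close>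
  have local: "2 + bonus u - 1 / 10 \<le> charge u ?W \<and> (charge u ?W < 2 + bonus u \<longrightarrow>
      (\<exists>n\<in>NA. u \<in> Bs n) \<and> card NA \<le> 6)" if u: "u \<in> ?W - pinned" for u
  proof -
    define j where "j = card (links u ?W)"
    have l1: "l u \<le> 1" using one_loop u by blast
    have nc: "\<not> link_clique (links u ?W)" if "l u = 0"
      using not_link_clique_outside[of u] u that B5 by force
    have j0: "links u ?W = {} \<longleftrightarrow> j = 0" using fNb by (simp add: j_def)
    have h1: "charge u ?W = 3 - 3 / (real j + 1)" if "l u = 1" "j \<ge> 1"
      using that u j0 by (simp add: charge_def Let_def j_def[symmetric])
    have h0: "charge u ?W = 5 / 2 - 3 / real j" if "l u = 0"
      using that u nc by (simp add: charge_def Let_def j_def[symmetric])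
    have fin: ?thesis if P: "5 \<le> j + l u" "j + l u = 5 \<longrightarrow> (\<exists>n\<in>NA. u \<in> Bs n) \<and> card NA \<le> 6"
    proof (cases "l u = 1")
      case True
      then have j4: "real j \<ge> 4" using P(1) by simp
      have h: "charge u ?W = 3 - 3 / (real j + 1)" using h1 True P(1) by simp
      have "3 / (real j + 1) \<le> 3 / 5" using j4 by (intro divide_left_mono) auto
      moreover have "3 / (real j + 1) \<le> 3 / 6" if "j + l u \<noteq> 5"
        using that P(1) True by (intro divide_left_mono) auto
      ultimately show ?thesis using P(2) True h by (auto simp: bonus_def)
    next
      case False
      then have l0: "l u = 0" using l1 by simp
      then have j5: "real j \<ge> 5" using P(1) by simp
      have "3 / real j \<le> 3 / 5" using j5 by (intro divide_left_mono) auto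
      moreover have "3 / real j \<le> 3 / 6" if "j + l u \<noteq> 5"
        using that P(1) l0 by (intro divide_left_mono) auto
      ultimately show ?thesis using P(2) l0 h0 by (auto simp: bonus_def)
    qed
    show ?thesis
    proof (cases "\<exists>s\<in>simplicial. linked u s")
      case True
      then obtain s where s: "s \<in> simplicial" "linked u s" by blast
      have uB: "u \<in> boundary s" using in_boundary s u by blast
      have sub: "boundary s - {u} \<subseteq> links u ?W" by (rule boundary_neighbours[OF s(1) uB])
      have cB: "card (boundary s - {u}) = card (boundary s) - 1" using uB finB[OF s(1)] by simp
      \<comment> \<open>The boundary supplies one link fewer than its size. The missing unit is a
        loop at \<open>u\<close> or else a further link, since the rest of the boundary is a clique
        and the usable links of a loopless \<open>u\<close> are not.\<close>
      have "card (boundary s) \<le> j + l u"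
      proof (cases "l u = 0")
        case True
        have "links u ?W \<noteq> boundary s - {u}"
        proof
          assume e: "links u ?W = boundary s - {u}"
          have "link_clique (boundary s - {u})" by (rule link_clique_subset[OF link_clique_body[OF s(1)]]) (auto simp: boundary_def)
          then show False using nc[OF True] e by simp
        qed
        then have "card (boundary s - {u}) < j" unfolding j_def using sub fNb by (intro psubset_card_mono) auto
        then show ?thesis using cB by simp
      next
        case False
        have "card (boundary s - {u}) \<le> j" unfolding j_def by (intro card_mono fNb sub)
        then show ?thesis using cB False by simp
      qed
      then have P1: "5 \<le> j + l u" and P2: "j + l u = 5 \<longrightarrow> card (boundary s) = 5"
        using B5[OF s(1)] by simp_all
      show ?thesis
      proof (rule fin[OF P1], rule impI)
        assume "j + l u = 5"
        then have c5: "card (boundary s) = 5" using P2 by simp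
        obtain n where "n \<in> NA" "n \<in> simplicial" "boundary n = boundary s" using Btight(1)[OF s(1) c5] by blast
        then have "u \<in> Bs n" using uB c5 by (simp add: Bs_def)
        then show "(\<exists>n\<in>NA. u \<in> Bs n) \<and> card NA \<le> 6" using \<open>n \<in> NA\<close> Btight(2)[OF s(1) c5] by blast
      qed
    next
      case False
      \<comment> \<open>Without simplicial links, every neighbour of \<open>u\<close> other than
        \<open>w\<close> is a usable link.\<close>
      have sub: "nbhd ?P adj {u} \<subseteq> insert w (links u ?W)"
        using False u adj_linked[of u] by (auto simp: nbhd_def links_def)
      have s6: "6 \<le> card (nbhd ?P adj {u}) + l u" using ge6[of "{u}"] u by (simp add: surplus_def)
      have wN: "w \<notin> links u ?W" using w by (auto simp: links_def)
      have "card (nbhd ?P adj {u}) \<le> card (insert w (links u ?W))" using fNb by (intro card_mono sub) simp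
      then have le: "card (nbhd ?P adj {u}) \<le> Suc j" using wN fNb by (simp add: j_def)
      have P1: "5 \<le> j + l u" using le s6 by simp
      show ?thesis
      proof (rule fin[OF P1], rule impI)
        assume j5: "j + l u = 5"
        then have "surplus ?P adj l {u} = 6" using le s6 by (simp add: surplus_def)
        then have t: "{u} \<inter> A = {}" "card NA \<le> 6" using tight[of "{u}"] u unfolding NA_def by auto
        have "w \<in> nbhd ?P adj {u}"
        proof (rule ccontr)
          assume "w \<notin> nbhd ?P adj {u}"
          then have "nbhd ?P adj {u} \<subseteq> links u ?W" using sub by blast
          then have "card (nbhd ?P adj {u}) \<le> j" unfolding j_def by (intro card_mono fNb)
          then show False using s6 j5 by simp
        qed
        then have "adj w u" using adj_sym[of u w] by (simp add: nbhd_def)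
        then have "u \<in> NA" using t(1) A u unfolding NA_def nbhd_def by blast
        moreover have "u \<in> Bs u" using u by (simp add: Bs_def)
        ultimately show "(\<exists>n\<in>NA. u \<in> Bs n) \<and> card NA \<le> 6" using t(2) by blast
      qed
    qed
  qed
  have cBad: "card Bad \<le> 30"
  proof (cases "Bad = {}")
    case False
    then obtain u where "u \<in> Bad" by blast
    then have c6: "card NA \<le> 6" using local by (auto simp: Bad_def)
    have finNA: "finite NA" unfolding NA_def by (rule finite_nbhd[OF finP])
    have cBs: "card (Bs n) \<le> 5" "finite (Bs n)" for n using finB by (auto simp: Bs_def)
    have "Bad \<subseteq> (\<Union>n\<in>NA. Bs n)" using local by (auto simp: Bad_def)
    then have "card Bad \<le> card (\<Union>n\<in>NA. Bs n)" using finNA cBs by (intro card_mono) auto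
    also have "\<dots> \<le> (\<Sum>n\<in>NA. card (Bs n))" by (rule card_UN_le[OF finNA])
    also have "\<dots> \<le> (\<Sum>n\<in>NA. 5)" by (intro sum_mono cBs)
    also have "\<dots> \<le> 30" using c6 by simp
    finally show ?thesis .
  qed simp
  define L where "L = {u \<in> V - pinned. l u \<ge> 1}"
  define ZL where "ZL = {z \<in> pinned. \<not> links z ?W \<subseteq> pinned}"
  have ZV: "pinned \<subseteq> ?W" by (auto simp: pinned_def simplicial_def)
  have LW: "L \<subseteq> ?W" by (auto simp: L_def simplicial_def)
  \<comment> \<open>The surplus of the set of unpinned vertices is at least 6. At most one unit
    comes from \<open>w\<close>; the others are loops, at most one for each unpinned vertex, and
    adjacent pinned vertices.\<close>
  have att: "5 \<le> card L + card ZL"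
  proof -
    have "nbhd ?P adj (V - pinned) \<subseteq> insert w ZL"
    proof
      fix z assume z: "z \<in> nbhd ?P adj (V - pinned)"
      then obtain u where u: "u \<in> V" "u \<notin> pinned" "adj u z" by (auto simp: nbhd_def)
      show "z \<in> insert w ZL"
      proof (cases "z = w")
        case False
        then have zZ: "z \<in> pinned" "z \<in> V" using z by (auto simp: nbhd_def)
        have linked: "linked u z" "linked z u" using adj_linked[OF u(1) zZ(2) u(3)] linked_sym[of u z] by blast+
        show ?thesis
        proof (cases "u \<in> simplicial")
          case False
          then have "u \<in> links z ?W" using linked u by (auto simp: links_def)
          then show ?thesis using u zZ by (auto simp: ZL_def)
        next
          case True
          \<comment> \<open>If \<open>z\<close> is attached only through a simplicial vertex
            \<open>u\<close>, then \<open>z\<close> is the only pinned link of \<open>u\<close>, and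
            the other boundary vertices of the body are unpinned links of \<open>z\<close>.\<close>
          have zB: "z \<in> boundary u" using in_boundary[OF True linked(2)] zZ ZV by blast
          have "\<not> boundary u \<subseteq> {z}"
          proof
            assume "boundary u \<subseteq> {z}"
            then have "card (boundary u) \<le> card {z}" by (intro card_mono) auto
            then show False using B5[OF True] by simp
          qed
          then obtain b where b: "b \<in> boundary u" "b \<noteq> z" by auto
          then have "linked u b" using True by (auto simp: boundary_def body_def links_def)
          then have "b \<notin> pinned" using one_pinned_neighbour[of u b z] linked u zZ b by blast
          moreover have "b \<in> links z ?W" using boundary_neighbours[OF True zB] b by blast
          ultimately show ?thesis using zZ by (auto simp: ZL_def)
        qed
      qed simp
    qed
    then have "card (nbhd ?P adj (V - pinned)) \<le> card (insert w ZL)"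
      using finite_subset[OF ZV finW] by (intro card_mono) (auto simp: ZL_def)
    also have "\<dots> \<le> Suc (card ZL)" by (simp add: card_insert_le_m1 card_insert_if finite_subset[OF _ finV])
    finally have n: "card (nbhd ?P adj (V - pinned)) \<le> Suc (card ZL)" .
    have "sum l (V - pinned) = (\<Sum>u\<in>V - pinned. if u \<in> L then 1 else 0)"
      using one_loop by (intro sum.cong) (force simp: L_def)+
    also have "\<dots> = card L" using finV by (simp add: L_def sum.If_cases Int_def)
    finally have "sum l (V - pinned) = card L" by simp
    moreover have "6 \<le> surplus ?P adj l (V - pinned)" using False by (intro ge6) blast+
    ultimately show ?thesis using n by (simp add: surplus_def)
  qed
  have "L \<inter> ZL = {}" by (auto simp: L_def ZL_def)
  define T where "T = L \<union> ZL"
  have finT: "finite L" "finite ZL" using finite_subset[OF LW finW] finite_subset[OF ZV finW] by (auto simp: ZL_def)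
  have T5: "5 \<le> card T" unfolding T_def using att \<open>L \<inter> ZL = {}\<close> finT by (simp add: card_Un_disjoint)
  have TW: "T \<subseteq> ?W" using LW ZV by (auto simp: T_def ZL_def)
  have BW: "Bad \<subseteq> ?W" by (auto simp: Bad_def)
  have pt: "2 + (if u \<in> T then 1 / 2 else 0) + (if u \<in> Bad then - 1 / 10 else 0) \<le> charge u ?W"
    if u: "u \<in> ?W" for u
  proof (cases "u \<in> pinned")
    case True
    then have "u \<notin> Bad" "u \<in> T \<longleftrightarrow> \<not> links u ?W \<subseteq> pinned" by (auto simp: Bad_def T_def L_def ZL_def)
    then show ?thesis using True by (simp add: charge_def Let_def)
  next
    case False
    then have "(if u \<in> T then 1 / 2 else 0) = bonus u" using u by (auto simp: T_def L_def ZL_def bonus_def)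
    moreover have "u \<in> Bad \<longleftrightarrow> charge u ?W < 2 + bonus u" using u False by (auto simp: Bad_def)
    ultimately show ?thesis using local[of u] u False by auto
  qed
  have "2 * real (card ?W) + real (card T) * (1 / 2) + real (card Bad) * (- 1 / 10) =
      (\<Sum>u\<in>?W. 2 + (if u \<in> T then 1 / 2 else 0) + (if u \<in> Bad then - 1 / 10 else 0))"
    by (simp only: sum.distrib sum_indicator_const[OF finW TW] sum_indicator_const[OF finW BW]) simp
  also have "\<dots> \<le> (\<Sum>u\<in>?W. charge u ?W)" by (intro sum_mono pt)
  finally have "real (min_dof ?W) \<le> real (card Bad) * (1 / 10) - real (card T) * (1 / 2)"
    using min_dof_bound[of ?W] by auto
  \<comment> \<open>The difference is 1/2, so the natural number \<open>min_dof\<close> is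
    0.\<close>
  also have "\<dots> \<le> 30 * (1 / 10) - 5 * (1 / 2)" using cBad T5 by (intro diff_mono mult_right_mono) auto
  finally have "min_dof ?W = 0" by simp
  then have "dof ?W 0" using dof_min_dof[of ?W] by auto
  then obtain f where f: "killed_by X (?W - pinned) (link_system ?W) 0 f" by (auto simp: dof_def)
  have "m = (\<lambda>_. 0)" if m: "m \<in> graph_motions" for m
  proof -
    have "(\<lambda>v. if v \<in> ?W then m v else 0) \<in> motions X (?W - pinned) (link_system ?W)" by (rule graph_motions_restrict[OF m]) auto
    then have "(\<lambda>v. if v \<in> ?W then m v else 0) = (\<lambda>_. 0)" using f unfolding killed_by_def by blast
    then have W0: "m v = 0" if "v \<in> ?W" for v using that by meson
    \<comment> \<open>A simplicial vertex is linked to two boundary vertices, which are already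
      known to be still.\<close>
    have S0: "m s = 0" if s: "s \<in> simplicial" for s
    proof -
      obtain a b where ab: "a \<in> boundary s" "b \<in> boundary s" "a \<noteq> b"
        using two_elements[of "boundary s"] B5[OF s] by auto
      have linked: "linked s a" "linked s b" using ab s by (auto simp: boundary_def body_def links_def)
      have "cross (X (a, 0) - X (s, 0)) (X (b, 0) - X (s, 0)) \<noteq> 0"
        using linked linkedD[OF linked(1)] linkedD[OF linked(2)] ab by (intro noncollinear) auto
      then have nc: "cross (X (s, 0) - X (a, 0)) (X (s, 0) - X (b, 0)) \<noteq> 0"
        by (simp add: cross_def algebra_simps)
      have "(X (s, 0) - X (a, 0)) \<bullet> m s = 0" "(X (s, 0) - X (b, 0)) \<bullet> m s = 0"
        using linked m W0[of a] W0[of b] ab boundary_sub[OF s] unfolding linked_def by force+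
      then show ?thesis by (rule orthogonal_to_independent[OF nc])
    qed
    show ?thesis
    proof
      fix v show "m v = 0" using W0[of v] S0[of v] graph_motions_supp[OF m, of v] by blast
    qed
  qed
  then show ?thesis unfolding inf_rigid_def graph_motions_def[symmetric] by blast
qed

end

section \<open>Weakly balanced graphs\<close>

text \<open>Let \<open>A\<close> be a smallest nonempty set of surplus 6 and \<open>w\<close> one of
  its vertices. A set of surplus 6 that avoids \<open>w\<close> and meets \<open>A\<close> would, by
  submodularity, meet it in a smaller set of this kind. If there is no such set at all, any vertex
  serves.\<close>

lemma rigid_vertex_deletion:
  assumes P: "finite P" "P \<noteq> {}" and adj: "\<And>u v. adj u v \<Longrightarrow> adj v u" "\<And>v. \<not> adj v v"
    and gr: "grounded 6 P adj l"
  shows "\<exists>w\<in>P. \<exists>X. inf_rigid (P - {w}) adj l X"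
proof -
  let ?T = "\<lambda>C. C \<subseteq> P \<and> C \<noteq> {} \<and> surplus P adj l C = 6"
  have ge6: "6 \<le> surplus P adj l C" if "C \<subseteq> P" "C \<noteq> {}" for C
    using gr that unfolding grounded_def by blast
  have ne: "C \<noteq> {}" if "surplus P adj l C = 6" for C
  proof
    assume "C = {}"
    then show False using that by (simp add: surplus_def nbhd_def)
  qed
  obtain w A where wA: "w \<in> P" "w \<in> A"
    and tight: "\<And>C. C \<subseteq> P - {w} \<Longrightarrow> surplus P adj l C = 6 \<Longrightarrow> C \<inter> A = {} \<and> card (nbhd P adj A) \<le> 6"
  proof (cases "\<exists>C. ?T C")
    case False
    obtain w where w: "w \<in> P" using P by blast
    have "\<not> surplus P adj l C = 6" if "C \<subseteq> P - {w}" for C using False ne[of C] that by blast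
    then show thesis using that[of w "{w}"] w by blast
  next
    case True
    define A where "A = (ARG_MIN card A. ?T A)"
    obtain C0 where C0: "?T C0" using True by blast
    have A: "?T A" and min: "\<And>C. ?T C \<Longrightarrow> card A \<le> card C"
      unfolding A_def using arg_min_natI[of ?T C0 card] arg_min_nat_le[of ?T _ card] C0 by blast+
    have finA: "finite A" using A P finite_subset by blast
    obtain w where w: "w \<in> A" using A by blast
    have "C \<inter> A = {}" if C: "C \<subseteq> P - {w}" "surplus P adj l C = 6" for C
    proof (rule ccontr)
      assume i: "C \<inter> A \<noteq> {}"
      have "surplus P adj l (C \<inter> A) + surplus P adj l (C \<union> A) \<le> 6 + 6"
        using surplus_submodular[of P C A adj l] P A C by auto
      moreover have "6 \<le> surplus P adj l (C \<union> A)" using A C by (intro ge6) auto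
      moreover have "6 \<le> surplus P adj l (C \<inter> A)" using A i by (intro ge6) auto
      ultimately have "surplus P adj l (C \<inter> A) = 6" by linarith
      then have "card A \<le> card (C \<inter> A)" using A i by (intro min) auto
      moreover have "card (C \<inter> A) < card A" using finA w C by (intro psubset_card_mono) auto
      ultimately show False by simp
    qed
    moreover have "card (nbhd P adj A) \<le> 6" using A unfolding surplus_def by linarith
    ultimately show thesis using that[of w A] w A by blast
  qed
  obtain X where "generic_config (P - {w}) adj l X"
    using generic_config_exists[of "P - {w}" adj l] P adj by blast
  then interpret generic_config "P - {w}" adj l X .
  have ins: "insert w (P - {w}) = P" using wA by blast
  have "inf_rigid (P - {w}) adj l X"
  proof (rule rigid_of_grounded)
    show "grounded 6 (insert w (P - {w})) adj l" using gr ins by simp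
    show "C \<inter> A = {} \<and> card (nbhd (insert w (P - {w})) adj A) \<le> 6"
      if "C \<subseteq> P - {w}" "surplus (insert w (P - {w})) adj l C = 6" for C
      using tight that unfolding ins by blast
  qed (use wA in auto)
  then show ?thesis using wA by blast
qed

text \<open>If \<open>C\<close> meets \<open>N\<close>, the clique gives it exactly the former
  neighbours of \<open>insert w C\<close>, and \<open>w\<close> brings no loops. Otherwise its
  neighbours are unchanged.\<close>

lemma grounded_delete_loopless:
  assumes P: "finite V" "w \<notin> V" and adj: "\<And>u v. adj u v \<Longrightarrow> adj v u"
    and gr: "grounded k (insert w V) adj l" and lw: "l w = 0" and N: "N = {v \<in> V. adj w v}"
  shows "grounded k V (\<lambda>u v. adj u v \<or> (u \<in> N \<and> v \<in> N \<and> u \<noteq> v)) l"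
  unfolding grounded_def
proof (intro allI impI)
  let ?adj = "\<lambda>u v. adj u v \<or> (u \<in> N \<and> v \<in> N \<and> u \<noteq> v)"
  fix C assume C: "C \<subseteq> V" "C \<noteq> {}"
  show "k \<le> surplus V ?adj l C"
  proof (cases "C \<inter> N = {}")
    case True
    have "\<not> adj c w" if "c \<in> C" for c using that True C adj[of c w] unfolding N by blast
    then have "nbhd V ?adj C = nbhd (insert w V) adj C"
      using True unfolding nbhd_def by blast
    then have "surplus V ?adj l C = surplus (insert w V) adj l C" by (simp add: surplus_def)
    moreover have "k \<le> surplus (insert w V) adj l C" using gr C unfolding grounded_def by blast
    ultimately show ?thesis by simp
  next
    case False
    then obtain c where c: "c \<in> C" "c \<in> N" by blast
    have "nbhd V ?adj C = nbhd (insert w V) adj (insert w C)"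
    proof (intro equalityI subsetI)
      fix x assume "x \<in> nbhd V ?adj C"
      then show "x \<in> nbhd (insert w V) adj (insert w C)" using P N unfolding nbhd_def by blast
    next
      fix x assume x: "x \<in> nbhd (insert w V) adj (insert w C)"
      then have "x \<in> V" "x \<notin> C" "(\<exists>c\<in>C. adj c x) \<or> adj w x" unfolding nbhd_def by blast+
      then show "x \<in> nbhd V ?adj C" using c N unfolding nbhd_def by blast
    qed
    moreover have "sum l (insert w C) = sum l C"
      using C P finite_subset[OF C(1)] lw by (subst sum.insert) auto
    ultimately have "surplus V ?adj l C = surplus (insert w V) adj l (insert w C)"
      by (simp add: surplus_def)
    moreover have "insert w C \<subseteq> insert w V" "insert w C \<noteq> {}" using C by auto
    then have "k \<le> surplus (insert w V) adj l (insert w C)" using gr unfolding grounded_def by blast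
    ultimately show ?thesis by simp
  qed
qed

text \<open>A set that meets \<open>N\<close> receives \<open>k\<close> loops at once, which
  explains their number; any other set was not adjacent to \<open>w\<close> and keeps its
  surplus.\<close>

lemma grounded_delete_looped:
  assumes P: "finite V" "w \<notin> V" and adj: "\<And>u v. adj u v \<Longrightarrow> adj v u"
    and gr: "grounded k (insert w V) adj l" and N: "N = {v \<in> V. adj w v}"
  shows "grounded k V adj (\<lambda>v. if v \<in> N then l v + k else l v)"
  unfolding grounded_def
proof (intro allI impI)
  let ?l = "\<lambda>v. if v \<in> N then l v + k else l v"
  fix C assume C: "C \<subseteq> V" "C \<noteq> {}"
  have finC: "finite C" using C P finite_subset by blast
  show "k \<le> surplus V adj ?l C"
  proof (cases "C \<inter> N = {}")
    case True
    have "\<not> adj c w" if "c \<in> C" for c using that True C adj[of c w] unfolding N by blast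
    then have "nbhd V adj C = nbhd (insert w V) adj C" unfolding nbhd_def by blast
    moreover have "sum ?l C = sum l C" using True by (intro sum.cong) auto
    ultimately have "surplus V adj ?l C = surplus (insert w V) adj l C" by (simp add: surplus_def)
    moreover have "k \<le> surplus (insert w V) adj l C" using gr C unfolding grounded_def by blast
    ultimately show ?thesis by simp
  next
    case False
    then obtain c where c: "c \<in> C" "c \<in> N" by blast
    have "k \<le> ?l c" using c by simp
    also have "\<dots> \<le> sum ?l C" using c finC by (intro member_le_sum) auto
    finally show ?thesis by (simp add: surplus_def)
  qed
qed

theorem grounded_rigid:
  assumes "finite V" and adj: "\<And>u v. adj u v \<Longrightarrow> adj v u" "\<And>v. \<not> adj v v"
    and "grounded 6 V adj l"
  shows "\<exists>X. inf_rigid V adj l X \<and> glob_rigid V adj l X"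
  using assms
proof (induction "card V" arbitrary: V adj l)
  case 0
  then have V: "V = {}" by simp
  have "inf_rigid {} adj l (\<lambda>_. 0)" by (rule inf_rigidI) simp
  moreover have "glob_rigid {} adj l (\<lambda>_. 0)" by (simp add: glob_rigid_def)
  ultimately show ?case unfolding V by blast
next
  case (Suc n)
  have "V \<noteq> {}" using Suc.hyps(2) by auto
  obtain w X1 where w: "w \<in> V" and rigid: "inf_rigid (V - {w}) adj l X1"
    using rigid_vertex_deletion[OF Suc.prems(1) \<open>V \<noteq> {}\<close> Suc.prems(2-4)] by blast
  define V' where "V' = V - {w}"
  have V': "V = insert w V'" "w \<notin> V'" "finite V'" "n = card V'"
    using w Suc.prems(1) Suc.hyps(2) by (auto simp: V'_def)
  define N where "N = {v \<in> V'. adj w v}"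
  have rigid': "inf_rigid V' adj l X1" using rigid by (simp add: V'_def)
  have gr: "grounded 6 (insert w V') adj l" using Suc.prems(4) V'(1) by simp
  have "nbhd (insert w V') adj {w} = N" using V'(2) by (auto simp: nbhd_def N_def)
  \<comment> \<open>The surplus of \<open>{w}\<close> yields what the deletion of \<open>w\<close>
    asks for: three neighbours without a loop, two neighbours with one loop, or two loops.\<close>
  then have six: "6 \<le> card N + l w" using gr unfolding grounded_def surplus_def by force
  show ?case
  proof (cases "l w = 0")
    case True
    let ?adj = "\<lambda>u v. adj u v \<or> (u \<in> N \<and> v \<in> N \<and> u \<noteq> v)"
    have "grounded 6 V' ?adj l"
      by (rule grounded_delete_loopless[OF V'(3,2) Suc.prems(2) gr True N_def])
    then obtain X0 where X0: "inf_rigid V' ?adj l X0" "glob_rigid V' ?adj l X0"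
      using Suc.hyps(1)[OF V'(4,3), of ?adj l] Suc.prems(2,3) by blast
    have "3 \<le> card N" using six True by simp
    from delete_loopless_vertex[OF V'(3,2) N_def this True rigid' X0] show ?thesis
      unfolding V'(1) .
  next
    case False
    let ?l = "\<lambda>v. if v \<in> N then l v + 6 else l v"
    have "grounded 6 V' adj ?l"
      by (rule grounded_delete_looped[OF V'(3,2) Suc.prems(2) gr N_def])
    then obtain X0 where X0: "inf_rigid V' adj ?l X0" "glob_rigid V' adj ?l X0"
      using Suc.hyps(1)[OF V'(4,3), of adj ?l] Suc.prems(2,3) by blast
    have "l w \<ge> 2 \<or> (l w = 1 \<and> card N \<ge> 2)" using six False by linarith
    from delete_looped_vertex[OF V'(3,2) N_def this rigid' X0] show ?thesis
      unfolding V'(1) .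
  qed
qed

text \<open>After deleting the neighbourhood \<open>T\<close> of \<open>C\<close>, a component that
  starts in \<open>C\<close> cannot leave it, so the loops it must contain are loops at
  \<open>C\<close>.\<close>

lemma grounded_of_weakly_balanced:
  assumes G: "looped_simple_graph G" and wb: "weakly_balanced k G"
  shows "grounded k (verts G) (\<lambda>u v. {u, v} \<in> edges G) (\<lambda>v. card {l \<in> loops G. loop_at G l = v})"
  unfolding grounded_def
proof (intro allI impI)
  let ?adj = "\<lambda>u v. {u, v} \<in> edges G"
  let ?l = "\<lambda>v. card {l \<in> loops G. loop_at G l = v}"
  fix C assume C: "C \<subseteq> verts G" "C \<noteq> {}"
  interpret looped_simple_graph G by (rule G)
  define T where "T = nbhd (verts G) ?adj C"
  show "k \<le> surplus (verts G) ?adj ?l C"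
  proof (cases "k \<le> card T")
    case True
    then show ?thesis by (simp add: surplus_def T_def)
  next
    case False
    obtain c where c: "c \<in> C" using C by blast
    let ?G = "delete_verts G T"
    define C0 where "C0 = connectivity ?G `` {c}"
    have TC: "T \<inter> C = {}" by (auto simp: T_def nbhd_def)
    then have "c \<in> verts ?G" using c C by (auto simp: delete_verts_def)
    then have C0: "C0 \<in> components ?G"
      unfolding components_def C0_def by (rule quotientI)
    have T: "T \<subseteq> verts G" by (auto simp: T_def nbhd_def)
    have "y \<in> C" if "(c, y) \<in> {(x, y). {x, y} \<in> edges ?G}\<^sup>*" for y
      using that
    proof (induction rule: rtrancl_induct)
      case base
      show ?case by (rule c)
    next
      case (step x y)
      then have e: "{x, y} \<in> edges G" "y \<notin> T" by (auto simp: delete_verts_def)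
      then have "y \<in> verts G" using edge_subset[OF e(1)] by blast
      then show ?case using e step.IH unfolding T_def nbhd_def by blast
    qed
    then have C0C: "C0 \<subseteq> C" by (auto simp: C0_def connectivity_def)
    have "k - card T \<le> card (loops_in ?G C0)"
      using wb T C0 False unfolding weakly_balanced_def by auto
    also have "\<dots> \<le> card (\<Union>v\<in>C. {l \<in> loops G. loop_at G l = v})"
      using C0C finite_loops C finite_verts
      by (intro card_mono) (auto simp: loops_in_def delete_verts_def intro: finite_subset)
    also have "\<dots> \<le> sum ?l C"
      using finite_subset[OF C(1) finite_verts] by (rule card_UN_le)
    finally show ?thesis using False by (simp add: surplus_def T_def)
  qed
qed

section \<open>Density of algebraically independent families\<close>

lemma countable_finitely_supported:
  assumes "countable S"
  shows "countable {P :: 'm \<Rightarrow>\<^sub>0 'b::{zero,countable}. Poly_Mapping.keys P \<subseteq> S}"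
proof -
  let ?A = "{P :: 'm \<Rightarrow>\<^sub>0 'b. Poly_Mapping.keys P \<subseteq> S}"
  let ?g = "\<lambda>P. (\<lambda>m. (m, Poly_Mapping.lookup P m)) ` Poly_Mapping.keys P"
  have "countable {F. finite F \<and> F \<subseteq> S \<times> (UNIV :: 'b set)}"
    using assms by (intro countable_Collect_finite_subset countable_SIGMA) auto
  moreover have "?g ` ?A \<subseteq> {F. finite F \<and> F \<subseteq> S \<times> UNIV}" by auto
  ultimately have "countable (?g ` ?A)" by (rule countable_subset[rotated])
  moreover have "inj_on ?g ?A"
  proof (rule inj_onI)
    fix P Q :: "'m \<Rightarrow>\<^sub>0 'b" assume eq: "?g P = ?g Q"
    show "P = Q"
    proof (rule poly_mapping_eqI)
      fix m
      have "(m, Poly_Mapping.lookup R m) \<in> ?g R \<longleftrightarrow> Poly_Mapping.lookup R m \<noteq> 0" for R :: "'m \<Rightarrow>\<^sub>0 'b"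
        by (auto simp: in_keys_iff)
      moreover have "b = Poly_Mapping.lookup R m" if "(m, b) \<in> ?g R" for R b using that by auto
      ultimately show "Poly_Mapping.lookup P m = Poly_Mapping.lookup Q m" using eq by metis
    qed
  qed
  ultimately show ?thesis by (rule countable_image_inj_on)
qed

lemma countable_monomials:
  assumes "finite I"
  shows "countable {m :: 'i \<Rightarrow>\<^sub>0 nat. Poly_Mapping.keys m \<subseteq> I}"
  using countable_finitely_supported[of I] assms by (simp add: countable_finite)

text \<open>Seen as a polynomial in \<open>t\<close>, the coefficient of an occurring power is a
  nonzero rational polynomial in the other variables, so it cannot vanish at independent
  values.\<close>

lemma univariate_section:
  fixes P :: "('i \<Rightarrow>\<^sub>0 nat) \<Rightarrow>\<^sub>0 rat"
  assumes ind: "algebraically_independent_over_rat I c"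
    and P: "P \<noteq> 0" "\<And>m. m \<in> Poly_Mapping.keys P \<Longrightarrow> Poly_Mapping.keys m \<subseteq> insert i I"
  shows "finite {t. eval_poly (c(i := t)) P = 0}"
proof -
  let ?lk = "Poly_Mapping.lookup" and ?K = "Poly_Mapping.keys"
  define a where "a m = of_rat (?lk P m) * (\<Prod>k\<in>?K m - {i}. c k ^ ?lk m k)" for m
  define R where "R = (\<Sum>m\<in>?K P. monom (a m) (?lk m i))"
  have "eval_poly (c(i := t)) P = poly R t" for t
  proof -
    have "(\<Prod>k\<in>?K m. (c(i := t)) k ^ ?lk m k) = (\<Prod>k\<in>?K m - {i}. c k ^ ?lk m k) * t ^ ?lk m i" for m
    proof (cases "i \<in> ?K m")
      case True
      then have "(\<Prod>k\<in>?K m. (c(i := t)) k ^ ?lk m k) = t ^ ?lk m i * (\<Prod>k\<in>?K m - {i}. (c(i := t)) k ^ ?lk m k)"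
        by (simp add: prod.remove)
      also have "(\<Prod>k\<in>?K m - {i}. (c(i := t)) k ^ ?lk m k) = (\<Prod>k\<in>?K m - {i}. c k ^ ?lk m k)"
        by (intro prod.cong) auto
      finally show ?thesis by simp
    next
      case False
      then have "?K m - {i} = ?K m" "?lk m i = 0" by (auto simp: in_keys_iff)
      moreover have "(\<Prod>k\<in>?K m. (c(i := t)) k ^ ?lk m k) = (\<Prod>k\<in>?K m. c k ^ ?lk m k)"
        using False by (intro prod.cong) auto
      ultimately show ?thesis by simp
    qed
    then show ?thesis by (simp add: eval_poly_def R_def a_def poly_sum poly_monom mult.assoc)
  qed
  moreover have "R \<noteq> 0"
  proof
    assume R: "R = 0"
    obtain m0 where m0: "m0 \<in> ?K P" using P(1) by (metis ex_in_conv keys_eq_empty)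
    define n where "n = ?lk m0 i"
    \<comment> \<open>Erasing the variable \<open>i\<close> is injective on monomials with a fixed
      exponent of \<open>i\<close>, so no terms of the coefficient cancel.\<close>
    define strip where "strip m = Poly_Mapping.update i 0 m" for m :: "'i \<Rightarrow>\<^sub>0 nat"
    have lk_strip: "?lk (strip m) = (?lk m)(i := 0)" for m
      by (simp add: strip_def update.rep_eq)
    have K_strip: "?K (strip m) = ?K m - {i}" for m
      by (simp add: strip_def keys_update)
    define A where "A = {m \<in> ?K P. ?lk m i = n}"
    have inj: "inj_on strip A"
    proof (rule inj_onI)
      fix m m' assume mA: "m \<in> A" "m' \<in> A" and eq: "strip m = strip m'"
      have "((?lk m)(i := 0)) k = ((?lk m')(i := 0)) k" for k
        using arg_cong[OF eq, of "\<lambda>m. ?lk m k"] unfolding lk_strip .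
      then have "?lk m k = ?lk m' k" for k
        using mA by (cases "k = i") (auto simp: A_def dest: meta_spec[of _ k])
      then show "m = m'" by (rule poly_mapping_eqI)
    qed
    define Q where "Q = (\<Sum>m\<in>A. Poly_Mapping.single (strip m) (?lk P m))"
    have finA: "finite A" by (simp add: A_def)
    have lkQ: "?lk Q (strip m) = ?lk P m" if m: "m \<in> A" for m
    proof -
      have "?lk Q (strip m) = (\<Sum>m'\<in>A. if m' = m then ?lk P m else 0)"
        unfolding Q_def lookup_sum
      proof (intro sum.cong refl)
        fix m' assume "m' \<in> A"
        then show "?lk (Poly_Mapping.single (strip m') (?lk P m')) (strip m) = (if m' = m then ?lk P m else 0)"
          using inj m by (auto simp: lookup_single when_def inj_on_def)
      qed
      then show ?thesis using m finA by (simp add: sum.delta)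
    qed
    have KQ: "?K Q = strip ` A"
    proof
      have "?lk Q m = 0" if "m \<notin> strip ` A" for m
        using that unfolding Q_def lookup_sum by (intro sum.neutral) (auto simp: lookup_single when_def)
      then show "?K Q \<subseteq> strip ` A" by (auto simp: in_keys_iff)
      show "strip ` A \<subseteq> ?K Q" using lkQ by (auto simp: in_keys_iff A_def)
    qed
    have "eval_poly c Q = (\<Sum>m\<in>A. a m)"
    proof -
      have "eval_poly c Q = (\<Sum>m\<in>A. of_rat (?lk Q (strip m)) * (\<Prod>k\<in>?K (strip m). c k ^ ?lk (strip m) k))"
        unfolding eval_poly_def KQ by (simp only: sum.reindex[OF inj] o_def)
      also have "\<dots> = (\<Sum>m\<in>A. a m)"
      proof (intro sum.cong refl)
        fix m assume "m \<in> A"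
        moreover have "(\<Prod>k\<in>?K (strip m). c k ^ ?lk (strip m) k) = (\<Prod>k\<in>?K m - {i}. c k ^ ?lk m k)"
          unfolding K_strip by (intro prod.cong) (auto simp: lk_strip)
        ultimately show "of_rat (?lk Q (strip m)) * (\<Prod>k\<in>?K (strip m). c k ^ ?lk (strip m) k) = a m"
          by (simp add: lkQ a_def)
      qed
      finally show ?thesis .
    qed
    also have "\<dots> = coeff R n"
      by (simp add: R_def coeff_sum A_def sum.If_cases Int_def)
    finally have "eval_poly c Q = 0" using R by simp
    moreover have "\<forall>m\<in>?K Q. ?K m \<subseteq> I" using P(2) by (auto simp: KQ K_strip A_def)
    ultimately have "Q = 0" using ind unfolding algebraically_independent_over_rat_def by blast
    moreover have "strip m0 \<in> ?K Q" using m0 by (simp add: KQ A_def n_def)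
    ultimately show False by simp
  qed
  ultimately show ?thesis using poly_roots_finite[of R] by simp
qed

text \<open>Coordinates are chosen one after another: countably many polynomials exclude finitely
  many values each, while the values that keep the point in \<open>U\<close> contain an
  interval.\<close>

lemma algebraically_independent_dense:
  fixes U :: "('i \<Rightarrow> real) set"
  assumes "finite I" "open U" "U \<noteq> {}"
  shows "\<exists>c\<in>U. algebraically_independent_over_rat I c"
  using assms(1)
proof (induction I rule: finite_induct)
  case empty
  obtain c where c: "c \<in> U" using assms by blast
  have "algebraically_independent_over_rat {} c"
    unfolding algebraically_independent_over_rat_def
  proof (intro allI impI)
    fix P :: "('i \<Rightarrow>\<^sub>0 nat) \<Rightarrow>\<^sub>0 rat"
    assume "\<forall>m\<in>Poly_Mapping.keys P. Poly_Mapping.keys m \<subseteq> {}" and e: "eval_poly c P = 0"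
    then have K: "Poly_Mapping.keys P \<subseteq> {0}" by auto
    have "eval_poly c P = (\<Sum>m\<in>{0}. of_rat (Poly_Mapping.lookup P m) *
        (\<Prod>i\<in>Poly_Mapping.keys m. c i ^ Poly_Mapping.lookup m i))"
      unfolding eval_poly_def
      by (rule sum.mono_neutral_left) (use K in \<open>auto simp: in_keys_iff\<close>)
    then have "eval_poly c P = of_rat (Poly_Mapping.lookup P 0)" by simp
    then have "Poly_Mapping.lookup P 0 = 0" using e by simp
    then show "P = 0" using K by (auto simp: in_keys_iff keys_eq_empty[symmetric] simp del: keys_eq_empty)
  qed
  then show ?case using c by blast
next
  case (insert i I)
  then obtain c where c: "c \<in> U" "algebraically_independent_over_rat I c" by blast
  define \<P> where "\<P> = {P :: ('i \<Rightarrow>\<^sub>0 nat) \<Rightarrow>\<^sub>0 rat. P \<noteq> 0 \<and> Poly_Mapping.keys P \<subseteq> {m. Poly_Mapping.keys m \<subseteq> insert i I}}"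
  have "countable \<P>"
    using countable_finitely_supported[OF countable_monomials[of "insert i I"], where 'b = rat] insert.hyps
    by (rule_tac countable_subset[rotated]) (auto simp: \<P>_def)
  moreover have "countable {t. eval_poly (c(i := t)) P = 0}" if "P \<in> \<P>" for P
    using that by (intro countable_finite univariate_section[OF c(2)]) (auto simp: \<P>_def)
  ultimately have "countable (\<Union>P\<in>\<P>. {t. eval_poly (c(i := t)) P = 0})"
    by (rule countable_UN)
  moreover have "uncountable {t. c(i := t) \<in> U}"
  proof -
    have "continuous_on UNIV (\<lambda>t. (c(i := t)) k)" for k by (cases "k = i") auto
    then have "continuous_on UNIV (\<lambda>t. c(i := t))"
      by (intro continuous_on_coordinatewise_then_product) auto
    then have "open ((\<lambda>t. c(i := t)) -` U)" using assms(2) by (intro open_vimage) auto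
    moreover have "(\<lambda>t. c(i := t)) -` U = {t. c(i := t) \<in> U}" by auto
    ultimately have "open {t. c(i := t) \<in> U}" by simp
    moreover have "c i \<in> {t. c(i := t) \<in> U}" using c by simp
    ultimately obtain e where "e > 0" "ball (c i) e \<subseteq> {t. c(i := t) \<in> U}" using openE by blast
    then show ?thesis using uncountable_ball[of e "c i"] countable_subset by blast
  qed
  ultimately obtain t where t: "c(i := t) \<in> U" "t \<notin> (\<Union>P\<in>\<P>. {t. eval_poly (c(i := t)) P = 0})"
    using countable_subset by (metis (no_types, lifting) mem_Collect_eq subsetI)
  have "algebraically_independent_over_rat (insert i I) (c(i := t))"
    unfolding algebraically_independent_over_rat_def using t(2) by (auto simp: \<P>_def)
  then show ?case using t(1) by blast
qed

lemma coordinate_vec: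
  "coordinate (\<lambda>v. \<chi> j. c (Inl v, j)) (\<lambda>l. \<chi> j. c (Inr l, j)) = c"
proof
  fix x show "coordinate (\<lambda>v. \<chi> j. c (Inl v, j)) (\<lambda>l. \<chi> j. c (Inr l, j)) x = c x"
    by (cases x rule: coordinate.cases[of "(undefined, undefined, x)" for x, simplified]) auto
qed

theorem theorem5p1:
  fixes G :: "('v, 'l) looped_graph"
  assumes "looped_simple_graph G"
    and "weakly_balanced 6 G"
  shows "globally_L_rigid TYPE(2) G"
proof -
  interpret looped_simple_graph G by (rule assms(1))
  define V where "V = verts G"
  define adj where "adj u v \<longleftrightarrow> {u, v} \<in> edges G" for u v
  define A where "A v = {x \<in> loops G. loop_at G x = v}" for v
  define l where "l v = card (A v)" for v
  have finA: "finite (A v)" for v using finite_loops by (simp add: A_def)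
  have "adj v u" if "adj u v" for u v using that by (simp add: adj_def insert_commute)
  moreover have "\<not> adj v v" for v using edge_card[of "{v, v}"] by (auto simp: adj_def)
  moreover have "grounded 6 V adj l"
    using grounded_of_weakly_balanced[OF assms] by (simp add: V_def adj_def[abs_def] l_def[abs_def] A_def)
  moreover have "finite V" using finite_verts by (simp add: V_def)
  ultimately obtain X0 where X0: "inf_rigid V adj l X0" "glob_rigid V adj l X0"
    using grounded_rigid[of V adj l] by blast
  obtain \<Omega> where \<Omega>: "open \<Omega>" "X0 \<in> \<Omega>" "\<And>X. X \<in> \<Omega> \<Longrightarrow> glob_rigid V adj l X"
    using glob_rigid_stable[OF \<open>finite V\<close> X0] by blast
  have "\<exists>h. bij_betw h {0..<l v} (A v)" for v
    unfolding l_def by (rule ex_bij_betw_nat_finite[OF finA])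
  \<comment> \<open>Numbers the named loops at each vertex, to match them with the numbered normals
    of a configuration.\<close>
  then obtain h where h: "bij_betw (h v) {0..<l v} (A v)" for v by metis
  \<comment> \<open>Turns a family of coordinates into a configuration. Indices beyond the loops of
    a vertex keep the entries of \<open>X0\<close>, so that \<open>X0\<close> itself is reached, at
    \<open>c0\<close>.\<close>
  define C where "C c = (\<lambda>(v, k). case k of 0 \<Rightarrow> \<chi> j. c (Inl v, j)
    | Suc i \<Rightarrow> if i < l v then \<chi> j. c (Inr (h v i), j) else X0 (v, k))" for c :: "('v + 'l) \<times> 2 \<Rightarrow> real"
  define c0 where "c0 = (\<lambda>(x, j). case x of Inl v \<Rightarrow> X0 (v, 0) $ j
    | Inr y \<Rightarrow> X0 (loop_at G y, Suc (inv_into {0..<l (loop_at G y)} (h (loop_at G y)) y)) $ j)"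
  have "C c0 = X0"
  proof
    fix x :: "'v \<times> nat"
    obtain v k where x: "x = (v, k)" by force
    show "C c0 x = X0 x"
    proof (cases k)
      case 0
      then show ?thesis by (simp add: x C_def c0_def vec_eq_iff)
    next
      case (Suc i)
      show ?thesis
      proof (cases "i < l v")
        case True
        then have i: "i \<in> {0..<l v}" by simp
        have "h v i \<in> A v" using bij_betwE[OF h[of v]] i by blast
        then have "loop_at G (h v i) = v" by (simp add: A_def)
        moreover have "inv_into {0..<l v} (h v) (h v i) = i"
          by (rule inv_into_f_f[OF bij_betw_imp_inj_on[OF h] i])
        ultimately show ?thesis using True by (simp add: x Suc C_def c0_def vec_eq_iff)
      next
        case False
        then show ?thesis by (simp add: x Suc C_def)
      qed
    qed
  qed
  have "continuous_on UNIV C"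
  proof (intro continuous_on_coordinatewise_then_product)
    fix x :: "'v \<times> nat"
    obtain v k where x: "x = (v, k)" by force
    have "continuous_on UNIV (\<lambda>c :: ('v + 'l) \<times> 2 \<Rightarrow> real. \<chi> j. c (y, j))" for y
      by (intro continuous_on_vec_lambda continuous_on_product_coordinates)
    then show "continuous_on UNIV (\<lambda>c. C c x)"
    proof (cases k)
      case (Suc i)
      then show ?thesis using \<open>\<And>y. continuous_on UNIV (\<lambda>c. \<chi> j. c (y, j))\<close>
        by (cases "i < l v") (simp_all add: x C_def)
    qed (simp add: x C_def)
  qed
  then have "open (C -` \<Omega>)" using \<Omega>(1) by (intro open_vimage) auto
  moreover have "C -` \<Omega> \<noteq> {}" using \<open>C c0 = X0\<close> \<Omega>(2) by blast
  moreover have "finite ((verts G <+> loops G) \<times> (UNIV :: 2 set))"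
    using finite_verts finite_loops by simp
  ultimately obtain c where c: "C c \<in> \<Omega>"
    and ind: "algebraically_independent_over_rat ((verts G <+> loops G) \<times> UNIV) c"
    using algebraically_independent_dense[of "(verts G <+> loops G) \<times> UNIV" "C -` \<Omega>"] by blast
  define p q where "p = (\<lambda>v. \<chi> j. c (Inl v, j))" and "q = (\<lambda>x. \<chi> j. c (Inr x, j))"
  have "generic_framework G p q"
    unfolding generic_framework_def p_def q_def coordinate_vec by (rule ind)
  moreover have "globally_rigid_framework G p q"
    unfolding globally_rigid_framework_def
  proof (intro allI impI)
    fix p' assume eq: "equivalent_frameworks G p p' q"
    have pC: "C c (v, 0) = p v" for v by (simp add: C_def p_def)
    have "equivalent_placement V adj l (C c) p'"
      unfolding equivalent_placement_def
    proof (intro conjI ballI allI impI)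
      fix u v assume "adj u v"
      then show "(norm (p' u - p' v))\<^sup>2 = (norm (C c (u, 0) - C c (v, 0)))\<^sup>2"
        using eq unfolding equivalent_frameworks_def adj_def pC by metis
    next
      fix v i assume i: "i < l v"
      then have "h v i \<in> A v" using bij_betwE[OF h[of v]] by auto
      then have "h v i \<in> loops G" "loop_at G (h v i) = v" by (auto simp: A_def)
      moreover have "C c (v, Suc i) = q (h v i)" using i by (simp add: C_def q_def)
      ultimately show "p' v \<bullet> C c (v, Suc i) = C c (v, 0) \<bullet> C c (v, Suc i)"
        using eq unfolding equivalent_frameworks_def pC by metis
    qed
    then show "\<forall>v\<in>verts G. p' v = p v" using \<Omega>(3)[OF c] unfolding glob_rigid_def V_def pC by blast
  qed
  ultimately show ?thesis unfolding globally_L_rigid_def by blast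
qed

end
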